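(* Let $\mathbb X$ and $\mathbb X'$ be tangent categories, where $\mathbb X$ has a terminal object $*$, and let $(A,\zeta,\sigma,\lambda)$ be a differential object in $\mathbb X$. Then evaluation at $A$, which sends a differential functor $(F,\hat\alpha)$ to the differential bundle $(F(A),F( * ),F(!),F(\zeta),F(\sigma),\hat\alpha_{W,A}\circ F(\lambda))$ and a morphism $\varphi:F\Rightarrow F'$ to $(\varphi_A,\varphi_* )$, gives four functors: (a) $\mathrm{Eval}_A:\mathrm{DiffFun}(\mathbb X,\mathbb X')\to\mathrm{DBun}_{\mathrm{add}}(\mathbb X')$, (b) $\mathrm{Eval}_A:\mathrm{DiffFun}_{\mathrm{lin}}(\mathbb X,\mathbb X')\to\mathrm{DBun}_{\mathrm{lin}}(\mathbb X')$, (c) $\mathrm{Eval}_A:\mathrm{DiffFun}^{\mathrm{strong}}(\mathbb X,\mathbb X')\to\mathrm{DObj}_{\mathrm{add}}(\mathbb X')$, (d) $\mathrm{Eval}_A:\mathrm{DiffFun}^{\mathrm{strong}}_{\mathrm{lin}}(\mathbb X,\mathbb X')\to\mathrm{DObj}_{\mathrm{lin}}(\mathbb X')$.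
   Context: **Weil algebras and tangent actegories.** $\mathrm{Weil}$ is the category whose objects are the commutative $\mathbb N$-algebras (semirings) $\mathbb N[x_1,\dots,x_n]/\langle x_ix_j\mid i\sim j\rangle$ for an equivalence relation $\sim$ on $\{1,\dots,n\}$, with unital $\mathbb N$-linear semiring homomorphisms as morphisms. It is monoidal under the coproduct $\otimes$ with unit $\mathbb N$ (also terminal). $W=\mathbb N[x]/\langle x^2\rangle$; $W^n=\mathbb N[x_1,\dots,x_n]/\langle x_ix_j \mid \text{all } i,j\rangle$ is the $n$-fold product in $\mathrm{Weil}$; every object has the form $W^{n_1}\otimes\cdots\otimes W^{n_k}$. Distinguished morphisms: $p:W\to\mathbb N$, $ax+b\mapsto b$; $0:\mathbb N\to W$ the inclusion; $+:W\times W\to W$, $ax_1+bx_2+c\mapsto (a+b)x+c$; $\ell:W\to W\otimes W$, $ax+b\mapsto ax_1x_2+b$; $c:W\otimes W\to W\otimes W$ swapping $x_1,x_2$. A $\mathrm{Weil}$-actegory $(\mathbb X,T_\bullet)$ is a category with a functor $T_\bullet:\mathrm{Weil}\times\mathbb X\to\mathbb X$ and natural isomorphisms $X\cong T_\bullet(\mathbb N,X)$, $T_\bullet(A,T_\bullet(B,X))\cong T_\bullet(A\otimes B,X)$ satisfying the usual associativity and unit coherences. Write $T_A=T_\bullet(A,-)$ and $T_\theta$ for the natural transformation given by a morphism $\theta$ of $\mathrm{Weil}$. It is a tangent actegory if for each object $X$ the functor $T_{(-)}(X)$ sends to pullbacks: (i) the squares exhibiting $A\otimes(B\times C)$ as the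 pullback of $A\otimes B\to A\leftarrow A\otimes C$, whenever $B\times C$ exists in $\mathrm{Weil}$; (ii) the squares obtained by applying $W^{\otimes n}\otimes-$, $n\ge0$, to the pullback square with top $\nu:W\times W\to W\otimes W$, $\nu(ax_1+bx_2+c)=ax_1x_2+bx_2+c$, right side $1_W\otimes p:W\otimes W\to W$, left side the unique map $W\times W\to\mathbb N$ and bottom $0:\mathbb N\to W$. Tangent categories are identified with tangent actegories, with tangent functor $T:=T_W$ and structure maps $p:=T_p,\ 0:=T_0,\ +:=T_+,\ \ell:=T_\ell,\ c:=T_c$, under the identifications $T_{W\otimes W}=T\circ T$, $T_n:=T_{W^n}$. **Differential bundles.** An additive bundle $(X,A,p,+,0)$: a morphism $p:X\to A$ with pullback powers $X_n$ of $p$ over $A$, and $+:X_2\to X$, $0:A\to X$ with $p\circ +=p\circ\pi_0=p\circ\pi_1$, $p\circ0=1_A$, and $+$ associative, commutative and with unit $0$. An additive bundle morphism $(f,g)$ is a pair $f:X\to Y$, $g:A\to B$ with $p'f=gp$, $f\circ+=+'\circ f_2$, $f\circ0=0'\circ g$. A differential bundle $(E,M,q,\zeta,\sigma,\lambda)$ in $(\mathbb X,T)$ consists of $q:E\to M$ whose finite pullback powers $E_n$ exist and are preserved by all $T^k$; $\zeta:M\to E$, $\sigma:E_2\to E$ making $(E,M,q,\sigma,\zeta)$ an additive bundle; and $\lambda:E\to TE$ such that $(\lambda,0_M)$ is an additive bundle morphism to $(TE,TM,Tq,T\sigma,T\zeta)$, $(\lambda,\zeta)$ is an additive bundle morphism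 to $(TE,E,p_E,+_E,0_E)$, $\ell_E\circ\lambda=T(\lambda)\circ\lambda$, and the square with top $T(\sigma)\circ\langle\lambda\pi_0,0\pi_1\rangle:E_2\to TE$, left $q\pi_0:E_2\to M$, bottom $0_M:M\to TM$, right $T(q)$ is a pullback. A differential object is a differential bundle over a terminal object $*$. A morphism of differential bundles $(f,g)$ is a pair $f:E\to E'$, $g:M\to M'$ with $q'f=gq$; it is additive if $f\sigma=\sigma'f_2$ and $f\zeta=\zeta'g$, and linear if $\lambda'f=T(f)\lambda$. $\mathrm{DBun}_{\mathrm{add}}$, $\mathrm{DBun}_{\mathrm{lin}}$ are the categories of differential bundles with additive, resp. linear, morphisms, and $\mathrm{DObj}_{\mathrm{add}}$, $\mathrm{DObj}_{\mathrm{lin}}$ their full subcategories on differential objects (empty if there is no terminal object). **Differential functors.** An oplax $\mathrm{Weil}$-linear functor $(F,\hat\alpha):(\mathbb X,T_\bullet)\to(\mathbb X',T'_\bullet)$ is a functor $F$ with a natural transformation $\hat\alpha:F\circ T_\bullet\Rightarrow T'_\bullet\circ(1\times F)$, components $\hat\alpha_{A,X}:F(T_AX)\to T'_A(FX)$, satisfying (modulo the structure isomorphisms) $\hat\alpha_{A\otimes B,X}=T'_A(\hat\alpha_{B,X})\circ\hat\alpha_{A,T_BX}$ and $\hat\alpha_{\mathbb N,X}=1_{FX}$. Suppose $\mathbb X$ has a terminal object $*$. $(F,\hat\alpha)$ is a lax differential functor if for all $A\in\mathrm{Weil}$: (a) $T'_A\circ F$ preserves pullbacks over $*$, and (b) all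 naturality squares of $\hat\alpha_{A,-}:F\circ T_A\Rightarrow T'_A\circ F$ are pullbacks; it is strong if moreover $F( * )$ is terminal. $\mathrm{DiffFun}(\mathbb X,\mathbb X')$ has lax differential functors as objects and all natural transformations of underlying functors as morphisms; $\mathrm{DiffFun}_{\mathrm{lin}}$ has the same objects and only the linear natural transformations, i.e. $\varphi$ with $\hat\alpha'_{A,X}\circ\varphi_{T_AX}=T'_A(\varphi_X)\circ\hat\alpha_{A,X}$ for all $A,X$. $\mathrm{DiffFun}^{\mathrm{strong}}$ and $\mathrm{DiffFun}^{\mathrm{strong}}_{\mathrm{lin}}$ are the full subcategories of these on strong differential functors.
   Formalization: The formal theorem additionally assumes that T( * ) is terminal in X (the tangent functor preserves the terminal object); without this the statement is false, since a differential functor need not preserve the universality square of A, which is a pullback over T( * ). *)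

theory Defs
  imports "HOL-Library.Poly_Mapping" "HOL-Library.FuncSet" "HOL-Algebra.Ring"
begin

section \<open>Categories\<close>

record ('o, 'm) cat =
  Ob :: "'o set"
  Ar :: "'m set"
  Dom :: "'m \<Rightarrow> 'o"
  Cod :: "'m \<Rightarrow> 'o"
  Id :: "'o \<Rightarrow> 'm"
  Comp :: "'m \<Rightarrow> 'm \<Rightarrow> 'm" (infixl \<open>\<cdot>\<index>\<close> 70)

definition Hom :: "('o, 'm) cat \<Rightarrow> 'o \<Rightarrow> 'o \<Rightarrow> 'm set" where
  "Hom C x y = {f \<in> Ar C. Dom C f = x \<and> Cod C f = y}"

locale category =
  fixes C :: "('o, 'm) cat" (structure)
  assumes dom_ob: "f \<in> Ar C \<Longrightarrow> Dom C f \<in> Ob C"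
    and cod_ob: "f \<in> Ar C \<Longrightarrow> Cod C f \<in> Ob C"
    and id_hom: "x \<in> Ob C \<Longrightarrow> Id C x \<in> Hom C x x"
    and comp_hom: "f \<in> Hom C x y \<Longrightarrow> g \<in> Hom C y z \<Longrightarrow> g \<cdot> f \<in> Hom C x z"
    and id_left: "f \<in> Hom C x y \<Longrightarrow> Id C y \<cdot> f = f"
    and id_right: "f \<in> Hom C x y \<Longrightarrow> f \<cdot> Id C x = f"
    and comp_assoc:
      "f \<in> Hom C w x \<Longrightarrow> g \<in> Hom C x y \<Longrightarrow> h \<in> Hom C y z \<Longrightarrow> (h \<cdot> g) \<cdot> f = h \<cdot> (g \<cdot> f)"

definition full_subcat :: "('o, 'm) cat \<Rightarrow> 'o set \<Rightarrow> ('o, 'm) cat" where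
  "full_subcat C S =
    C\<lparr>Ob := Ob C \<inter> S, Ar := {f \<in> Ar C. Dom C f \<in> S \<and> Cod C f \<in> S}\<rparr>"

definition prod_cat :: "('o, 'm) cat \<Rightarrow> ('p, 'n) cat \<Rightarrow> ('o \<times> 'p, 'm \<times> 'n) cat" where
  "prod_cat C D =
    \<lparr>Ob = Ob C \<times> Ob D, Ar = Ar C \<times> Ar D,
     Dom = (\<lambda>(f, g). (Dom C f, Dom D g)), Cod = (\<lambda>(f, g). (Cod C f, Cod D g)),
     Id = (\<lambda>(x, y). (Id C x, Id D y)),
     Comp = (\<lambda>(f', g') (f, g). (f' \<cdot>\<^bsub>C\<^esub> f, g' \<cdot>\<^bsub>D\<^esub> g))\<rparr>"

record ('o, 'm, 'p, 'n) fctr =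
  obj_map :: "'o \<Rightarrow> 'p"
  arr_map :: "'m \<Rightarrow> 'n"

locale is_functor = dom: category C + cod: category D
  for C :: "('o, 'm) cat" and D :: "('p, 'n) cat" and F :: "('o, 'm, 'p, 'n) fctr" +
  assumes obj_map_ob: "x \<in> Ob C \<Longrightarrow> obj_map F x \<in> Ob D"
    and arr_map_hom: "f \<in> Hom C x y \<Longrightarrow> arr_map F f \<in> Hom D (obj_map F x) (obj_map F y)"
    and arr_map_id: "x \<in> Ob C \<Longrightarrow> arr_map F (Id C x) = Id D (obj_map F x)"
    and arr_map_comp:
      "f \<in> Hom C x y \<Longrightarrow> g \<in> Hom C y z \<Longrightarrow>
        arr_map F (g \<cdot>\<^bsub>C\<^esub> f) = arr_map F g \<cdot>\<^bsub>D\<^esub> arr_map F f"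

definition is_terminal :: "('o, 'm) cat \<Rightarrow> 'o \<Rightarrow> bool" where
  "is_terminal C t \<longleftrightarrow> t \<in> Ob C \<and> (\<forall>x \<in> Ob C. \<exists>!f. f \<in> Hom C x t)"

definition is_inverse :: "('o, 'm) cat \<Rightarrow> 'm \<Rightarrow> 'm \<Rightarrow> bool" where
  "is_inverse C f g \<longleftrightarrow>
    f \<in> Ar C \<and> g \<in> Hom C (Cod C f) (Dom C f) \<and>
    g \<cdot>\<^bsub>C\<^esub> f = Id C (Dom C f) \<and> f \<cdot>\<^bsub>C\<^esub> g = Id C (Cod C f)"

definition is_iso :: "('o, 'm) cat \<Rightarrow> 'm \<Rightarrow> bool" where
  "is_iso C f \<longleftrightarrow> (\<exists>g. is_inverse C f g)"

definition inverse_ar :: "('o, 'm) cat \<Rightarrow> 'm \<Rightarrow> 'm" where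
  "inverse_ar C f = (THE g. is_inverse C f g)"

definition is_product :: "('o, 'm) cat \<Rightarrow> 'o \<Rightarrow> 'o \<Rightarrow> 'm \<Rightarrow> 'm \<Rightarrow> bool" where
  "is_product C y z p0 p1 \<longleftrightarrow>
    p0 \<in> Ar C \<and> p1 \<in> Ar C \<and> Dom C p0 = Dom C p1 \<and> Cod C p0 = y \<and> Cod C p1 = z \<and>
    (\<forall>w \<in> Ob C. \<forall>f \<in> Hom C w y. \<forall>g \<in> Hom C w z.
      \<exists>!h. h \<in> Hom C w (Dom C p0) \<and> p0 \<cdot>\<^bsub>C\<^esub> h = f \<and> p1 \<cdot>\<^bsub>C\<^esub> h = g)"

definition is_pullback :: "('o, 'm) cat \<Rightarrow> 'm \<Rightarrow> 'm \<Rightarrow> 'm \<Rightarrow> 'm \<Rightarrow> bool" where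
  \<comment> \<open>arguments: top, left, right, bottom edge of the square, so that the cospan is
    formed by the right and the bottom edge\<close>
  "is_pullback C t l r b \<longleftrightarrow>
    t \<in> Ar C \<and> l \<in> Ar C \<and> r \<in> Ar C \<and> b \<in> Ar C \<and>
    Dom C t = Dom C l \<and> Cod C t = Dom C r \<and> Cod C l = Dom C b \<and> Cod C r = Cod C b \<and>
    r \<cdot>\<^bsub>C\<^esub> t = b \<cdot>\<^bsub>C\<^esub> l \<and>
    (\<forall>w \<in> Ob C. \<forall>x \<in> Hom C w (Dom C r). \<forall>y \<in> Hom C w (Dom C b).
      r \<cdot>\<^bsub>C\<^esub> x = b \<cdot>\<^bsub>C\<^esub> y \<longrightarrow>
      (\<exists>!h. h \<in> Hom C w (Dom C t) \<and> t \<cdot>\<^bsub>C\<^esub> h = x \<and> l \<cdot>\<^bsub>C\<^esub> h = y))"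

definition is_pullback_power ::
  "('o, 'm) cat \<Rightarrow> 'm \<Rightarrow> nat \<Rightarrow> 'm \<Rightarrow> (nat \<Rightarrow> 'm) \<Rightarrow> bool" where
  \<comment> \<open>the n-fold wide pullback of \<open>q\<close> with itself over \<open>Cod C q\<close>: \<open>r\<close> is the map to the base
    (which makes the case \<open>n = 0\<close> meaningful), \<open>\<pi> i\<close> for \<open>i < n\<close> are the projections\<close>
  "is_pullback_power C q n r \<pi> \<longleftrightarrow>
    q \<in> Ar C \<and> r \<in> Ar C \<and> Cod C r = Cod C q \<and>
    (\<forall>i<n. \<pi> i \<in> Hom C (Dom C r) (Dom C q) \<and> q \<cdot>\<^bsub>C\<^esub> \<pi> i = r) \<and>
    (\<forall>w \<in> Ob C. \<forall>s \<in> Hom C w (Cod C q). \<forall>x.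
      (\<forall>i<n. x i \<in> Hom C w (Dom C q) \<and> q \<cdot>\<^bsub>C\<^esub> x i = s) \<longrightarrow>
      (\<exists>!h. h \<in> Hom C w (Dom C r) \<and> r \<cdot>\<^bsub>C\<^esub> h = s \<and> (\<forall>i<n. \<pi> i \<cdot>\<^bsub>C\<^esub> h = x i)))"

definition pairing :: "('o, 'm) cat \<Rightarrow> 'm \<Rightarrow> 'm \<Rightarrow> 'm \<Rightarrow> 'm \<Rightarrow> 'm" where
  \<comment> \<open>the induced map \<open>\<langle>x, y\<rangle>\<close> into a pullback with projections \<open>p0\<close>, \<open>p1\<close>\<close>
  "pairing C p0 p1 x y =
    (THE h. h \<in> Hom C (Dom C x) (Dom C p0) \<and> p0 \<cdot>\<^bsub>C\<^esub> h = x \<and> p1 \<cdot>\<^bsub>C\<^esub> h = y)"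


section \<open>The category of Weil algebras\<close>

text \<open>
  An object is given by its presentation \<open>(n, R)\<close>, with \<open>R\<close> an equivalence relation on
  the index set \<open>{..<n}\<close> of the variables; it stands for the quotient semiring
  \<open>weil_alg (n, R)\<close> of the polynomial semiring in \<open>n\<close> variables over the natural numbers.
\<close>

type_synonym npoly = "(nat \<Rightarrow>\<^sub>0 nat) \<Rightarrow>\<^sub>0 nat"
type_synonym weil_ob = "nat \<times> (nat \<times> nat) set"
type_synonym weil_ar = "weil_ob \<times> weil_ob \<times> (npoly set \<Rightarrow> npoly set)"

definition var :: "nat \<Rightarrow> npoly" where
  "var i = Poly_Mapping.single (Poly_Mapping.single i 1) 1"

definition npolys :: "nat \<Rightarrow> npoly set" where
  "npolys n = {P. \<forall>m \<in> Poly_Mapping.keys P. Poly_Mapping.keys m \<subseteq> {..<n}}"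

inductive_set weil_cong :: "weil_ob \<Rightarrow> (npoly \<times> npoly) set" for A :: weil_ob where
  \<comment> \<open>the semiring congruence generated by \<open>x\<^sub>i x\<^sub>j = 0\<close> for related \<open>i\<close>, \<open>j\<close>\<close>
  gen: "(i, j) \<in> snd A \<Longrightarrow> i < fst A \<Longrightarrow> j < fst A \<Longrightarrow> (var i * var j, 0) \<in> weil_cong A"
| refl: "P \<in> npolys (fst A) \<Longrightarrow> (P, P) \<in> weil_cong A"
| sym: "(P, Q) \<in> weil_cong A \<Longrightarrow> (Q, P) \<in> weil_cong A"
| trans: "(P, Q) \<in> weil_cong A \<Longrightarrow> (Q, S) \<in> weil_cong A \<Longrightarrow> (P, S) \<in> weil_cong A"
| add: "(P, Q) \<in> weil_cong A \<Longrightarrow> (P', Q') \<in> weil_cong A \<Longrightarrow> (P + P', Q + Q') \<in> weil_cong A"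
| mult: "(P, Q) \<in> weil_cong A \<Longrightarrow> (P', Q') \<in> weil_cong A \<Longrightarrow> (P * P', Q * Q') \<in> weil_cong A"

definition weil_alg :: "weil_ob \<Rightarrow> npoly set ring" where
  "weil_alg A =
    \<lparr>carrier = npolys (fst A) // weil_cong A,
     mult = (\<lambda>S T. \<Union>P\<in>S. \<Union>Q\<in>T. weil_cong A `` {P * Q}),
     one = weil_cong A `` {1},
     zero = weil_cong A `` {0},
     add = (\<lambda>S T. \<Union>P\<in>S. \<Union>Q\<in>T. weil_cong A `` {P + Q})\<rparr>"

definition weil_hom :: "weil_ob \<Rightarrow> weil_ob \<Rightarrow> (npoly set \<Rightarrow> npoly set) set" where
  \<comment> \<open>\<open>ring_hom\<close> does not demand preservation of zero, which is not automatic for semirings;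
    linearity over the natural numbers then is\<close>
  "weil_hom A B =
    {h \<in> ring_hom (weil_alg A) (weil_alg B) \<inter> extensional (carrier (weil_alg A)).
      h \<zero>\<^bsub>weil_alg A\<^esub> = \<zero>\<^bsub>weil_alg B\<^esub>}"

definition Weil :: "(weil_ob, weil_ar) cat" where
  "Weil =
    \<lparr>Ob = {(n, R). equiv {..<n} R},
     Ar = {(A, B, h). equiv {..<fst A} (snd A) \<and> equiv {..<fst B} (snd B) \<and> h \<in> weil_hom A B},
     Dom = (\<lambda>(A, B, h). A), Cod = (\<lambda>(A, B, h). B),
     Id = (\<lambda>A. (A, A, restrict id (carrier (weil_alg A)))),
     Comp = (\<lambda>(B', C, g) (A, B, f). (A, C, compose (carrier (weil_alg A)) g f))\<rparr>"

definition npoly_subst :: "(nat \<Rightarrow> npoly) \<Rightarrow> npoly \<Rightarrow> npoly" where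
  "npoly_subst s P =
    (\<Sum>m \<in> Poly_Mapping.keys P. of_nat (Poly_Mapping.lookup P m) *
      (\<Prod>i \<in> Poly_Mapping.keys m. s i ^ Poly_Mapping.lookup m i))"

definition weil_map :: "weil_ob \<Rightarrow> weil_ob \<Rightarrow> (nat \<Rightarrow> npoly) \<Rightarrow> weil_ar" where
  \<comment> \<open>the morphism determined by \<open>x\<^sub>i \<mapsto> s i\<close>, used only where this respects the relations\<close>
  "weil_map A B s =
    (A, B, \<lambda>S \<in> carrier (weil_alg A). \<Union>P\<in>S. weil_cong B `` {npoly_subst s P})"

text \<open>
  The coproduct \<open>A \<otimes> B\<close> puts the variables of \<open>B\<close> behind those of \<open>A\<close>. With this choice the
  monoidal structure is strict, so that no associators or unitors for \<open>\<otimes>\<close> are needed below.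
\<close>

definition weil_tensor :: "weil_ob \<Rightarrow> weil_ob \<Rightarrow> weil_ob" (infixr \<open>\<otimes>w\<close> 70) where
  "A \<otimes>w B = (fst A + fst B, snd A \<union> (\<lambda>(i, j). (fst A + i, fst A + j)) ` snd B)"

definition weil_N :: weil_ob where
  "weil_N = (0, {})"

definition weil_Wn :: "nat \<Rightarrow> weil_ob" where
  "weil_Wn n = (n, {..<n} \<times> {..<n})"

abbreviation weil_W :: weil_ob where
  "weil_W \<equiv> weil_Wn 1"

primrec weil_W_tensor :: "nat \<Rightarrow> weil_ob" where
  "weil_W_tensor 0 = weil_N"
| "weil_W_tensor (Suc n) = weil_W \<otimes>w weil_W_tensor n"

lemma weil_tensor_assoc: "(A \<otimes>w B) \<otimes>w C = A \<otimes>w B \<otimes>w C"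
  by (force simp: weil_tensor_def add.assoc image_Un image_image case_prod_beta)

lemma weil_tensor_unit: "weil_N \<otimes>w A = A" "A \<otimes>w weil_N = A"
  by (auto simp: weil_tensor_def weil_N_def)

definition weil_in0 :: "weil_ob \<Rightarrow> weil_ob \<Rightarrow> weil_ar" where
  "weil_in0 A B = weil_map A (A \<otimes>w B) var"

definition weil_in1 :: "weil_ob \<Rightarrow> weil_ob \<Rightarrow> weil_ar" where
  "weil_in1 A B = weil_map B (A \<otimes>w B) (\<lambda>j. var (fst A + j))"

definition weil_tensor_ar :: "weil_ar \<Rightarrow> weil_ar \<Rightarrow> weil_ar" (infixr \<open>\<otimes>a\<close> 70) where
  "\<theta> \<otimes>a \<phi> =
    (let A = Dom Weil \<theta>; A' = Cod Weil \<theta>; B = Dom Weil \<phi>; B' = Cod Weil \<phi> in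
      THE h. h \<in> Hom Weil (A \<otimes>w B) (A' \<otimes>w B') \<and>
        h \<cdot>\<^bsub>Weil\<^esub> weil_in0 A B = weil_in0 A' B' \<cdot>\<^bsub>Weil\<^esub> \<theta> \<and>
        h \<cdot>\<^bsub>Weil\<^esub> weil_in1 A B = weil_in1 A' B' \<cdot>\<^bsub>Weil\<^esub> \<phi>)"

definition weil_aug :: "weil_ob \<Rightarrow> weil_ar" where
  \<comment> \<open>the unique map to the terminal object\<close>
  "weil_aug A = weil_map A weil_N (\<lambda>i. 0)"

definition weil_p :: weil_ar where
  "weil_p = weil_map weil_W weil_N (\<lambda>i. 0)"

definition weil_zero :: weil_ar where
  \<comment> \<open>there are no variables in the domain\<close>
  "weil_zero = weil_map weil_N weil_W (\<lambda>i. 0)"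

definition weil_plus :: weil_ar where
  "weil_plus = weil_map (weil_Wn 2) weil_W (\<lambda>i. var 0)"

definition weil_ell :: weil_ar where
  "weil_ell = weil_map weil_W (weil_W \<otimes>w weil_W) (\<lambda>i. var 0 * var 1)"

definition weil_pr :: "nat \<Rightarrow> weil_ar" where
  \<comment> \<open>the projections of \<open>W \<times> W\<close>\<close>
  "weil_pr k = weil_map (weil_Wn 2) weil_W (\<lambda>i. if i = k then var 0 else 0)"

definition weil_nu :: weil_ar where
  "weil_nu = weil_map (weil_Wn 2) (weil_W \<otimes>w weil_W) (\<lambda>i. if i = 0 then var 0 * var 1 else var 1)"


section \<open>Tangent actegories\<close>

record ('o, 'm) actegory =
  tcat :: "('o, 'm) cat"
  act :: "(weil_ob \<times> 'o, weil_ar \<times> 'm, 'o, 'm) fctr"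
  act_unit :: "'o \<Rightarrow> 'm" \<comment> \<open>\<open>X \<rightarrow> T\<^sub>N X\<close>\<close>
  act_mult :: "weil_ob \<Rightarrow> weil_ob \<Rightarrow> 'o \<Rightarrow> 'm" \<comment> \<open>\<open>T\<^sub>A (T\<^sub>B X) \<rightarrow> T\<^bsub>A \<otimes> B\<^esub> X\<close>\<close>

definition Tob :: "('o, 'm) actegory \<Rightarrow> weil_ob \<Rightarrow> 'o \<Rightarrow> 'o" where
  "Tob \<XX> A X = obj_map (act \<XX>) (A, X)"

definition Tar :: "('o, 'm) actegory \<Rightarrow> weil_ob \<Rightarrow> 'm \<Rightarrow> 'm" where
  "Tar \<XX> A f = arr_map (act \<XX>) (Id Weil A, f)"

definition Tnat :: "('o, 'm) actegory \<Rightarrow> weil_ar \<Rightarrow> 'o \<Rightarrow> 'm" where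
  "Tnat \<XX> \<theta> X = arr_map (act \<XX>) (\<theta>, Id (tcat \<XX>) X)"

locale weil_actegory =
  act: is_functor "prod_cat Weil (tcat \<XX>)" "tcat \<XX>" "act \<XX>"
  for \<XX> :: "('o, 'm) actegory" +
  assumes base_category: "category (tcat \<XX>)"
    and unit_iso:
      "X \<in> Ob (tcat \<XX>) \<Longrightarrow>
        act_unit \<XX> X \<in> Hom (tcat \<XX>) X (Tob \<XX> weil_N X) \<and> is_iso (tcat \<XX>) (act_unit \<XX> X)"
    and unit_natural:
      "f \<in> Hom (tcat \<XX>) X Y \<Longrightarrow>
        Tar \<XX> weil_N f \<cdot>\<^bsub>tcat \<XX>\<^esub> act_unit \<XX> X = act_unit \<XX> Y \<cdot>\<^bsub>tcat \<XX>\<^esub> f"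
    and mult_iso:
      "A \<in> Ob Weil \<Longrightarrow> B \<in> Ob Weil \<Longrightarrow> X \<in> Ob (tcat \<XX>) \<Longrightarrow>
        act_mult \<XX> A B X \<in> Hom (tcat \<XX>) (Tob \<XX> A (Tob \<XX> B X)) (Tob \<XX> (A \<otimes>w B) X) \<and>
        is_iso (tcat \<XX>) (act_mult \<XX> A B X)"
    and mult_natural:
      "\<theta> \<in> Hom Weil A A' \<Longrightarrow> \<phi> \<in> Hom Weil B B' \<Longrightarrow> f \<in> Hom (tcat \<XX>) X Y \<Longrightarrow>
        act_mult \<XX> A' B' Y \<cdot>\<^bsub>tcat \<XX>\<^esub> arr_map (act \<XX>) (\<theta>, arr_map (act \<XX>) (\<phi>, f)) =
        arr_map (act \<XX>) (\<theta> \<otimes>a \<phi>, f) \<cdot>\<^bsub>tcat \<XX>\<^esub> act_mult \<XX> A B X"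
    and mult_assoc:
      "A \<in> Ob Weil \<Longrightarrow> B \<in> Ob Weil \<Longrightarrow> D \<in> Ob Weil \<Longrightarrow> X \<in> Ob (tcat \<XX>) \<Longrightarrow>
        act_mult \<XX> (A \<otimes>w B) D X \<cdot>\<^bsub>tcat \<XX>\<^esub> act_mult \<XX> A B (Tob \<XX> D X) =
        act_mult \<XX> A (B \<otimes>w D) X \<cdot>\<^bsub>tcat \<XX>\<^esub> Tar \<XX> A (act_mult \<XX> B D X)"
    and mult_unit_left:
      "A \<in> Ob Weil \<Longrightarrow> X \<in> Ob (tcat \<XX>) \<Longrightarrow>
        act_mult \<XX> weil_N A X \<cdot>\<^bsub>tcat \<XX>\<^esub> act_unit \<XX> (Tob \<XX> A X) = Id (tcat \<XX>) (Tob \<XX> A X)"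
    and mult_unit_right:
      "A \<in> Ob Weil \<Longrightarrow> X \<in> Ob (tcat \<XX>) \<Longrightarrow>
        act_mult \<XX> A weil_N X \<cdot>\<^bsub>tcat \<XX>\<^esub> Tar \<XX> A (act_unit \<XX> X) = Id (tcat \<XX>) (Tob \<XX> A X)"

locale tangent_actegory = weil_actegory +
  assumes tangent_product_pullback:
      "A \<in> Ob Weil \<Longrightarrow> B \<in> Ob Weil \<Longrightarrow> D \<in> Ob Weil \<Longrightarrow> is_product Weil B D p0 p1 \<Longrightarrow>
        X \<in> Ob (tcat \<XX>) \<Longrightarrow>
        is_pullback (tcat \<XX>)
          (Tnat \<XX> (Id Weil A \<otimes>a p0) X) (Tnat \<XX> (Id Weil A \<otimes>a p1) X)
          (Tnat \<XX> (Id Weil A \<otimes>a weil_aug B) X) (Tnat \<XX> (Id Weil A \<otimes>a weil_aug D) X)"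
    and tangent_lift_pullback:
      "X \<in> Ob (tcat \<XX>) \<Longrightarrow>
        is_pullback (tcat \<XX>)
          (Tnat \<XX> (Id Weil (weil_W_tensor n) \<otimes>a weil_nu) X)
          (Tnat \<XX> (Id Weil (weil_W_tensor n) \<otimes>a weil_aug (weil_Wn 2)) X)
          (Tnat \<XX> (Id Weil (weil_W_tensor n) \<otimes>a (Id Weil weil_W \<otimes>a weil_p)) X)
          (Tnat \<XX> (Id Weil (weil_W_tensor n) \<otimes>a weil_zero) X)"

text \<open>The structure maps of the tangent category, composed with the structure isomorphisms.\<close>

definition tan_p :: "('o, 'm) actegory \<Rightarrow> 'o \<Rightarrow> 'm" where
  "tan_p \<XX> X = inverse_ar (tcat \<XX>) (act_unit \<XX> X) \<cdot>\<^bsub>tcat \<XX>\<^esub> Tnat \<XX> weil_p X"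

definition tan_zero :: "('o, 'm) actegory \<Rightarrow> 'o \<Rightarrow> 'm" where
  "tan_zero \<XX> X = Tnat \<XX> weil_zero X \<cdot>\<^bsub>tcat \<XX>\<^esub> act_unit \<XX> X"

definition tan_ell :: "('o, 'm) actegory \<Rightarrow> 'o \<Rightarrow> 'm" where
  "tan_ell \<XX> X =
    inverse_ar (tcat \<XX>) (act_mult \<XX> weil_W weil_W X) \<cdot>\<^bsub>tcat \<XX>\<^esub> Tnat \<XX> weil_ell X"


section \<open>Differential bundles\<close>

text \<open>
  The chosen pullback \<open>X\<^sub>2\<close>, on which the addition is defined, is part of the data, in the form
  of its two projections.
\<close>

record ('o, 'm) addbun =
  btot :: 'o
  bbase :: 'o
  bproj :: 'm
  bpi0 :: 'm
  bpi1 :: 'm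
  bzero :: 'm
  bplus :: 'm

record ('o, 'm) dbun = "('o, 'm) addbun" +
  blift :: 'm

definition additive_bundle :: "('o, 'm) cat \<Rightarrow> ('o, 'm, 'z) addbun_scheme \<Rightarrow> bool" where
  "additive_bundle C B \<longleftrightarrow>
    bproj B \<in> Hom C (btot B) (bbase B) \<and>
    (\<forall>n. \<exists>r \<pi>. is_pullback_power C (bproj B) n r \<pi>) \<and>
    is_pullback C (bpi0 B) (bpi1 B) (bproj B) (bproj B) \<and>
    bplus B \<in> Hom C (Dom C (bpi0 B)) (btot B) \<and>
    bzero B \<in> Hom C (bbase B) (btot B) \<and>
    bproj B \<cdot>\<^bsub>C\<^esub> bplus B = bproj B \<cdot>\<^bsub>C\<^esub> bpi0 B \<and>
    bproj B \<cdot>\<^bsub>C\<^esub> bplus B = bproj B \<cdot>\<^bsub>C\<^esub> bpi1 B \<and>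
    bproj B \<cdot>\<^bsub>C\<^esub> bzero B = Id C (bbase B) \<and>
    (\<forall>r \<pi>. is_pullback_power C (bproj B) 3 r \<pi> \<longrightarrow>
      bplus B \<cdot>\<^bsub>C\<^esub> pairing C (bpi0 B) (bpi1 B)
        (bplus B \<cdot>\<^bsub>C\<^esub> pairing C (bpi0 B) (bpi1 B) (\<pi> 0) (\<pi> 1)) (\<pi> 2) =
      bplus B \<cdot>\<^bsub>C\<^esub> pairing C (bpi0 B) (bpi1 B)
        (\<pi> 0) (bplus B \<cdot>\<^bsub>C\<^esub> pairing C (bpi0 B) (bpi1 B) (\<pi> 1) (\<pi> 2))) \<and>
    bplus B \<cdot>\<^bsub>C\<^esub> pairing C (bpi0 B) (bpi1 B) (bpi1 B) (bpi0 B) = bplus B \<and>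
    bplus B \<cdot>\<^bsub>C\<^esub> pairing C (bpi0 B) (bpi1 B)
      (Id C (btot B)) (bzero B \<cdot>\<^bsub>C\<^esub> bproj B) = Id C (btot B)"

definition bundle_morphism ::
  "('o, 'm) cat \<Rightarrow> ('o, 'm, 'y) addbun_scheme \<Rightarrow> ('o, 'm, 'z) addbun_scheme \<Rightarrow> 'm \<Rightarrow> 'm \<Rightarrow> bool"
where
  "bundle_morphism C B B' f g \<longleftrightarrow>
    f \<in> Hom C (btot B) (btot B') \<and> g \<in> Hom C (bbase B) (bbase B') \<and>
    bproj B' \<cdot>\<^bsub>C\<^esub> f = g \<cdot>\<^bsub>C\<^esub> bproj B"

definition additive_morphism ::
  "('o, 'm) cat \<Rightarrow> ('o, 'm, 'y) addbun_scheme \<Rightarrow> ('o, 'm, 'z) addbun_scheme \<Rightarrow> 'm \<Rightarrow> 'm \<Rightarrow> bool"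
where
  "additive_morphism C B B' f g \<longleftrightarrow>
    bundle_morphism C B B' f g \<and>
    f \<cdot>\<^bsub>C\<^esub> bplus B =
      bplus B' \<cdot>\<^bsub>C\<^esub> pairing C (bpi0 B') (bpi1 B') (f \<cdot>\<^bsub>C\<^esub> bpi0 B) (f \<cdot>\<^bsub>C\<^esub> bpi1 B) \<and>
    f \<cdot>\<^bsub>C\<^esub> bzero B = bzero B' \<cdot>\<^bsub>C\<^esub> g"

definition T_bundle ::
  "('o, 'm) actegory \<Rightarrow> ('o, 'm, 'z) addbun_scheme \<Rightarrow> ('o, 'm) addbun" where
  "T_bundle \<XX> B =
    \<lparr>btot = Tob \<XX> weil_W (btot B), bbase = Tob \<XX> weil_W (bbase B),
     bproj = Tar \<XX> weil_W (bproj B),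
     bpi0 = Tar \<XX> weil_W (bpi0 B), bpi1 = Tar \<XX> weil_W (bpi1 B),
     bzero = Tar \<XX> weil_W (bzero B), bplus = Tar \<XX> weil_W (bplus B)\<rparr>"

definition tangent_bundle :: "('o, 'm) actegory \<Rightarrow> 'o \<Rightarrow> ('o, 'm) addbun" where
  "tangent_bundle \<XX> X =
    \<lparr>btot = Tob \<XX> weil_W X, bbase = X, bproj = tan_p \<XX> X,
     bpi0 = Tnat \<XX> (weil_pr 0) X, bpi1 = Tnat \<XX> (weil_pr 1) X,
     bzero = tan_zero \<XX> X, bplus = Tnat \<XX> weil_plus X\<rparr>"

definition differential_bundle :: "('o, 'm) actegory \<Rightarrow> ('o, 'm) dbun \<Rightarrow> bool" where
  "differential_bundle \<XX> B \<longleftrightarrow>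
    (let C = tcat \<XX>; T = Tar \<XX> weil_W; E = btot B; M = bbase B in
      additive_bundle C B \<and>
      (\<forall>n r \<pi> k. is_pullback_power C (bproj B) n r \<pi> \<longrightarrow>
        is_pullback_power C ((T ^^ k) (bproj B)) n ((T ^^ k) r) (\<lambda>i. (T ^^ k) (\<pi> i))) \<and>
      additive_morphism C B (T_bundle \<XX> B) (blift B) (tan_zero \<XX> M) \<and>
      additive_morphism C B (tangent_bundle \<XX> E) (blift B) (bzero B) \<and>
      tan_ell \<XX> E \<cdot>\<^bsub>C\<^esub> blift B = T (blift B) \<cdot>\<^bsub>C\<^esub> blift B \<and>
      is_pullback C
        (T (bplus B) \<cdot>\<^bsub>C\<^esub> pairing C (T (bpi0 B)) (T (bpi1 B))
          (blift B \<cdot>\<^bsub>C\<^esub> bpi0 B) (tan_zero \<XX> E \<cdot>\<^bsub>C\<^esub> bpi1 B))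
        (bproj B \<cdot>\<^bsub>C\<^esub> bpi0 B)
        (T (bproj B))
        (tan_zero \<XX> M))"

definition linear_morphism ::
  "('o, 'm) actegory \<Rightarrow> ('o, 'm) dbun \<Rightarrow> ('o, 'm) dbun \<Rightarrow> 'm \<Rightarrow> 'm \<Rightarrow> bool" where
  "linear_morphism \<XX> B B' f g \<longleftrightarrow>
    bundle_morphism (tcat \<XX>) B B' f g \<and>
    blift B' \<cdot>\<^bsub>tcat \<XX>\<^esub> f = Tar \<XX> weil_W f \<cdot>\<^bsub>tcat \<XX>\<^esub> blift B"

type_synonym ('o, 'm) dbun_ar = "('o, 'm) dbun \<times> ('o, 'm) dbun \<times> 'm \<times> 'm"

definition DBun_of ::
  "('o, 'm) actegory \<Rightarrow> (('o, 'm) dbun \<Rightarrow> ('o, 'm) dbun \<Rightarrow> 'm \<Rightarrow> 'm \<Rightarrow> bool) \<Rightarrow>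
    (('o, 'm) dbun, ('o, 'm) dbun_ar) cat" where
  "DBun_of \<XX> mor =
    \<lparr>Ob = {B. differential_bundle \<XX> B},
     Ar = {(B, B', f, g). differential_bundle \<XX> B \<and> differential_bundle \<XX> B' \<and> mor B B' f g},
     Dom = (\<lambda>(B, B', f, g). B), Cod = (\<lambda>(B, B', f, g). B'),
     Id = (\<lambda>B. (B, B, Id (tcat \<XX>) (btot B), Id (tcat \<XX>) (bbase B))),
     Comp = (\<lambda>(B1, B2, f', g') (B0, B1', f, g).
       (B0, B2, f' \<cdot>\<^bsub>tcat \<XX>\<^esub> f, g' \<cdot>\<^bsub>tcat \<XX>\<^esub> g))\<rparr>"

definition DBun_add :: "('o, 'm) actegory \<Rightarrow> (('o, 'm) dbun, ('o, 'm) dbun_ar) cat" where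
  "DBun_add \<XX> = DBun_of \<XX> (additive_morphism (tcat \<XX>))"

definition DBun_lin :: "('o, 'm) actegory \<Rightarrow> (('o, 'm) dbun, ('o, 'm) dbun_ar) cat" where
  "DBun_lin \<XX> = DBun_of \<XX> (linear_morphism \<XX>)"

definition DObj_add :: "('o, 'm) actegory \<Rightarrow> (('o, 'm) dbun, ('o, 'm) dbun_ar) cat" where
  "DObj_add \<XX> = full_subcat (DBun_add \<XX>) {B. is_terminal (tcat \<XX>) (bbase B)}"

definition DObj_lin :: "('o, 'm) actegory \<Rightarrow> (('o, 'm) dbun, ('o, 'm) dbun_ar) cat" where
  "DObj_lin \<XX> = full_subcat (DBun_lin \<XX>) {B. is_terminal (tcat \<XX>) (bbase B)}"


section \<open>Differential functors\<close>

record ('o, 'm, 'p, 'n) oplax =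
  ofun :: "('o, 'm, 'p, 'n) fctr"
  ocmp :: "weil_ob \<times> 'o \<Rightarrow> 'n" \<comment> \<open>\<open>F (T\<^sub>A X) \<rightarrow> T'\<^sub>A (F X)\<close>\<close>

definition oplax_linear_functor ::
  "('o, 'm) actegory \<Rightarrow> ('p, 'n) actegory \<Rightarrow> ('o, 'm, 'p, 'n) oplax \<Rightarrow> bool" where
  "oplax_linear_functor \<XX> \<YY> \<F> \<longleftrightarrow>
    (let C = tcat \<XX>; D = tcat \<YY>; Fo = obj_map (ofun \<F>); Fa = arr_map (ofun \<F>); \<alpha> = ocmp \<F> in
      is_functor C D (ofun \<F>) \<and>
      (\<forall>A \<in> Ob Weil. \<forall>X \<in> Ob C. \<alpha> (A, X) \<in> Hom D (Fo (Tob \<XX> A X)) (Tob \<YY> A (Fo X))) \<and>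
      (\<forall>A B X Y. \<forall>\<theta> \<in> Hom Weil A B. \<forall>f \<in> Hom C X Y.
        arr_map (act \<YY>) (\<theta>, Fa f) \<cdot>\<^bsub>D\<^esub> \<alpha> (A, X) = \<alpha> (B, Y) \<cdot>\<^bsub>D\<^esub> Fa (arr_map (act \<XX>) (\<theta>, f))) \<and>
      (\<forall>A \<in> Ob Weil. \<forall>B \<in> Ob Weil. \<forall>X \<in> Ob C.
        \<alpha> (A \<otimes>w B, X) \<cdot>\<^bsub>D\<^esub> Fa (act_mult \<XX> A B X) =
        act_mult \<YY> A B (Fo X) \<cdot>\<^bsub>D\<^esub> (Tar \<YY> A (\<alpha> (B, X)) \<cdot>\<^bsub>D\<^esub> \<alpha> (A, Tob \<XX> B X))) \<and>
      (\<forall>X \<in> Ob C. \<alpha> (weil_N, X) \<cdot>\<^bsub>D\<^esub> Fa (act_unit \<XX> X) = act_unit \<YY> (Fo X)))"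

definition lax_differential_functor ::
  "('o, 'm) actegory \<Rightarrow> 'o \<Rightarrow> ('p, 'n) actegory \<Rightarrow> ('o, 'm, 'p, 'n) oplax \<Rightarrow> bool" where
  \<comment> \<open>\<open>pt\<close> is the terminal object of \<open>\<XX>\<close>\<close>
  "lax_differential_functor \<XX> pt \<YY> \<F> \<longleftrightarrow>
    (let C = tcat \<XX>; D = tcat \<YY>; Fa = arr_map (ofun \<F>); \<alpha> = ocmp \<F> in
      oplax_linear_functor \<XX> \<YY> \<F> \<and>
      (\<forall>A \<in> Ob Weil. \<forall>t l r b. is_pullback C t l r b \<and> Cod C r = pt \<longrightarrow>
        is_pullback D (Tar \<YY> A (Fa t)) (Tar \<YY> A (Fa l)) (Tar \<YY> A (Fa r)) (Tar \<YY> A (Fa b))) \<and>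
      (\<forall>A \<in> Ob Weil. \<forall>X Y. \<forall>f \<in> Hom C X Y.
        is_pullback D (\<alpha> (A, X)) (Fa (Tar \<XX> A f)) (Tar \<YY> A (Fa f)) (\<alpha> (A, Y))))"

definition natural_transformation ::
  "('o, 'm) cat \<Rightarrow> ('p, 'n) cat \<Rightarrow> ('o, 'm, 'p, 'n) fctr \<Rightarrow> ('o, 'm, 'p, 'n) fctr \<Rightarrow>
    ('o \<Rightarrow> 'n) \<Rightarrow> bool" where
  "natural_transformation C D F G \<phi> \<longleftrightarrow>
    (\<forall>X \<in> Ob C. \<phi> X \<in> Hom D (obj_map F X) (obj_map G X)) \<and>
    (\<forall>X Y. \<forall>f \<in> Hom C X Y. \<phi> Y \<cdot>\<^bsub>D\<^esub> arr_map F f = arr_map G f \<cdot>\<^bsub>D\<^esub> \<phi> X)"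

definition linear_transformation ::
  "('o, 'm) actegory \<Rightarrow> ('p, 'n) actegory \<Rightarrow> ('o, 'm, 'p, 'n) oplax \<Rightarrow> ('o, 'm, 'p, 'n) oplax \<Rightarrow>
    ('o \<Rightarrow> 'n) \<Rightarrow> bool" where
  "linear_transformation \<XX> \<YY> \<F> \<G> \<phi> \<longleftrightarrow>
    natural_transformation (tcat \<XX>) (tcat \<YY>) (ofun \<F>) (ofun \<G>) \<phi> \<and>
    (\<forall>A \<in> Ob Weil. \<forall>X \<in> Ob (tcat \<XX>).
      ocmp \<G> (A, X) \<cdot>\<^bsub>tcat \<YY>\<^esub> \<phi> (Tob \<XX> A X) = Tar \<YY> A (\<phi> X) \<cdot>\<^bsub>tcat \<YY>\<^esub> ocmp \<F> (A, X))"

definition ext_oplax ::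
  "('o, 'm) actegory \<Rightarrow> ('o, 'm, 'p, 'n) oplax set" where
  \<comment> \<open>every functor and family of components has exactly one representation that is
    undefined outside of its domain\<close>
  "ext_oplax \<XX> =
    {\<F>. obj_map (ofun \<F>) \<in> extensional (Ob (tcat \<XX>)) \<and>
        arr_map (ofun \<F>) \<in> extensional (Ar (tcat \<XX>)) \<and>
        ocmp \<F> \<in> extensional (Ob Weil \<times> Ob (tcat \<XX>))}"

type_synonym ('o, 'm, 'p, 'n) oplax_ar =
  "('o, 'm, 'p, 'n) oplax \<times> ('o, 'm, 'p, 'n) oplax \<times> ('o \<Rightarrow> 'n)"

definition DiffFun_of ::
  "('o, 'm) actegory \<Rightarrow> 'o \<Rightarrow> ('p, 'n) actegory \<Rightarrow>
    (('o, 'm, 'p, 'n) oplax \<Rightarrow> ('o, 'm, 'p, 'n) oplax \<Rightarrow> ('o \<Rightarrow> 'n) \<Rightarrow> bool) \<Rightarrow>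
    (('o, 'm, 'p, 'n) oplax, ('o, 'm, 'p, 'n) oplax_ar) cat" where
  "DiffFun_of \<XX> pt \<YY> mor =
    (let obs = {\<F> \<in> ext_oplax \<XX>. lax_differential_functor \<XX> pt \<YY> \<F>} in
    \<lparr>Ob = obs,
     Ar = {(\<F>, \<G>, \<phi>). \<F> \<in> obs \<and> \<G> \<in> obs \<and> mor \<F> \<G> \<phi> \<and> \<phi> \<in> extensional (Ob (tcat \<XX>))},
     Dom = (\<lambda>(\<F>, \<G>, \<phi>). \<F>), Cod = (\<lambda>(\<F>, \<G>, \<phi>). \<G>),
     Id = (\<lambda>\<F>. (\<F>, \<F>, \<lambda>X \<in> Ob (tcat \<XX>). Id (tcat \<YY>) (obj_map (ofun \<F>) X))),
     Comp = (\<lambda>(\<G>', \<H>, \<psi>) (\<F>, \<G>, \<phi>). (\<F>, \<H>, \<lambda>X \<in> Ob (tcat \<XX>). \<psi> X \<cdot>\<^bsub>tcat \<YY>\<^esub> \<phi> X))\<rparr>)"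

definition DiffFun ::
  "('o, 'm) actegory \<Rightarrow> 'o \<Rightarrow> ('p, 'n) actegory \<Rightarrow>
    (('o, 'm, 'p, 'n) oplax, ('o, 'm, 'p, 'n) oplax_ar) cat" where
  "DiffFun \<XX> pt \<YY> =
    DiffFun_of \<XX> pt \<YY> (\<lambda>\<F> \<G>. natural_transformation (tcat \<XX>) (tcat \<YY>) (ofun \<F>) (ofun \<G>))"

definition DiffFun_lin ::
  "('o, 'm) actegory \<Rightarrow> 'o \<Rightarrow> ('p, 'n) actegory \<Rightarrow>
    (('o, 'm, 'p, 'n) oplax, ('o, 'm, 'p, 'n) oplax_ar) cat" where
  "DiffFun_lin \<XX> pt \<YY> = DiffFun_of \<XX> pt \<YY> (linear_transformation \<XX> \<YY>)"

definition strong_functors ::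
  "'o \<Rightarrow> ('p, 'n) actegory \<Rightarrow> ('o, 'm, 'p, 'n) oplax set" where
  "strong_functors pt \<YY> = {\<F>. is_terminal (tcat \<YY>) (obj_map (ofun \<F>) pt)}"

definition DiffFun_strong ::
  "('o, 'm) actegory \<Rightarrow> 'o \<Rightarrow> ('p, 'n) actegory \<Rightarrow>
    (('o, 'm, 'p, 'n) oplax, ('o, 'm, 'p, 'n) oplax_ar) cat" where
  "DiffFun_strong \<XX> pt \<YY> = full_subcat (DiffFun \<XX> pt \<YY>) (strong_functors pt \<YY>)"

definition DiffFun_strong_lin ::
  "('o, 'm) actegory \<Rightarrow> 'o \<Rightarrow> ('p, 'n) actegory \<Rightarrow>
    (('o, 'm, 'p, 'n) oplax, ('o, 'm, 'p, 'n) oplax_ar) cat" where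
  "DiffFun_strong_lin \<XX> pt \<YY> = full_subcat (DiffFun_lin \<XX> pt \<YY>) (strong_functors pt \<YY>)"


section \<open>Evaluation\<close>

definition eval_bundle ::
  "('p, 'n) actegory \<Rightarrow> ('o, 'm) dbun \<Rightarrow> ('o, 'm, 'p, 'n) oplax \<Rightarrow> ('p, 'n) dbun" where
  "eval_bundle \<YY> B \<F> =
    (let Fo = obj_map (ofun \<F>); Fa = arr_map (ofun \<F>) in
    \<lparr>btot = Fo (btot B), bbase = Fo (bbase B), bproj = Fa (bproj B),
     bpi0 = Fa (bpi0 B), bpi1 = Fa (bpi1 B), bzero = Fa (bzero B), bplus = Fa (bplus B),
     blift = ocmp \<F> (weil_W, btot B) \<cdot>\<^bsub>tcat \<YY>\<^esub> Fa (blift B)\<rparr>)"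

definition Eval ::
  "('p, 'n) actegory \<Rightarrow> ('o, 'm) dbun \<Rightarrow>
    (('o, 'm, 'p, 'n) oplax, ('o, 'm, 'p, 'n) oplax_ar, ('p, 'n) dbun, ('p, 'n) dbun_ar) fctr" where
  "Eval \<YY> B =
    \<lparr>obj_map = eval_bundle \<YY> B,
     arr_map = (\<lambda>(\<F>, \<G>, \<phi>).
       (eval_bundle \<YY> B \<F>, eval_bundle \<YY> B \<G>, \<phi> (btot B), \<phi> (bbase B)))\<rparr>"

end

theory Submission
  imports Defs
begin

text \<open>
Evaluation at a differential object \<open>A\<close> works because every piece of structure of a differential
bundle over a terminal object is either a finite diagram involving pullbacks over that terminal
object, or a natural transformation of the form \<open>T\<^sub>\<theta>\<close>. A lax differential functor \<open>(F, \<alpha>)\<close> preserves the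
former (also after applying any \<open>T'\<^sub>B\<close>), and \<open>\<alpha>\<close> intertwines the latter.

\<^item> \<^emph>\<open>Additive bundle.\<close> The \<open>n + 1\<close>st pullback power of \<open>q\<close> is the pullback of the \<open>n\<close>th power and \<open>q\<close> over the
base. Since the base is terminal, \<open>T'\<^sup>k \<circ> F\<close> preserves all pullback powers of \<open>q\<close>, by induction on \<open>n\<close>
(\<open>preserves_powers\<close>); here \<open>T'\<^sup>k\<close> is replaced by the isomorphic functor \<open>T'\<^sub>B\<close> with \<open>B = W\<^bsup>\<otimes>k\<^esup>\<close>, for which
preservation is part of the definition. The equations for the addition are equations between maps
out of pullback powers, hence are preserved (\<open>additive_image\<close>).

\<^item> \<^emph>\<open>The lift\<close> \<open>\<lambda>' = \<alpha> \<circ> F \<lambda>\<close>. Naturality of \<open>\<alpha>\<close> in both variables, multiplicativity and the unit law say that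
\<open>\<alpha>\<close> commutes with projection, zero, sum and the vertical lift \<open>\<ell>\<close> of the tangent bundles (\<open>cmp_p\<close>,
\<open>cmp_zero\<close>, \<open>cmp_ell\<close>, \<open>cmp_Tnat\<close>). So the conditions on \<open>\<lambda>'\<close> are the images under \<open>F\<close> of those on \<open>\<lambda>\<close>. Pairings
into \<open>T\<^sub>2 E\<close> are determined by their components because \<open>T\<^sub>2\<close> is a fibre power of \<open>T\<close>, which comes from the
fact that \<open>W\<^sub>2\<close> is the product of two copies of \<open>W\<close> in the category of Weil algebras
(\<open>weil_W2_product\<close>).

\<^item> \<^emph>\<open>Universality of the lift.\<close> The square for \<open>\<lambda>\<close> is a pullback over \<open>T *\<close>, which is terminal as well as
\<open>*\<close>; so \<open>F\<close> preserves it. Pasting its image with the naturality square of \<open>\<alpha>\<close> at \<open>q\<close>, which is a pullback by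
definition of a lax differential functor, gives the square for \<open>\<lambda>'\<close> (\<open>universal_image\<close>).

\<^item> \<^emph>\<open>Morphisms.\<close> A natural transformation commutes with the images of \<open>q\<close>, \<open>\<zeta>\<close>, \<open>\<sigma>\<close> and of the two
projections of the fibre product, which makes its component at \<open>A\<close> additive; if it is linear, it also commutes with \<open>\<alpha>\<close>, hence with \<open>\<lambda>'\<close>.
For strong functors the base \<open>F *\<close> is terminal, so that one lands in differential objects.
\<close>

section \<open>Isomorphisms, pullbacks and pullback powers\<close>

context category
begin

text \<open>
Rewriting with domains and codomains instead of membership in hom-sets, and with composites
associated to the right, lets the simplifier discharge all typing conditions.
\<close>

lemma in_Hom [simp]: "f \<in> Hom C x y \<longleftrightarrow> f \<in> Ar C \<and> Dom C f = x \<and> Cod C f = y"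
  by (simp add: Hom_def)

lemma comp_ar [simp]:
  assumes "f \<in> Ar C" "g \<in> Ar C" "Cod C f = Dom C g"
  shows "g \<cdot> f \<in> Ar C" "Dom C (g \<cdot> f) = Dom C f" "Cod C (g \<cdot> f) = Cod C g"
  using comp_hom[of f "Dom C f" "Cod C f" g "Cod C g"] assms by simp_all

lemma id_ar [simp]:
  assumes "x \<in> Ob C"
  shows "Id C x \<in> Ar C" "Dom C (Id C x) = x" "Cod C (Id C x) = x"
  using id_hom[OF assms] by simp_all

lemma comp_id [simp]:
  "f \<in> Ar C \<Longrightarrow> Cod C f = y \<Longrightarrow> Id C y \<cdot> f = f" "f \<in> Ar C \<Longrightarrow> Dom C f = x \<Longrightarrow> f \<cdot> Id C x = f"
  using id_left[of f "Dom C f" y] id_right[of f x "Cod C f"] by simp_all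

lemma comp_assoc_ar [simp]:
  "f \<in> Ar C \<Longrightarrow> g \<in> Ar C \<Longrightarrow> h \<in> Ar C \<Longrightarrow> Cod C f = Dom C g \<Longrightarrow> Cod C g = Dom C h \<Longrightarrow>
    (h \<cdot> g) \<cdot> f = h \<cdot> (g \<cdot> f)"
  using comp_assoc by simp

declare dom_ob [simp] cod_ob [simp]

text \<open>
Composites are kept associated to the right, so a commuting square has to be applied in front of
a further factor.
\<close>

lemma whisker:
  assumes "g \<cdot> f = k \<cdot> h" and "f \<in> Ar C" "g \<in> Ar C" "h \<in> Ar C" "k \<in> Ar C" "z \<in> Ar C"
    and "Cod C f = Dom C g" "Cod C h = Dom C k" "Cod C z = Dom C f" "Cod C z = Dom C h"
  shows "g \<cdot> (f \<cdot> z) = k \<cdot> (h \<cdot> z)"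
proof -
  have "g \<cdot> (f \<cdot> z) = (g \<cdot> f) \<cdot> z" using assms(2-) by simp
  also have "\<dots> = k \<cdot> (h \<cdot> z)" unfolding assms(1) using assms(2-) by simp
  finally show ?thesis .
qed

lemma inverseD:
  assumes "is_inverse C f g"
  shows "f \<in> Ar C" "g \<in> Ar C" "Dom C g = Cod C f" "Cod C g = Dom C f"
    "g \<cdot> f = Id C (Dom C f)" "f \<cdot> g = Id C (Cod C f)"
  using assms by (simp_all add: is_inverse_def)

lemma inverse_cancel:
  assumes "is_inverse C f g" "x \<in> Ar C"
  shows "Cod C x = Dom C f \<Longrightarrow> g \<cdot> (f \<cdot> x) = x" "Cod C x = Cod C f \<Longrightarrow> f \<cdot> (g \<cdot> x) = x"
proof -
  note i = inverseD[OF assms(1)]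
  show "g \<cdot> (f \<cdot> x) = x" if x: "Cod C x = Dom C f"
  proof -
    have "g \<cdot> (f \<cdot> x) = (g \<cdot> f) \<cdot> x" using comp_assoc_ar[OF assms(2) i(1,2) x] i(3) by simp
    then show ?thesis using i(5) assms(2) x by simp
  qed
  show "f \<cdot> (g \<cdot> x) = x" if x: "Cod C x = Cod C f"
  proof -
    have "f \<cdot> (g \<cdot> x) = (f \<cdot> g) \<cdot> x" using comp_assoc_ar[OF assms(2) i(2,1)] i(3,4) x by simp
    then show ?thesis using i(6) assms(2) x by simp
  qed
qed

lemma inverse_ar_eqI:
  assumes "is_inverse C f g" shows "inverse_ar C f = g"
  unfolding inverse_ar_def
proof (rule the_equality)
  fix h assume h: "is_inverse C f h"
  have "h = h \<cdot> (f \<cdot> g)" using inverseD[OF assms] inverseD[OF h] by simp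
  also have "\<dots> = g" using inverseD[OF assms] inverse_cancel(1)[OF h, of g] by simp
  finally show "h = g" .
qed (rule assms)

lemma is_inverse_inverse_ar: "is_iso C f \<Longrightarrow> is_inverse C f (inverse_ar C f)"
  unfolding is_iso_def using inverse_ar_eqI by blast

lemma iso_mono:
  assumes "is_iso C f" "f \<cdot> x = f \<cdot> y" "x \<in> Ar C" "y \<in> Ar C" "Cod C x = Dom C f" "Cod C y = Dom C f"
  shows "x = y"
proof -
  obtain g where i: "is_inverse C f g" using assms(1) by (auto simp: is_iso_def)
  have "x = g \<cdot> (f \<cdot> x)" using inverse_cancel(1)[OF i] assms(3,5) by simp
  also have "\<dots> = y" using inverse_cancel(1)[OF i] assms(2,4,6) by simp
  finally show ?thesis .
qed

lemma iso_comp: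
  assumes "is_iso C f" "is_iso C g" "Cod C f = Dom C g"
  shows "is_iso C (g \<cdot> f)"
proof -
  obtain f' g' where i: "is_inverse C f f'" "is_inverse C g g'"
    using assms by (auto simp: is_iso_def)
  have "is_inverse C (g \<cdot> f) (f' \<cdot> g')"
    unfolding is_inverse_def using inverseD[OF i(1)] inverseD[OF i(2)] assms(3)
      inverse_cancel(1)[OF i(2), of f] inverse_cancel(2)[OF i(1), of g'] by simp
  then show ?thesis by (auto simp: is_iso_def)
qed

lemma terminal_unique:
  "is_terminal C x \<Longrightarrow> f \<in> Ar C \<Longrightarrow> g \<in> Ar C \<Longrightarrow> Dom C f = Dom C g \<Longrightarrow> Cod C f = x \<Longrightarrow> Cod C g = x \<Longrightarrow> f = g"
  unfolding is_terminal_def by (metis dom_ob in_Hom)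

lemma pullbackD:
  assumes "is_pullback C t l r b"
  shows "t \<in> Ar C" "l \<in> Ar C" "r \<in> Ar C" "b \<in> Ar C" "Dom C l = Dom C t" "Cod C t = Dom C r"
    "Cod C l = Dom C b" "Cod C b = Cod C r" "r \<cdot> t = b \<cdot> l"
  using assms by (simp_all add: is_pullback_def)

lemma pullback_lift:
  assumes "is_pullback C t l r b"
    and "x \<in> Ar C" "y \<in> Ar C" "Dom C x = Dom C y" "Cod C x = Dom C r" "Cod C y = Dom C b"
    and "r \<cdot> x = b \<cdot> y"
  obtains h where "h \<in> Ar C" "Dom C h = Dom C x" "Cod C h = Dom C t" "t \<cdot> h = x" "l \<cdot> h = y"
proof -
  have "\<exists>!h. h \<in> Hom C (Dom C x) (Dom C t) \<and> t \<cdot> h = x \<and> l \<cdot> h = y"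
    using assms unfolding is_pullback_def by (elim conjE) (simp del: in_Hom, simp)
  then show ?thesis using that by auto
qed

lemma pullback_unique:
  assumes pb: "is_pullback C t l r b"
    and h: "h \<in> Ar C" "h' \<in> Ar C" "Dom C h = Dom C h'" "Cod C h = Dom C t" "Cod C h' = Dom C t"
    and eq: "t \<cdot> h = t \<cdot> h'" "l \<cdot> h = l \<cdot> h'"
  shows "h = h'"
proof -
  note p = pullbackD[OF pb]
  have "r \<cdot> (t \<cdot> h) = b \<cdot> (l \<cdot> h)" by (rule whisker) (use p h in simp_all)
  moreover have "t \<cdot> h \<in> Hom C (Dom C h) (Dom C r)" "l \<cdot> h \<in> Hom C (Dom C h) (Dom C b)" "Dom C h \<in> Ob C"
    using p h by simp_all
  ultimately have "\<exists>!k. k \<in> Hom C (Dom C h) (Dom C t) \<and> t \<cdot> k = t \<cdot> h \<and> l \<cdot> k = l \<cdot> h"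
    using pb unfolding is_pullback_def by blast
  then show ?thesis using h eq by (metis in_Hom)
qed

lemma pullbackI:
  assumes "t \<in> Ar C" "l \<in> Ar C" "r \<in> Ar C" "b \<in> Ar C" "Dom C l = Dom C t" "Cod C t = Dom C r"
    "Cod C l = Dom C b" "Cod C b = Cod C r" "r \<cdot> t = b \<cdot> l"
    and ex: "\<And>x y. x \<in> Ar C \<Longrightarrow> y \<in> Ar C \<Longrightarrow> Dom C x = Dom C y \<Longrightarrow> Cod C x = Dom C r \<Longrightarrow>
      Cod C y = Dom C b \<Longrightarrow> r \<cdot> x = b \<cdot> y \<Longrightarrow>
      \<exists>h. h \<in> Ar C \<and> Dom C h = Dom C x \<and> Cod C h = Dom C t \<and> t \<cdot> h = x \<and> l \<cdot> h = y"
    and un: "\<And>h h'. h \<in> Ar C \<Longrightarrow> h' \<in> Ar C \<Longrightarrow> Dom C h = Dom C h' \<Longrightarrow> Cod C h = Dom C t \<Longrightarrow>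
      Cod C h' = Dom C t \<Longrightarrow> t \<cdot> h = t \<cdot> h' \<Longrightarrow> l \<cdot> h = l \<cdot> h' \<Longrightarrow> h = h'"
  shows "is_pullback C t l r b"
  unfolding is_pullback_def
proof (intro conjI ballI impI)
  fix w x y assume *: "x \<in> Hom C w (Dom C r)" "y \<in> Hom C w (Dom C b)" "r \<cdot> x = b \<cdot> y"
  obtain h where h: "h \<in> Ar C" "Dom C h = Dom C x" "Cod C h = Dom C t" "t \<cdot> h = x" "l \<cdot> h = y"
    using ex[of x y] * by auto
  show "\<exists>!h. h \<in> Hom C w (Dom C t) \<and> t \<cdot> h = x \<and> l \<cdot> h = y"
  proof (rule ex1I[of _ h])
    show "h \<in> Hom C w (Dom C t) \<and> t \<cdot> h = x \<and> l \<cdot> h = y" using h * by simp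
    fix k assume "k \<in> Hom C w (Dom C t) \<and> t \<cdot> k = x \<and> l \<cdot> k = y"
    then show "k = h" using h * by - (rule un, simp_all)
  qed
qed (use assms in simp_all)

lemma pairing:
  assumes "is_pullback C p0 p1 r b"
    and "x \<in> Ar C" "y \<in> Ar C" "Dom C x = Dom C y" "Cod C x = Dom C r" "Cod C y = Dom C b"
    and "r \<cdot> x = b \<cdot> y"
  shows "pairing C p0 p1 x y \<in> Ar C" "Dom C (pairing C p0 p1 x y) = Dom C x"
    "Cod C (pairing C p0 p1 x y) = Dom C p0"
    "p0 \<cdot> pairing C p0 p1 x y = x" "p1 \<cdot> pairing C p0 p1 x y = y"
proof -
  obtain h where h: "h \<in> Ar C" "Dom C h = Dom C x" "Cod C h = Dom C p0" "p0 \<cdot> h = x" "p1 \<cdot> h = y"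
    using pullback_lift[OF assms] .
  have "pairing C p0 p1 x y = h" unfolding pairing_def
    using h by (intro the_equality) (auto intro: pullback_unique[OF assms(1)])
  then show "pairing C p0 p1 x y \<in> Ar C" "Dom C (pairing C p0 p1 x y) = Dom C x"
    "Cod C (pairing C p0 p1 x y) = Dom C p0"
    "p0 \<cdot> pairing C p0 p1 x y = x" "p1 \<cdot> pairing C p0 p1 x y = y" using h by simp_all
qed

lemma pairing_eqI:
  assumes "is_pullback C p0 p1 r b" "h \<in> Ar C" "Cod C h = Dom C p0" "p0 \<cdot> h = x" "p1 \<cdot> h = y"
  shows "pairing C p0 p1 x y = h"
  unfolding pairing_def
  using assms pullback_unique[OF assms(1)] pullbackD[OF assms(1)] by (intro the_equality) auto

lemma pairing_comp:
  assumes "is_pullback C p0 p1 r b"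
    and "x \<in> Ar C" "y \<in> Ar C" "Dom C x = Dom C y" "Cod C x = Dom C r" "Cod C y = Dom C b"
    and "r \<cdot> x = b \<cdot> y" and "u \<in> Ar C" "Cod C u = Dom C x"
  shows "pairing C p0 p1 (x \<cdot> u) (y \<cdot> u) = pairing C p0 p1 x y \<cdot> u"
proof (rule pairing_eqI[OF assms(1)])
  note h = pairing[OF assms(1-7)] and p = pullbackD[OF assms(1)]
  show "p0 \<cdot> (pairing C p0 p1 x y \<cdot> u) = x \<cdot> u"
    using comp_assoc_ar[of u "pairing C p0 p1 x y" p0] h(4) h(1-3) p assms(8,9) by simp
  show "p1 \<cdot> (pairing C p0 p1 x y \<cdot> u) = y \<cdot> u"
    using comp_assoc_ar[of u "pairing C p0 p1 x y" p1] h(5) h(1-3) p assms(8,9) by simp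
qed (use pairing[OF assms(1-7)] assms(8,9) in simp_all)

lemma pullback_paste:
  assumes A: "is_pullback C t1 l m b1" and B: "is_pullback C t2 m r b2"
  shows "is_pullback C (t2 \<cdot> t1) l r (b2 \<cdot> b1)"
proof (rule pullbackI)
  note a = pullbackD[OF A] and b = pullbackD[OF B]
  have "r \<cdot> (t2 \<cdot> t1) = b2 \<cdot> (m \<cdot> t1)" by (rule whisker) (use a b in simp_all)
  then show "r \<cdot> (t2 \<cdot> t1) = b2 \<cdot> b1 \<cdot> l" using a b by simp
  {
    fix x y assume xy: "x \<in> Ar C" "y \<in> Ar C" "Dom C x = Dom C y" "Cod C x = Dom C r"
      "Cod C y = Dom C (b2 \<cdot> b1)" "r \<cdot> x = b2 \<cdot> b1 \<cdot> y"
    have "r \<cdot> x = b2 \<cdot> (b1 \<cdot> y)" using xy a b by simp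
    from pullback_lift[OF B _ _ _ _ _ this] xy a b
    obtain k where k: "k \<in> Ar C" "Dom C k = Dom C x" "Cod C k = Dom C t2" "t2 \<cdot> k = x" "m \<cdot> k = b1 \<cdot> y"
      by auto
    from pullback_lift[OF A _ _ _ _ _ this(5)] this(1-3) xy a b
    obtain h where h: "h \<in> Ar C" "Dom C h = Dom C k" "Cod C h = Dom C t1" "t1 \<cdot> h = k" "l \<cdot> h = y"
      by auto
    show "\<exists>h. h \<in> Ar C \<and> Dom C h = Dom C x \<and> Cod C h = Dom C (t2 \<cdot> t1) \<and> t2 \<cdot> t1 \<cdot> h = x \<and> l \<cdot> h = y"
      by (rule exI[of _ h]) (use h k a b in simp)
  }
  fix h h' assume h: "h \<in> Ar C" "h' \<in> Ar C" "Dom C h = Dom C h'" "Cod C h = Dom C (t2 \<cdot> t1)"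
    "Cod C h' = Dom C (t2 \<cdot> t1)" "t2 \<cdot> t1 \<cdot> h = t2 \<cdot> t1 \<cdot> h'" "l \<cdot> h = l \<cdot> h'"
  have "m \<cdot> (t1 \<cdot> h) = b1 \<cdot> (l \<cdot> h)" "m \<cdot> (t1 \<cdot> h') = b1 \<cdot> (l \<cdot> h')"
    by (rule whisker; use a b h in simp)+
  then have "t1 \<cdot> h = t1 \<cdot> h'"
    using a b h by - (rule pullback_unique[OF B], simp_all)
  then show "h = h'" using a b h by - (rule pullback_unique[OF A], simp_all)
qed (use pullbackD[OF A] pullbackD[OF B] in simp_all)

text \<open>
Enlarging the base of a cospan along a monomorphism does not change the cones. The lemma is used for isomorphisms
and for maps between terminal objects.
\<close>

lemma pullback_mono_base:
  assumes P: "is_pullback C t l r b" and i: "i \<in> Ar C" "Dom C i = Cod C r"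
    and mono: "\<And>u v. u \<in> Ar C \<Longrightarrow> v \<in> Ar C \<Longrightarrow> Dom C u = Dom C v \<Longrightarrow> Cod C u = Dom C i \<Longrightarrow>
      Cod C v = Dom C i \<Longrightarrow> i \<cdot> u = i \<cdot> v \<Longrightarrow> u = v"
  shows "is_pullback C t l (i \<cdot> r) (i \<cdot> b)"
proof (rule pullbackI)
  note p = pullbackD[OF P]
  fix x y assume xy: "x \<in> Ar C" "y \<in> Ar C" "Dom C x = Dom C y" "Cod C x = Dom C (i \<cdot> r)"
    "Cod C y = Dom C (i \<cdot> b)" "i \<cdot> r \<cdot> x = i \<cdot> b \<cdot> y"
  have "r \<cdot> x = b \<cdot> y" using xy p i by - (rule mono, simp_all)
  then obtain h where "h \<in> Ar C" "Dom C h = Dom C x" "Cod C h = Dom C t" "t \<cdot> h = x" "l \<cdot> h = y"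
    using xy p i pullback_lift[OF P, of x y] by auto
  then show "\<exists>h. h \<in> Ar C \<and> Dom C h = Dom C x \<and> Cod C h = Dom C t \<and> t \<cdot> h = x \<and> l \<cdot> h = y"
    by blast
qed (use pullbackD[OF P] i in \<open>simp_all add: pullback_unique[OF P]\<close>)

text \<open>
Conversely, every cone over \<open>(r, b)\<close> is one over \<open>(i \<cdot> r, i \<cdot> b)\<close>; once the square commutes, it inherits the
universal property. The two lemmas transport preservation of pullbacks from one terminal object to another.
\<close>

lemma pullback_reduce_base:
  assumes P: "is_pullback C t l (i \<cdot> r) (i \<cdot> b)" and i: "i \<in> Ar C" "r \<in> Ar C" "b \<in> Ar C"
    "Dom C i = Cod C r" "Cod C b = Cod C r" and comm: "r \<cdot> t = b \<cdot> l"
  shows "is_pullback C t l r b"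
proof (rule pullbackI)
  note p = pullbackD[OF P]
  fix x y assume xy: "x \<in> Ar C" "y \<in> Ar C" "Dom C x = Dom C y" "Cod C x = Dom C r"
    "Cod C y = Dom C b" "r \<cdot> x = b \<cdot> y"
  have "(i \<cdot> r) \<cdot> x = (i \<cdot> b) \<cdot> y" using xy p i by simp
  then obtain h where "h \<in> Ar C" "Dom C h = Dom C x" "Cod C h = Dom C t" "t \<cdot> h = x" "l \<cdot> h = y"
    using xy p i pullback_lift[OF P, of x y] by auto
  then show "\<exists>h. h \<in> Ar C \<and> Dom C h = Dom C x \<and> Cod C h = Dom C t \<and> t \<cdot> h = x \<and> l \<cdot> h = y"
    by blast
qed (use pullbackD[OF P] i comm in \<open>simp_all add: pullback_unique[OF P]\<close>)

text \<open>
Used for the components of a natural isomorphism between functors: if one functor sends a square to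
a pullback, so does the other.
\<close>

lemma pullback_iso_square:
  assumes P: "is_pullback C t' l' r' b'"
    and a: "t \<in> Ar C" "l \<in> Ar C" "r \<in> Ar C" "b \<in> Ar C" "Dom C l = Dom C t" "Cod C t = Dom C r"
      "Cod C l = Dom C b" "Cod C b = Cod C r" "r \<cdot> t = b \<cdot> l"
    and iso: "is_iso C kP" "is_iso C kR" "is_iso C kL" "is_iso C kZ"
    and k: "kP \<in> Hom C (Dom C t) (Dom C t')" "kR \<in> Hom C (Dom C r) (Dom C r')"
      "kL \<in> Hom C (Dom C b) (Dom C b')" "kZ \<in> Hom C (Cod C r) (Cod C r')"
    and comm: "kR \<cdot> t = t' \<cdot> kP" "kL \<cdot> l = l' \<cdot> kP" "kZ \<cdot> r = r' \<cdot> kR" "kZ \<cdot> b = b' \<cdot> kL"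
  shows "is_pullback C t l r b"
proof (rule pullbackI)
  note p = pullbackD[OF P]
  {
    fix x y assume xy: "x \<in> Ar C" "y \<in> Ar C" "Dom C x = Dom C y" "Cod C x = Dom C r"
      "Cod C y = Dom C b" "r \<cdot> x = b \<cdot> y"
    have "r' \<cdot> (kR \<cdot> x) = kZ \<cdot> (r \<cdot> x)" by (rule whisker) (use comm p a k xy in simp_all)
    moreover have "b' \<cdot> (kL \<cdot> y) = kZ \<cdot> (b \<cdot> y)" by (rule whisker) (use comm p a k xy in simp_all)
    ultimately have "r' \<cdot> (kR \<cdot> x) = b' \<cdot> (kL \<cdot> y)" using xy by simp
    from pullback_lift[OF P _ _ _ _ _ this] p a k xy
    obtain h where h: "h \<in> Ar C" "Dom C h = Dom C x" "Cod C h = Dom C t'" "t' \<cdot> h = kR \<cdot> x" "l' \<cdot> h = kL \<cdot> y"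
      by auto
    obtain j where j: "is_inverse C kP j" using iso(1) by (auto simp: is_iso_def)
    note jD = inverseD[OF j]
    have kj: "kP \<cdot> (j \<cdot> h) = h" using inverse_cancel(2)[OF j h(1)] h k by simp
    have "kR \<cdot> (t \<cdot> (j \<cdot> h)) = t' \<cdot> (kP \<cdot> (j \<cdot> h))" by (rule whisker) (use comm p a k h jD in simp_all)
    then have "t \<cdot> (j \<cdot> h) = x" using kj h xy a k p jD by - (rule iso_mono[OF iso(2)], simp_all)
    moreover have "kL \<cdot> (l \<cdot> (j \<cdot> h)) = l' \<cdot> (kP \<cdot> (j \<cdot> h))" by (rule whisker) (use comm p a k h jD in simp_all)
    then have "l \<cdot> (j \<cdot> h) = y" using kj h xy a k p jD by - (rule iso_mono[OF iso(3)], simp_all)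
    ultimately show "\<exists>h. h \<in> Ar C \<and> Dom C h = Dom C x \<and> Cod C h = Dom C t \<and> t \<cdot> h = x \<and> l \<cdot> h = y"
      using h k jD by (intro exI[of _ "j \<cdot> h"]) simp
  }
  fix h h' assume h: "h \<in> Ar C" "h' \<in> Ar C" "Dom C h = Dom C h'" "Cod C h = Dom C t"
    "Cod C h' = Dom C t" "t \<cdot> h = t \<cdot> h'" "l \<cdot> h = l \<cdot> h'"
  have "t' \<cdot> (kP \<cdot> h) = kR \<cdot> (t \<cdot> h)" "t' \<cdot> (kP \<cdot> h') = kR \<cdot> (t \<cdot> h')"
     "l' \<cdot> (kP \<cdot> h) = kL \<cdot> (l \<cdot> h)" "l' \<cdot> (kP \<cdot> h') = kL \<cdot> (l \<cdot> h')"
    by (rule whisker; use comm p a k h in simp)+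
  then have "kP \<cdot> h = kP \<cdot> h'" using h a p k by - (rule pullback_unique[OF P], simp_all)
  then show "h = h'" using h k by - (rule iso_mono[OF iso(1)], simp_all)
qed (use a in simp_all)

lemma powerD:
  assumes "is_pullback_power C q n r \<pi>"
  shows "q \<in> Ar C" "r \<in> Ar C" "Cod C r = Cod C q"
    "i < n \<Longrightarrow> \<pi> i \<in> Ar C" "i < n \<Longrightarrow> Dom C (\<pi> i) = Dom C r" "i < n \<Longrightarrow> Cod C (\<pi> i) = Dom C q"
    "i < n \<Longrightarrow> q \<cdot> \<pi> i = r"
  using assms by (simp_all add: is_pullback_power_def)

lemma power_universal:
  assumes "is_pullback_power C q n r \<pi>"
    and "s \<in> Ar C" "Cod C s = Cod C q"
    and "\<And>i. i < n \<Longrightarrow> x i \<in> Ar C \<and> Dom C (x i) = Dom C s \<and> Cod C (x i) = Dom C q \<and> q \<cdot> x i = s"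
  shows "\<exists>!h. h \<in> Hom C (Dom C s) (Dom C r) \<and> r \<cdot> h = s \<and> (\<forall>i<n. \<pi> i \<cdot> h = x i)"
proof -
  have "s \<in> Hom C (Dom C s) (Cod C q)" "\<forall>i<n. x i \<in> Hom C (Dom C s) (Dom C q) \<and> q \<cdot> x i = s" "Dom C s \<in> Ob C"
    using assms(2-) by simp_all
  then show ?thesis using assms(1) unfolding is_pullback_power_def by blast
qed

lemma power_lift:
  assumes "is_pullback_power C q n r \<pi>"
    and "s \<in> Ar C" "Cod C s = Cod C q"
    and "\<And>i. i < n \<Longrightarrow> x i \<in> Ar C \<and> Dom C (x i) = Dom C s \<and> Cod C (x i) = Dom C q \<and> q \<cdot> x i = s"
  obtains h where "h \<in> Ar C" "Dom C h = Dom C s" "Cod C h = Dom C r" "r \<cdot> h = s" "\<And>i. i < n \<Longrightarrow> \<pi> i \<cdot> h = x i"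
proof -
  show ?thesis using power_universal[of q n r \<pi> s x, OF assms] that by auto
qed

lemma power_unique:
  assumes P: "is_pullback_power C q n r \<pi>"
    and h: "h \<in> Ar C" "h' \<in> Ar C" "Dom C h = Dom C h'" "Cod C h = Dom C r" "Cod C h' = Dom C r"
    and eq: "r \<cdot> h = r \<cdot> h'" "\<And>i. i < n \<Longrightarrow> \<pi> i \<cdot> h = \<pi> i \<cdot> h'"
  shows "h = h'"
proof -
  note p = powerD[OF P]
  have "q \<cdot> (\<pi> i \<cdot> h) = r \<cdot> h" if "i < n" for i
    using comp_assoc_ar[of h "\<pi> i" q] p(4-7)[OF that] p(1-3) h by simp
  then have "\<exists>!k. k \<in> Hom C (Dom C (r \<cdot> h)) (Dom C r) \<and> r \<cdot> k = r \<cdot> h \<and> (\<forall>i<n. \<pi> i \<cdot> k = \<pi> i \<cdot> h)"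
    using p h by (intro power_universal[OF P]) simp_all
  moreover have "h \<in> Hom C (Dom C (r \<cdot> h)) (Dom C r) \<and> r \<cdot> h = r \<cdot> h \<and> (\<forall>i<n. \<pi> i \<cdot> h = \<pi> i \<cdot> h)"
    "h' \<in> Hom C (Dom C (r \<cdot> h)) (Dom C r) \<and> r \<cdot> h' = r \<cdot> h \<and> (\<forall>i<n. \<pi> i \<cdot> h' = \<pi> i \<cdot> h)"
    using h eq p by simp_all
  ultimately show ?thesis by (elim ex1E) (metis (no_types))
qed

lemma powerI:
  assumes "q \<in> Ar C" "r \<in> Ar C" "Cod C r = Cod C q"
    and pi: "\<And>i. i < n \<Longrightarrow> \<pi> i \<in> Ar C \<and> Dom C (\<pi> i) = Dom C r \<and> Cod C (\<pi> i) = Dom C q \<and> q \<cdot> \<pi> i = r"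
    and ex: "\<And>s x. s \<in> Ar C \<Longrightarrow> Cod C s = Cod C q \<Longrightarrow>
      (\<And>i. i < n \<Longrightarrow> x i \<in> Ar C \<and> Dom C (x i) = Dom C s \<and> Cod C (x i) = Dom C q \<and> q \<cdot> x i = s) \<Longrightarrow>
      \<exists>h. h \<in> Ar C \<and> Dom C h = Dom C s \<and> Cod C h = Dom C r \<and> r \<cdot> h = s \<and> (\<forall>i<n. \<pi> i \<cdot> h = x i)"
    and un: "\<And>h h'. h \<in> Ar C \<Longrightarrow> h' \<in> Ar C \<Longrightarrow> Dom C h = Dom C h' \<Longrightarrow> Cod C h = Dom C r \<Longrightarrow>
      Cod C h' = Dom C r \<Longrightarrow> r \<cdot> h = r \<cdot> h' \<Longrightarrow> (\<And>i. i < n \<Longrightarrow> \<pi> i \<cdot> h = \<pi> i \<cdot> h') \<Longrightarrow> h = h'"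
  shows "is_pullback_power C q n r \<pi>"
  unfolding is_pullback_power_def
proof (intro conjI ballI allI impI)
  fix w s x assume *: "s \<in> Hom C w (Cod C q)" "\<forall>i<n. x i \<in> Hom C w (Dom C q) \<and> q \<cdot> x i = s"
  then obtain h where h: "h \<in> Ar C" "Dom C h = w" "Cod C h = Dom C r" "r \<cdot> h = s" "\<forall>i<n. \<pi> i \<cdot> h = x i"
    using ex[of s x] by auto
  show "\<exists>!h. h \<in> Hom C w (Dom C r) \<and> r \<cdot> h = s \<and> (\<forall>i<n. \<pi> i \<cdot> h = x i)"
  proof (rule ex1I[of _ h])
    show "h \<in> Hom C w (Dom C r) \<and> r \<cdot> h = s \<and> (\<forall>i<n. \<pi> i \<cdot> h = x i)" using h by simp
    fix k assume "k \<in> Hom C w (Dom C r) \<and> r \<cdot> k = s \<and> (\<forall>i<n. \<pi> i \<cdot> k = x i)"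
    then show "k = h" using h by - (rule un, simp_all)
  qed
qed (use assms in simp_all)

lemma power_cong:
  assumes "is_pullback_power C q n r \<pi>" "\<And>i. i < n \<Longrightarrow> \<pi>' i = \<pi> i"
  shows "is_pullback_power C q n r \<pi>'"
  using assms unfolding is_pullback_power_def by simp

text \<open>
The next two lemmas identify the \<open>n + 1\<close>st pullback power of \<open>q\<close> with the binary pullback of the \<open>n\<close>th one
and \<open>q\<close>; the square lies over the codomain of \<open>q\<close>. If all powers exist, a functor that preserves
pullbacks over this object therefore preserves them.
\<close>

lemma power_SucD:
  assumes S: "is_pullback_power C q (Suc n) r \<pi>" and N: "is_pullback_power C q n r' \<pi>'"
    and t: "t \<in> Ar C" "Dom C t = Dom C r" "Cod C t = Dom C r'" "r' \<cdot> t = r" "\<And>i. i < n \<Longrightarrow> \<pi>' i \<cdot> t = \<pi> i"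
  shows "is_pullback C t (\<pi> n) r' q"
proof (rule pullbackI)
  note s = powerD[OF S] and m = powerD[OF N]
  {
    fix x y assume xy: "x \<in> Ar C" "y \<in> Ar C" "Dom C x = Dom C y" "Cod C x = Dom C r'"
      "Cod C y = Dom C q" "r' \<cdot> x = q \<cdot> y"
    have "q \<cdot> (\<pi>' i \<cdot> x) = r' \<cdot> x" if "i < n" for i
      using comp_assoc_ar[of x "\<pi>' i" q] m(4-7)[OF that] m(1-3) xy by simp
    then have "\<exists>!h. h \<in> Hom C (Dom C (q \<cdot> y)) (Dom C r) \<and> r \<cdot> h = q \<cdot> y \<and>
        (\<forall>i<Suc n. \<pi> i \<cdot> h = (if i < n then \<pi>' i \<cdot> x else y))"
      using xy s m by (intro power_universal[OF S]) simp_all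
    then obtain h where h: "h \<in> Ar C" "Dom C h = Dom C y" "Cod C h = Dom C r" "r \<cdot> h = q \<cdot> y"
      "\<And>i. i < Suc n \<Longrightarrow> \<pi> i \<cdot> h = (if i < n then \<pi>' i \<cdot> x else y)"
      using xy m by auto
    have "t \<cdot> h = x"
    proof (rule power_unique[OF N])
      show "r' \<cdot> (t \<cdot> h) = r' \<cdot> x" using comp_assoc_ar[of h t r'] t h s m xy by simp
      fix i assume i: "i < n"
      then show "\<pi>' i \<cdot> (t \<cdot> h) = \<pi>' i \<cdot> x"
        using comp_assoc_ar[of h t "\<pi>' i"] t(5)[OF i] t h(5)[of i] h s m(4-7)[OF i] m(1-3) xy by simp
    qed (use t h s m xy in simp_all)
    moreover have "\<pi> n \<cdot> h = y" using h(5)[of n] by simp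
    ultimately show "\<exists>h. h \<in> Ar C \<and> Dom C h = Dom C x \<and> Cod C h = Dom C t \<and> t \<cdot> h = x \<and> \<pi> n \<cdot> h = y"
      using h t xy by (intro exI[of _ h]) simp
  }
  fix h h' assume h: "h \<in> Ar C" "h' \<in> Ar C" "Dom C h = Dom C h'" "Cod C h = Dom C t"
    "Cod C h' = Dom C t" "t \<cdot> h = t \<cdot> h'" "\<pi> n \<cdot> h = \<pi> n \<cdot> h'"
  have th: "r \<cdot> k = r' \<cdot> (t \<cdot> k)" "i < n \<Longrightarrow> \<pi> i \<cdot> k = \<pi>' i \<cdot> (t \<cdot> k)"
    if "k \<in> Ar C" "Cod C k = Dom C t" for k i
    using that t m comp_assoc_ar[of k t r'] comp_assoc_ar[of k t "\<pi>' i"] by simp_all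
  show "h = h'"
  proof (rule power_unique[OF S])
    show "r \<cdot> h = r \<cdot> h'" using th h by simp
    fix i assume "i < Suc n"
    then show "\<pi> i \<cdot> h = \<pi> i \<cdot> h'" using th h by (cases "i < n") (simp_all add: less_Suc_eq)
  qed (use h t in simp_all)
qed (use powerD[OF S] powerD[OF N] t in simp_all)

lemma power_SucI:
  assumes P: "is_pullback C t p r' q" and N: "is_pullback_power C q n r' \<pi>'"
  shows "is_pullback_power C q (Suc n) (r' \<cdot> t) (\<lambda>i. if i < n then \<pi>' i \<cdot> t else p)"
proof (rule powerI)
  note s = pullbackD[OF P] and m = powerD[OF N]
  have qt: "q \<cdot> (\<pi>' i \<cdot> t) = r' \<cdot> t" if "i < n" for i
    using comp_assoc_ar[of t "\<pi>' i" q] m(4-7)[OF that] m(1-3) s by simp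
  then show "(if i < n then \<pi>' i \<cdot> t else p) \<in> Ar C \<and> Dom C (if i < n then \<pi>' i \<cdot> t else p) = Dom C (r' \<cdot> t) \<and>
      Cod C (if i < n then \<pi>' i \<cdot> t else p) = Dom C q \<and> q \<cdot> (if i < n then \<pi>' i \<cdot> t else p) = r' \<cdot> t" for i
    using m s by simp
  {
    fix z x assume z: "z \<in> Ar C" "Cod C z = Cod C q" and
      x: "\<And>i. i < Suc n \<Longrightarrow> x i \<in> Ar C \<and> Dom C (x i) = Dom C z \<and> Cod C (x i) = Dom C q \<and> q \<cdot> x i = z"
    obtain k where k: "k \<in> Ar C" "Dom C k = Dom C z" "Cod C k = Dom C r'" "r' \<cdot> k = z" "\<And>i. i < n \<Longrightarrow> \<pi>' i \<cdot> k = x i"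
      using power_lift[OF N z, of x] x by (metis less_SucI)
    obtain h where h: "h \<in> Ar C" "Dom C h = Dom C k" "Cod C h = Dom C t" "t \<cdot> h = k" "p \<cdot> h = x n"
      using pullback_lift[OF P, of k "x n"] k x[of n] by auto
    have "(if i < n then \<pi>' i \<cdot> t else p) \<cdot> h = x i" if "i < Suc n" for i
      using that h k m s by (auto simp: less_Suc_eq)
    then show "\<exists>h. h \<in> Ar C \<and> Dom C h = Dom C z \<and> Cod C h = Dom C (r' \<cdot> t) \<and> r' \<cdot> t \<cdot> h = z \<and>
        (\<forall>i<Suc n. (if i < n then \<pi>' i \<cdot> t else p) \<cdot> h = x i)"
      using h k s(1-8) m x[of n] by (intro exI[of _ h]) simp
  }
  fix h h' assume h: "h \<in> Ar C" "h' \<in> Ar C" "Dom C h = Dom C h'" "Cod C h = Dom C (r' \<cdot> t)"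
    "Cod C h' = Dom C (r' \<cdot> t)" "r' \<cdot> t \<cdot> h = r' \<cdot> t \<cdot> h'"
    "\<And>i. i < Suc n \<Longrightarrow> (if i < n then \<pi>' i \<cdot> t else p) \<cdot> h = (if i < n then \<pi>' i \<cdot> t else p) \<cdot> h'"
  have "t \<cdot> h = t \<cdot> h'"
  proof (rule power_unique[OF N])
    fix i assume i: "i < n"
    then show "\<pi>' i \<cdot> (t \<cdot> h) = \<pi>' i \<cdot> (t \<cdot> h')" using h(7)[of i] h(1-5) m s by simp
  qed (use h(1-6) m s(1-8) in simp_all)
  then show "h = h'" using h(7)[of n] h(1-5) s m by - (rule pullback_unique[OF P], simp_all)
qed (use pullbackD[OF P] powerD[OF N] in simp_all)

lemma power_0_iff: "is_pullback_power C q 0 r \<pi> \<longleftrightarrow> q \<in> Ar C \<and> is_iso C r \<and> Cod C r = Cod C q"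
proof
  assume P: "is_pullback_power C q 0 r \<pi>"
  note p = powerD[OF P]
  obtain h where h: "h \<in> Ar C" "Dom C h = Cod C q" "Cod C h = Dom C r" "r \<cdot> h = Id C (Cod C q)"
    using power_lift[OF P, of "Id C (Cod C q)"] p by auto
  have "h \<cdot> r = Id C (Dom C r)"
    by (rule power_unique[OF P]) (use h p comp_assoc_ar[of r h r] in simp_all)
  then have "is_inverse C r h" using h p by (simp add: is_inverse_def)
  then show "q \<in> Ar C \<and> is_iso C r \<and> Cod C r = Cod C q" using p by (auto simp: is_iso_def)
next
  assume *: "q \<in> Ar C \<and> is_iso C r \<and> Cod C r = Cod C q"
  then obtain h where i: "is_inverse C r h" by (auto simp: is_iso_def)
  note h = inverseD[OF i]
  show "is_pullback_power C q 0 r \<pi>"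
  proof (rule powerI)
    fix s assume "s \<in> Ar C" "Cod C s = Cod C q"
    then show "\<exists>k. k \<in> Ar C \<and> Dom C k = Dom C s \<and> Cod C k = Dom C r \<and> r \<cdot> k = s \<and> (\<forall>i<0. \<pi> i \<cdot> k = x i)" for x
      using h * inverse_cancel(2)[OF i] by (intro exI[of _ "h \<cdot> s"]) simp
  next
    fix k k' assume "k \<in> Ar C" "k' \<in> Ar C" "Cod C k = Dom C r" "Cod C k' = Dom C r" "r \<cdot> k = r \<cdot> k'"
    then show "k = k'" using * iso_mono[of r k k'] by blast
  qed (use h * in simp_all)
qed

text \<open>
Together with the following comparison of two powers of the same map, this transfers a
property from one chosen pullback power to all others.
\<close>

lemma power_precomp_iso:
  assumes P: "is_pullback_power C q n r \<pi>" and u: "is_iso C u" "Cod C u = Dom C r"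
  shows "is_pullback_power C q n (r \<cdot> u) (\<lambda>i. \<pi> i \<cdot> u)"
proof -
  obtain v where i: "is_inverse C u v" using u by (auto simp: is_iso_def)
  note v = inverseD[OF i] and p = powerD[OF P]
  show ?thesis
  proof (rule powerI)
    fix j assume "j < n"
    then show "\<pi> j \<cdot> u \<in> Ar C \<and> Dom C (\<pi> j \<cdot> u) = Dom C (r \<cdot> u) \<and> Cod C (\<pi> j \<cdot> u) = Dom C q \<and> q \<cdot> (\<pi> j \<cdot> u) = r \<cdot> u"
      using comp_assoc_ar[of u "\<pi> j" q] p u v by simp
  next
    fix s x assume s: "s \<in> Ar C" "Cod C s = Cod C q" and
      x: "\<And>i. i < n \<Longrightarrow> x i \<in> Ar C \<and> Dom C (x i) = Dom C s \<and> Cod C (x i) = Dom C q \<and> q \<cdot> x i = s"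
    obtain h where h: "h \<in> Ar C" "Dom C h = Dom C s" "Cod C h = Dom C r" "r \<cdot> h = s" "\<And>i. i < n \<Longrightarrow> \<pi> i \<cdot> h = x i"
      using power_lift[OF P s, of x] x by blast
    have "u \<cdot> (v \<cdot> h) = h" using inverse_cancel(2)[OF i] h u by simp
    then show "\<exists>h. h \<in> Ar C \<and> Dom C h = Dom C s \<and> Cod C h = Dom C (r \<cdot> u) \<and> r \<cdot> u \<cdot> h = s \<and> (\<forall>i<n. \<pi> i \<cdot> u \<cdot> h = x i)"
      using h v u p by (intro exI[of _ "v \<cdot> h"]) simp
  next
    fix h h' assume h: "h \<in> Ar C" "h' \<in> Ar C" "Dom C h = Dom C h'" "Cod C h = Dom C (r \<cdot> u)"
      "Cod C h' = Dom C (r \<cdot> u)" "r \<cdot> u \<cdot> h = r \<cdot> u \<cdot> h'" "\<And>i. i < n \<Longrightarrow> \<pi> i \<cdot> u \<cdot> h = \<pi> i \<cdot> u \<cdot> h'"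
    have "u \<cdot> h = u \<cdot> h'"
    proof (rule power_unique[OF P])
      fix j assume "j < n"
      then show "\<pi> j \<cdot> (u \<cdot> h) = \<pi> j \<cdot> (u \<cdot> h')" using h(7)[of j] h(1-5) p u v by simp
    qed (use h(1-6) p u v in simp_all)
    then show "h = h'" using h(1-5) u p v by - (rule iso_mono[OF u(1)], simp_all)
  qed (use p u v in simp_all)
qed

lemma power_compare:
  assumes P: "is_pullback_power C q n r \<pi>" and Q: "is_pullback_power C q n r' \<pi>'"
  obtains u where "is_iso C u" "u \<in> Ar C" "Dom C u = Dom C r" "Cod C u = Dom C r'" "r' \<cdot> u = r"
    "\<And>i. i < n \<Longrightarrow> \<pi>' i \<cdot> u = \<pi> i"
proof -
  note p = powerD[OF P] and q = powerD[OF Q]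
  obtain u where u: "u \<in> Ar C" "Dom C u = Dom C r" "Cod C u = Dom C r'" "r' \<cdot> u = r"
    "\<And>i. i < n \<Longrightarrow> \<pi>' i \<cdot> u = \<pi> i"
    using power_lift[OF Q, of r \<pi>] p by blast
  obtain v where v: "v \<in> Ar C" "Dom C v = Dom C r'" "Cod C v = Dom C r" "r \<cdot> v = r'"
    "\<And>i. i < n \<Longrightarrow> \<pi> i \<cdot> v = \<pi>' i"
    using power_lift[OF P, of r' \<pi>'] q by blast
  have vu: "r \<cdot> (v \<cdot> u) = r" "i < n \<Longrightarrow> \<pi> i \<cdot> (v \<cdot> u) = \<pi> i"
    and uv: "r' \<cdot> (u \<cdot> v) = r'" "i < n \<Longrightarrow> \<pi>' i \<cdot> (u \<cdot> v) = \<pi>' i" for i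
    using u v p q comp_assoc_ar[of u v r] comp_assoc_ar[of u v "\<pi> i"]
      comp_assoc_ar[of v u r'] comp_assoc_ar[of v u "\<pi>' i"] by simp_all
  have "v \<cdot> u = Id C (Dom C r)"
    by (rule power_unique[OF P]) (use u v p vu in simp_all)
  moreover have "u \<cdot> v = Id C (Dom C r')"
    by (rule power_unique[OF Q]) (use u v q uv in simp_all)
  ultimately have "is_inverse C u v" using u v by (simp add: is_inverse_def)
  then have "is_iso C u" by (auto simp: is_iso_def)
  then show ?thesis using that u by blast
qed

lemma power_2_of_pullback:
  assumes P: "is_pullback C p0 p1 q q"
  shows "is_pullback_power C q 2 (q \<cdot> p0) (\<lambda>i. if i = 0 then p0 else p1)"
proof (rule powerI)
  note p = pullbackD[OF P]
  {
    fix s x assume s: "s \<in> Ar C" "Cod C s = Cod C q" and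
      x: "\<And>i::nat. i < 2 \<Longrightarrow> x i \<in> Ar C \<and> Dom C (x i) = Dom C s \<and> Cod C (x i) = Dom C q \<and> q \<cdot> x i = s"
    have x0: "x 0 \<in> Ar C" "Dom C (x 0) = Dom C s" "Cod C (x 0) = Dom C q" "q \<cdot> x 0 = s"
      and x1: "x 1 \<in> Ar C" "Dom C (x 1) = Dom C s" "Cod C (x 1) = Dom C q" "q \<cdot> x 1 = s"
      using x[of 0] x[of 1] by simp_all
    obtain h where h: "h \<in> Ar C" "Dom C h = Dom C (x 0)" "Cod C h = Dom C p0" "p0 \<cdot> h = x 0" "p1 \<cdot> h = x 1"
      by (rule pullback_lift[OF P x0(1) x1(1) _ x0(3) x1(3)]) (simp_all only: x0 x1)
    have "q \<cdot> p0 \<cdot> h = s" using h(1,3,4) p(1-6) x0(4) by simp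
    moreover have "\<forall>i<2. (if i = 0 then p0 else p1) \<cdot> h = x i"
      using h(4,5) by (simp add: less_2_cases_iff)
    ultimately show "\<exists>h. h \<in> Ar C \<and> Dom C h = Dom C s \<and> Cod C h = Dom C (q \<cdot> p0) \<and> q \<cdot> p0 \<cdot> h = s \<and>
        (\<forall>i<2. (if i = 0 then p0 else p1) \<cdot> h = x i)"
      using h(1-3) x0(2) p(1-6) by (intro exI[of _ h]) simp
  }
  fix h h' assume h: "h \<in> Ar C" "h' \<in> Ar C" "Dom C h = Dom C h'" "Cod C h = Dom C (q \<cdot> p0)"
    "Cod C h' = Dom C (q \<cdot> p0)"
    "\<And>i::nat. i < 2 \<Longrightarrow> (if i = 0 then p0 else p1) \<cdot> h = (if i = 0 then p0 else p1) \<cdot> h'"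
  show "h = h'"
    using h(6)[of 0] h(6)[of 1] h(1-5) p by - (rule pullback_unique[OF P], simp_all)
qed (use pullbackD[OF P] in simp_all)

lemma pullback_of_power_2:
  assumes P: "is_pullback_power C q 2 r \<pi>"
  shows "is_pullback C (\<pi> 0) (\<pi> 1) q q"
proof (rule pullbackI)
  note p = powerD[OF P] note p01 = p(4-7)[of 0, simplified] p(4-7)[of 1, simplified]
  {
    fix x y assume xy: "x \<in> Ar C" "y \<in> Ar C" "Dom C x = Dom C y" "Cod C x = Dom C q"
      "Cod C y = Dom C q" "q \<cdot> x = q \<cdot> y"
    have "\<exists>!h. h \<in> Hom C (Dom C (q \<cdot> x)) (Dom C r) \<and> r \<cdot> h = q \<cdot> x \<and>
        (\<forall>i<2. \<pi> i \<cdot> h = (if i = 0 then x else y))"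
      using xy p by (intro power_universal[OF P]) simp_all
    then obtain h where h: "h \<in> Ar C" "Dom C h = Dom C (q \<cdot> x)" "Cod C h = Dom C r"
      "\<And>i::nat. i < 2 \<Longrightarrow> \<pi> i \<cdot> h = (if i = 0 then x else y)"
      by auto
    then show "\<exists>h. h \<in> Ar C \<and> Dom C h = Dom C x \<and> Cod C h = Dom C (\<pi> 0) \<and> \<pi> 0 \<cdot> h = x \<and> \<pi> 1 \<cdot> h = y"
      using h(4)[of 0] h(4)[of 1] p p01 xy by (intro exI[of _ h]) simp
  }
  fix h h' assume h: "h \<in> Ar C" "h' \<in> Ar C" "Dom C h = Dom C h'" "Cod C h = Dom C (\<pi> 0)"
    "Cod C h' = Dom C (\<pi> 0)" "\<pi> 0 \<cdot> h = \<pi> 0 \<cdot> h'" "\<pi> 1 \<cdot> h = \<pi> 1 \<cdot> h'"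
  have "r \<cdot> k = q \<cdot> (\<pi> 0 \<cdot> k)" if "k \<in> Ar C" "Cod C k = Dom C r" for k
    using comp_assoc_ar[of k "\<pi> 0" q] that p p01 by simp
  then show "h = h'" using h p p01
    by - (rule power_unique[OF P], auto simp: less_2_cases_iff)
qed (use powerD[OF P] powerD(4-7)[OF P, of 0] powerD(4-7)[OF P, of 1] in simp_all)

end

context is_functor
begin

lemma arr_map_ar [simp]:
  assumes "f \<in> Ar C"
  shows "arr_map F f \<in> Ar D" "Dom D (arr_map F f) = obj_map F (Dom C f)"
    "Cod D (arr_map F f) = obj_map F (Cod C f)"
  using arr_map_hom[of f "Dom C f" "Cod C f"] assms by simp_all

lemma arr_map_comp_ar [simp]:
  "f \<in> Ar C \<Longrightarrow> g \<in> Ar C \<Longrightarrow> Cod C f = Dom C g \<Longrightarrow>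
    arr_map F (g \<cdot>\<^bsub>C\<^esub> f) = arr_map F g \<cdot>\<^bsub>D\<^esub> arr_map F f"
  using arr_map_comp by simp

declare obj_map_ob [simp] arr_map_id [simp]

lemma arr_map_iso: "is_iso C f \<Longrightarrow> is_iso D (arr_map F f)"
proof -
  assume "is_iso C f"
  then obtain g where i: "is_inverse C f g" by (auto simp: is_iso_def)
  note g = dom.inverseD[OF i]
  have "arr_map F g \<cdot>\<^bsub>D\<^esub> arr_map F f = arr_map F (g \<cdot>\<^bsub>C\<^esub> f)"
    "arr_map F f \<cdot>\<^bsub>D\<^esub> arr_map F g = arr_map F (f \<cdot>\<^bsub>C\<^esub> g)" using g(1-4) by simp_all
  then have "is_inverse D (arr_map F f) (arr_map F g)"
    unfolding is_inverse_def using g by simp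
  then show ?thesis by (auto simp: is_iso_def)
qed

definition preserves_pullbacks_over :: "'o \<Rightarrow> bool" where
  "preserves_pullbacks_over z \<longleftrightarrow>
    (\<forall>t l r b. is_pullback C t l r b \<and> Cod C r = z \<longrightarrow>
      is_pullback D (arr_map F t) (arr_map F l) (arr_map F r) (arr_map F b))"

lemma preserves_powers:
  assumes pres: "preserves_pullbacks_over (Cod C q)"
    and ex: "\<And>n. \<exists>r \<pi>. is_pullback_power C q n r \<pi>"
    and P: "is_pullback_power C q n r \<pi>"
  shows "is_pullback_power D (arr_map F q) n (arr_map F r) (\<lambda>i. arr_map F (\<pi> i))"
  using P
proof (induction n arbitrary: r \<pi>)
  case 0
  then have r: "q \<in> Ar C" "is_iso C r" "Cod C r = Cod C q" by (simp_all add: dom.power_0_iff)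
  then have "r \<in> Ar C" by (auto simp: is_iso_def is_inverse_def)
  then show ?case using r arr_map_iso[OF r(2)] by (simp add: cod.power_0_iff)
next
  case (Suc n)
  note s = dom.powerD[OF Suc.prems]
  obtain r' \<pi>' where N: "is_pullback_power C q n r' \<pi>'" using ex by blast
  note m = dom.powerD[OF N]
  obtain t where t: "t \<in> Ar C" "Dom C t = Dom C r" "Cod C t = Dom C r'" "r' \<cdot>\<^bsub>C\<^esub> t = r"
    "\<And>i. i < n \<Longrightarrow> \<pi>' i \<cdot>\<^bsub>C\<^esub> t = \<pi> i"
    using dom.power_lift[OF N, of r \<pi>] s by (metis less_SucI)
  have "is_pullback C t (\<pi> n) r' q" by (rule dom.power_SucD[OF Suc.prems N t])
  then have "is_pullback D (arr_map F t) (arr_map F (\<pi> n)) (arr_map F r') (arr_map F q)"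
    using pres m(3) unfolding preserves_pullbacks_over_def by blast
  from cod.power_SucI[OF this Suc.IH[OF N]]
  have "is_pullback_power D (arr_map F q) (Suc n) (arr_map F r)
     (\<lambda>i. if i < n then arr_map F (\<pi>' i) \<cdot>\<^bsub>D\<^esub> arr_map F t else arr_map F (\<pi> n))"
    using arr_map_comp_ar[of t r'] t m by simp
  then show ?case
  proof (rule cod.power_cong)
    fix i assume "i < Suc n"
    then show "arr_map F (\<pi> i) = (if i < n then arr_map F (\<pi>' i) \<cdot>\<^bsub>D\<^esub> arr_map F t else arr_map F (\<pi> n))"
      using t(1,3) m by (auto simp: less_Suc_eq t(5)[symmetric])
  qed
qed

end

section \<open>Substitution in polynomials over the natural numbers\<close>

lemma npoly_induct [case_names single add]:
  fixes P :: npoly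
  assumes s: "\<And>m c. Q (Poly_Mapping.single m c)" and a: "\<And>P P'. Q P \<Longrightarrow> Q P' \<Longrightarrow> Q (P + P')"
  shows "Q P"
proof (induction P rule: Poly_Mapping.update_induct)
  case const
  have "Q (Poly_Mapping.single 0 0)" by (rule s)
  then show ?case by simp
next
  case (update f a b)
  have "Poly_Mapping.update a b f = Poly_Mapping.single a b + f"
    using update(1) by (intro poly_mapping_eqI) (auto simp: lookup_update lookup_add lookup_single in_keys_iff when_def)
  then show ?case using a[OF s update(3)] by simp
qed

text \<open>
Multiplicativity of \<open>npoly_subst\<close> is proved on monomials and extended by additivity.
\<close>

definition monom_subst :: "(nat \<Rightarrow> npoly) \<Rightarrow> (nat \<Rightarrow>\<^sub>0 nat) \<Rightarrow> npoly" where
  "monom_subst s m = (\<Prod>i\<in>Poly_Mapping.keys m. s i ^ Poly_Mapping.lookup m i)"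

lemma monom_subst_superset:
  assumes "finite S" "Poly_Mapping.keys m \<subseteq> S"
  shows "monom_subst s m = (\<Prod>i\<in>S. s i ^ Poly_Mapping.lookup m i)"
  unfolding monom_subst_def using assms
  by (intro prod.mono_neutral_left) (auto simp: in_keys_iff)

lemma monom_subst_add: "monom_subst s (m + m') = monom_subst s m * monom_subst s m'"
proof -
  let ?S = "Poly_Mapping.keys m \<union> Poly_Mapping.keys m'"
  have "monom_subst s (m + m') = (\<Prod>i\<in>?S. s i ^ Poly_Mapping.lookup (m + m') i)"
    by (rule monom_subst_superset) (auto simp: keys_add)
  also have "\<dots> = (\<Prod>i\<in>?S. s i ^ Poly_Mapping.lookup m i) * (\<Prod>i\<in>?S. s i ^ Poly_Mapping.lookup m' i)"
    by (simp add: lookup_add power_add prod.distrib)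
  finally show ?thesis by (simp add: monom_subst_superset[of ?S])
qed

lemma monom_subst_zero [simp]: "monom_subst s 0 = 1"
  by (simp add: monom_subst_def)

lemma npoly_subst_superset:
  assumes "finite S" "Poly_Mapping.keys P \<subseteq> S"
  shows "npoly_subst s P = (\<Sum>m\<in>S. of_nat (Poly_Mapping.lookup P m) * monom_subst s m)"
  unfolding npoly_subst_def monom_subst_def using assms
  by (intro sum.mono_neutral_left) (auto simp: in_keys_iff)

lemma npoly_subst_add: "npoly_subst s (P + Q) = npoly_subst s P + npoly_subst s Q"
proof -
  let ?S = "Poly_Mapping.keys P \<union> Poly_Mapping.keys Q"
  have "npoly_subst s (P + Q) = (\<Sum>m\<in>?S. of_nat (Poly_Mapping.lookup (P + Q) m) * monom_subst s m)"
    by (rule npoly_subst_superset) (auto dest: subsetD[OF Poly_Mapping.keys_add])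
  then show ?thesis
    by (simp add: npoly_subst_superset[of ?S] lookup_add sum.distrib distrib_right)
qed

lemma npoly_subst_single: "npoly_subst s (Poly_Mapping.single m c) = of_nat c * monom_subst s m"
  by (subst npoly_subst_superset[of "{m}"]) (auto simp: when_def)

lemma npoly_subst_0 [simp]: "npoly_subst s 0 = 0"
  by (simp add: npoly_subst_def)

lemma npoly_subst_1 [simp]: "npoly_subst s 1 = 1"
  using npoly_subst_single[of s 0 1] by (simp del: One_nat_def)

lemma npoly_subst_mult: "npoly_subst s (P * Q) = npoly_subst s P * npoly_subst s Q"
proof (induction P rule: npoly_induct)
  case (single m c)
  show ?case
    by (induction Q rule: npoly_induct)
      (simp_all add: mult_single npoly_subst_single npoly_subst_add monom_subst_add algebra_simps)
qed (simp add: npoly_subst_add distrib_right)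

lemma npoly_subst_var [simp]: "npoly_subst s (var i) = s i"
  by (simp add: var_def npoly_subst_single monom_subst_def)

lemma npolys_0 [simp]: "0 \<in> npolys n" and npolys_1 [simp]: "1 \<in> npolys n"
  and npolys_var [simp]: "i < n \<Longrightarrow> var i \<in> npolys n"
  by (auto simp: npolys_def var_def)

lemma npolys_add [simp]: "P \<in> npolys n \<Longrightarrow> Q \<in> npolys n \<Longrightarrow> P + Q \<in> npolys n"
  unfolding npolys_def using Poly_Mapping.keys_add[of P Q] by blast

lemma npolys_mult [simp]: "P \<in> npolys n \<Longrightarrow> Q \<in> npolys n \<Longrightarrow> P * Q \<in> npolys n"
  unfolding npolys_def using keys_mult[of P Q] Poly_Mapping.keys_add
  by (smt (verit, ccfv_threshold) Un_least mem_Collect_eq subset_iff)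

lemma npolys_of_nat [simp]: "of_nat k \<in> npolys n"
  by (induction k) auto

lemma npolys_prod: "(\<And>i. i \<in> S \<Longrightarrow> f i \<in> npolys n) \<Longrightarrow> prod f S \<in> npolys n"
  by (induction S rule: infinite_finite_induct) auto

lemma npolys_power: "P \<in> npolys n \<Longrightarrow> P ^ k \<in> npolys n"
  by (induction k) auto

lemma npoly_subst_npolys:
  assumes "P \<in> npolys n" and "\<And>i. i < n \<Longrightarrow> s i \<in> npolys k"
  shows "npoly_subst s P \<in> npolys k"
proof -
  have "of_nat (Poly_Mapping.lookup P m) * monom_subst s m \<in> npolys k" if "m \<in> Poly_Mapping.keys P" for m
  proof (rule npolys_mult)
    have "Poly_Mapping.keys m \<subseteq> {..<n}" using assms(1) that by (auto simp: npolys_def)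
    then show "monom_subst s m \<in> npolys k"
      unfolding monom_subst_def by (intro npolys_prod npolys_power assms(2)) auto
  qed simp
  then have "(\<Sum>m\<in>S. of_nat (Poly_Mapping.lookup P m) * monom_subst s m) \<in> npolys k"
    if "S \<subseteq> Poly_Mapping.keys P" for S
    using that by (induction S rule: infinite_finite_induct) auto
  from this[OF order.refl] show ?thesis by (simp add: npoly_subst_def monom_subst_def)
qed

lemma npoly_subst_var_id: "npoly_subst var P = P"
proof -
  have *: "var i ^ k = Poly_Mapping.single (Poly_Mapping.single i k) 1" for i k
    by (induction k) (simp_all add: var_def mult_single single_add[symmetric] plus_1_eq_Suc del: One_nat_def)
  have "monom_subst var m = Poly_Mapping.single m 1" for m
  proof (induction m rule: Poly_Mapping.update_induct)
    case const
    then show ?case by (simp del: One_nat_def)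
  next
    case (update f a b)
    have "Poly_Mapping.update a b f = Poly_Mapping.single a b + f"
      using update(1) by (intro poly_mapping_eqI) (auto simp: lookup_update lookup_add lookup_single in_keys_iff when_def)
    then show ?case using update
      by (simp add: monom_subst_add mult_single monom_subst_superset[of "{a}"] *)
  qed
  then show ?thesis
    by (induction P rule: npoly_induct) (simp_all add: npoly_subst_single npoly_subst_add of_nat_single mult_single)
qed

text \<open>
Polynomials are generated from the variables by the semiring operations, because substituting the
variables for themselves changes nothing. Properties of morphisms out of a Weil algebra are proved
along this induction.
\<close>

lemma npolys_induct [consumes 1, case_names zero one var add mult]:
  assumes "P \<in> npolys n" and "Q 0" "Q 1" "\<And>i. i < n \<Longrightarrow> Q (var i)"
    and add: "\<And>P P'. P \<in> npolys n \<Longrightarrow> P' \<in> npolys n \<Longrightarrow> Q P \<Longrightarrow> Q P' \<Longrightarrow> Q (P + P')"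
    and mult: "\<And>P P'. P \<in> npolys n \<Longrightarrow> P' \<in> npolys n \<Longrightarrow> Q P \<Longrightarrow> Q P' \<Longrightarrow> Q (P * P')"
  shows "Q P"
proof -
  define R where "R P \<longleftrightarrow> P \<in> npolys n \<and> Q P" for P
  have R: "R 0" "R 1" "\<And>i. i < n \<Longrightarrow> R (var i)" "\<And>P P'. R P \<Longrightarrow> R P' \<Longrightarrow> R (P + P')"
      "\<And>P P'. R P \<Longrightarrow> R P' \<Longrightarrow> R (P * P')"
    using assms by (auto simp: R_def)
  have Rn: "R (of_nat k)" for k by (induction k) (auto intro: R)
  have Rp: "R P \<Longrightarrow> R (P ^ k)" for P k by (induction k) (auto intro: R)
  have Rm: "R (monom_subst var m)" if "Poly_Mapping.keys m \<subseteq> {..<n}" for m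
  proof -
    have "(\<And>i. i \<in> S \<Longrightarrow> i < n) \<Longrightarrow> R (\<Prod>i\<in>S. var i ^ Poly_Mapping.lookup m i)" for S
      by (induction S rule: infinite_finite_induct) (auto intro!: R Rp)
    then show ?thesis using that by (auto simp: monom_subst_def)
  qed
  have "R (\<Sum>m\<in>S. of_nat (Poly_Mapping.lookup P m) * monom_subst var m)"
    if "S \<subseteq> Poly_Mapping.keys P" for S
    using that
  proof (induction S rule: infinite_finite_induct)
    case (insert x F)
    then show ?case using \<open>P \<in> npolys n\<close> by (auto intro!: R Rn Rm simp: npolys_def)
  qed (auto intro: R)
  from this[OF order.refl] have "R (npoly_subst var P)"
    by (simp add: npoly_subst_def monom_subst_def)
  then show ?thesis by (simp add: npoly_subst_var_id R_def)
qed

section \<open>Morphisms of Weil algebras\<close>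

lemma weil_cong_npolys: "(P, Q) \<in> weil_cong A \<Longrightarrow> P \<in> npolys (fst A) \<and> Q \<in> npolys (fst A)"
  by (induction rule: weil_cong.induct) auto

lemma equiv_weil_cong: "equiv (npolys (fst A)) (weil_cong A)"
proof (rule equivI)
  show "weil_cong A \<subseteq> npolys (fst A) \<times> npolys (fst A)" by (auto dest: weil_cong_npolys)
  show "refl_on (npolys (fst A)) (weil_cong A)" by (blast intro: refl_onI weil_cong.refl)
  show "sym (weil_cong A)" by (rule symI) (rule weil_cong.sym)
  show "trans (weil_cong A)" by (rule transI) (rule weil_cong.trans)
qed

definition weil_class :: "weil_ob \<Rightarrow> npoly \<Rightarrow> npoly set" where
  "weil_class A P = weil_cong A `` {P}"

lemma weil_class_eq_iff:
  "P \<in> npolys (fst A) \<Longrightarrow> Q \<in> npolys (fst A) \<Longrightarrow>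
    weil_class A P = weil_class A Q \<longleftrightarrow> (P, Q) \<in> weil_cong A"
  unfolding weil_class_def by (simp add: eq_equiv_class_iff[OF equiv_weil_cong])

lemma weil_class_carrier [simp]:
  "P \<in> npolys (fst A) \<Longrightarrow> weil_class A P \<in> carrier (weil_alg A)"
  by (simp add: weil_class_def weil_alg_def quotientI)

lemma weil_carrierE:
  assumes "S \<in> carrier (weil_alg A)"
  obtains P where "P \<in> npolys (fst A)" "S = weil_class A P"
  using assms by (auto simp: weil_class_def weil_alg_def elim!: quotientE)

lemma weil_class_self: "P \<in> npolys (fst A) \<Longrightarrow> P \<in> weil_class A P"
  by (simp add: weil_class_def weil_cong.refl)

lemma weil_class_UN:
  assumes "P \<in> npolys (fst A)" and "\<And>Q. (P, Q) \<in> weil_cong A \<Longrightarrow> f Q = f P"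
  shows "(\<Union>Q\<in>weil_class A P. f Q) = f P"
proof -
  have "(\<Union>Q\<in>weil_class A P. f Q) = (\<Union>Q\<in>weil_class A P. f P)"
    using assms(2) by (intro SUP_cong) (auto simp: weil_class_def)
  then show ?thesis using weil_class_self[OF assms(1)] by auto
qed

lemma weil_class_add [simp]:
  assumes "P \<in> npolys (fst A)" "Q \<in> npolys (fst A)"
  shows "add (weil_alg A) (weil_class A P) (weil_class A Q) = weil_class A (P + Q)"
proof -
  have *: "weil_class A (P' + Q') = weil_class A (P + Q)"
    if "(P, P') \<in> weil_cong A" "(Q, Q') \<in> weil_cong A" for P' Q'
    using that weil_cong_npolys[OF that(1)] weil_cong_npolys[OF that(2)] assms
    by (subst weil_class_eq_iff) (auto intro: weil_cong.add weil_cong.sym)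
  have "add (weil_alg A) (weil_class A P) (weil_class A Q) =
      (\<Union>P'\<in>weil_class A P. \<Union>Q'\<in>weil_class A Q. weil_class A (P' + Q'))"
    by (simp add: weil_alg_def weil_class_def)
  also have "\<dots> = (\<Union>P'\<in>weil_class A P. \<Union>Q'\<in>weil_class A Q. weil_class A (P + Q))"
    using * by (intro SUP_cong) (auto simp: weil_class_def)
  finally show ?thesis using weil_class_self[OF assms(1)] weil_class_self[OF assms(2)] by auto
qed

lemma weil_class_mult [simp]:
  assumes "P \<in> npolys (fst A)" "Q \<in> npolys (fst A)"
  shows "mult (weil_alg A) (weil_class A P) (weil_class A Q) = weil_class A (P * Q)"
proof -
  have *: "weil_class A (P' * Q') = weil_class A (P * Q)"
    if "(P, P') \<in> weil_cong A" "(Q, Q') \<in> weil_cong A" for P' Q'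
    using that weil_cong_npolys[OF that(1)] weil_cong_npolys[OF that(2)] assms
    by (subst weil_class_eq_iff) (auto intro: weil_cong.mult weil_cong.sym)
  have "mult (weil_alg A) (weil_class A P) (weil_class A Q) =
      (\<Union>P'\<in>weil_class A P. \<Union>Q'\<in>weil_class A Q. weil_class A (P' * Q'))"
    by (simp add: weil_alg_def weil_class_def)
  also have "\<dots> = (\<Union>P'\<in>weil_class A P. \<Union>Q'\<in>weil_class A Q. weil_class A (P * Q))"
    using * by (intro SUP_cong) (auto simp: weil_class_def)
  finally show ?thesis using weil_class_self[OF assms(1)] weil_class_self[OF assms(2)] by auto
qed

lemma weil_class_zero: "zero (weil_alg A) = weil_class A 0"
  and weil_class_one: "one (weil_alg A) = weil_class A 1"
  by (simp_all add: weil_alg_def weil_class_def)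

text \<open>
Morphisms are best described by their values on classes of polynomials: there the operations of the
quotient are those of polynomials.
\<close>

lemma weil_hom_iff:
  "h \<in> weil_hom A B \<longleftrightarrow>
    h \<in> extensional (carrier (weil_alg A)) \<and>
    (\<forall>P\<in>npolys (fst A). h (weil_class A P) \<in> carrier (weil_alg B)) \<and>
    (\<forall>P\<in>npolys (fst A). \<forall>Q\<in>npolys (fst A).
      h (weil_class A (P * Q)) = mult (weil_alg B) (h (weil_class A P)) (h (weil_class A Q)) \<and>
      h (weil_class A (P + Q)) = add (weil_alg B) (h (weil_class A P)) (h (weil_class A Q))) \<and>
    h (weil_class A 0) = weil_class B 0 \<and> h (weil_class A 1) = weil_class B 1"
    (is "_ \<longleftrightarrow> ?R")
proof
  assume "h \<in> weil_hom A B"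
  then have h: "h \<in> ring_hom (weil_alg A) (weil_alg B)" "h \<in> extensional (carrier (weil_alg A))"
    "h (weil_class A 0) = weil_class B 0"
    by (auto simp: weil_hom_def weil_class_zero)
  have mul: "h (weil_class A (P * Q)) = mult (weil_alg B) (h (weil_class A P)) (h (weil_class A Q))"
    if "P \<in> npolys (fst A)" "Q \<in> npolys (fst A)" for P Q
    using ring_hom_mult[OF h(1), of "weil_class A P" "weil_class A Q"] that by simp
  have add: "h (weil_class A (P + Q)) = add (weil_alg B) (h (weil_class A P)) (h (weil_class A Q))"
    if "P \<in> npolys (fst A)" "Q \<in> npolys (fst A)" for P Q
    using ring_hom_add[OF h(1), of "weil_class A P" "weil_class A Q"] that by simp
  have "h (weil_class A 1) = weil_class B 1"
    using ring_hom_one[OF h(1)] by (simp add: weil_class_one)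
  with mul add h(2,3) ring_hom_closed[OF h(1)] show ?R by (simp (no_asm_simp))
next
  assume R: ?R
  have "h \<in> ring_hom (weil_alg A) (weil_alg B)"
    using R by (intro ring_hom_memI) (auto elim!: weil_carrierE simp: weil_class_one)
  then show "h \<in> weil_hom A B" using R by (auto simp: weil_hom_def weil_class_zero)
qed

lemma Hom_Weil:
  "Hom Weil A B = {(A', B', h). A' = A \<and> B' = B \<and> A \<in> Ob Weil \<and> B \<in> Ob Weil \<and> h \<in> weil_hom A B}"
  by (auto simp: Hom_def Weil_def)

text \<open>
The condition under which a substitution induces a morphism of Weil algebras. It suffices to test it on the
generating relations.
\<close>

definition weil_assignment :: "weil_ob \<Rightarrow> weil_ob \<Rightarrow> (nat \<Rightarrow> npoly) \<Rightarrow> bool" where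
  "weil_assignment A B s \<longleftrightarrow>
    (\<forall>i<fst A. s i \<in> npolys (fst B)) \<and>
    (\<forall>i<fst A. \<forall>j<fst A. (i, j) \<in> snd A \<longrightarrow> (s i * s j, 0) \<in> weil_cong B)"

lemma weil_assignment_cong:
  assumes "weil_assignment A B s" and "(P, Q) \<in> weil_cong A"
  shows "(npoly_subst s P, npoly_subst s Q) \<in> weil_cong B"
  using assms(2)
proof induction
  case (gen i j)
  then show ?case using assms(1) by (auto simp: weil_assignment_def npoly_subst_mult)
next
  case (refl P)
  then show ?case using assms(1)
    by (intro weil_cong.refl npoly_subst_npolys[OF refl]) (simp add: weil_assignment_def)
next
  case (sym P Q)
  then show ?case by (blast intro: weil_cong.sym)
next
  case (trans P Q S)
  then show ?case by (blast intro: weil_cong.trans)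
qed (simp_all add: npoly_subst_mult npoly_subst_add weil_cong.add weil_cong.mult)

lemma weil_map_class:
  assumes "weil_assignment A B s" and P: "P \<in> npolys (fst A)"
  shows "snd (snd (weil_map A B s)) (weil_class A P) = weil_class B (npoly_subst s P)"
proof -
  have "weil_class B (npoly_subst s Q) = weil_class B (npoly_subst s P)" if "(P, Q) \<in> weil_cong A" for Q
    using weil_assignment_cong[OF assms(1) that]
    by (subst weil_class_eq_iff) (auto dest: weil_cong_npolys intro: weil_cong.sym)
  then show ?thesis using P
    by (simp add: weil_map_def weil_class_UN flip: weil_class_def)
qed

lemma weil_map_hom:
  assumes s: "weil_assignment A B s" and "A \<in> Ob Weil" "B \<in> Ob Weil"
  shows "weil_map A B s \<in> Hom Weil A B"
proof -
  have "npoly_subst s P \<in> npolys (fst B)" if "P \<in> npolys (fst A)" for P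
    using s by (intro npoly_subst_npolys[OF that]) (simp add: weil_assignment_def)
  note cl = this
  have "snd (snd (weil_map A B s)) \<in> weil_hom A B"
    unfolding weil_hom_iff
  proof (intro conjI ballI)
    show "snd (snd (weil_map A B s)) \<in> extensional (carrier (weil_alg A))"
      by (simp add: weil_map_def)
  qed (simp_all add: weil_map_class[OF s] npoly_subst_add npoly_subst_mult cl)
  then show ?thesis using assms by (simp add: Hom_Weil weil_map_def)
qed

text \<open>
Weil algebras are generated by their variables.
\<close>

lemma weil_hom_determined:
  assumes "f \<in> weil_hom A B" "g \<in> weil_hom A B"
    and "\<And>i. i < fst A \<Longrightarrow> f (weil_class A (var i)) = g (weil_class A (var i))"
  shows "f = g"
proof (rule extensionalityI[of _ "carrier (weil_alg A)"])
  fix S assume "S \<in> carrier (weil_alg A)"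
  then obtain P where P: "P \<in> npolys (fst A)" "S = weil_class A P" by (rule weil_carrierE)
  have "f (weil_class A P) = g (weil_class A P)" using P(1)
    by (induction P rule: npolys_induct) (use assms in \<open>auto simp: weil_hom_iff\<close>)
  then show "f S = g S" using P by simp
qed (use assms in \<open>auto simp: weil_hom_iff\<close>)

lemma weil_hom_compose:
  assumes "f \<in> weil_hom A B" "g \<in> weil_hom B D"
  shows "compose (carrier (weil_alg A)) g f \<in> weil_hom A D"
proof -
  have f: "f \<in> ring_hom (weil_alg A) (weil_alg B)" "f (weil_class A 0) = weil_class B 0"
    and g: "g \<in> ring_hom (weil_alg B) (weil_alg D)" "g (weil_class B 0) = weil_class D 0"
    using assms by (auto simp: weil_hom_def weil_class_zero)
  have gf: "g \<circ> f \<in> ring_hom (weil_alg A) (weil_alg D)"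
    by (rule ring_hom_trans[OF f(1) g(1)])
  have [simp]: "compose (carrier (weil_alg A)) g f (weil_class A P) = (g \<circ> f) (weil_class A P)"
    if "P \<in> npolys (fst A)" for P using that by (simp add: compose_eq)
  have "compose (carrier (weil_alg A)) g f \<in> ring_hom (weil_alg A) (weil_alg D)"
  proof (rule ring_hom_memI)
    fix u assume "u \<in> carrier (weil_alg A)"
    then show "compose (carrier (weil_alg A)) g f u \<in> carrier (weil_alg D)"
      using ring_hom_closed[OF gf] by (simp add: compose_eq)
  next
    fix u v assume "u \<in> carrier (weil_alg A)" "v \<in> carrier (weil_alg A)"
    then obtain P Q where PQ: "P \<in> npolys (fst A)" "Q \<in> npolys (fst A)"
        "u = weil_class A P" "v = weil_class A Q"
      by (elim weil_carrierE)
    show "compose (carrier (weil_alg A)) g f (mult (weil_alg A) u v) =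
        mult (weil_alg D) (compose (carrier (weil_alg A)) g f u) (compose (carrier (weil_alg A)) g f v)"
      "compose (carrier (weil_alg A)) g f (add (weil_alg A) u v) =
        add (weil_alg D) (compose (carrier (weil_alg A)) g f u) (compose (carrier (weil_alg A)) g f v)"
      using PQ ring_hom_mult[OF gf, of u v] ring_hom_add[OF gf, of u v] by simp_all
  next
    show "compose (carrier (weil_alg A)) g f (one (weil_alg A)) = one (weil_alg D)"
      using ring_hom_one[OF gf] by (simp add: weil_class_one)
  qed
  then show ?thesis using f(2) g(2) by (simp add: weil_hom_def weil_class_zero)
qed

lemma weil_map_var: "A \<in> Ob Weil \<Longrightarrow> weil_map A A var = Id Weil A"
proof -
  have "weil_assignment A A var" by (auto simp: weil_assignment_def intro: weil_cong.gen)
  then have "snd (snd (weil_map A A var)) S = S" if "S \<in> carrier (weil_alg A)" for S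
    using that by (auto elim!: weil_carrierE simp: weil_map_class npoly_subst_var_id)
  then show ?thesis
    by (auto simp: weil_map_def Weil_def fun_eq_iff)
qed

lemma Weil_comp: "(B', D, g) \<cdot>\<^bsub>Weil\<^esub> (A, B, f) = (A, D, compose (carrier (weil_alg A)) g f)"
  by (simp add: Weil_def)

lemma Weil_Id: "Id Weil A = (A, A, restrict id (carrier (weil_alg A)))"
  by (simp add: Weil_def)

lemma Weil_Id_hom: "A \<in> Ob Weil \<Longrightarrow> Id Weil A \<in> Hom Weil A A"
  unfolding weil_map_var[symmetric]
  by (rule weil_map_hom) (auto simp: weil_assignment_def intro: weil_cong.gen)

lemma Weil_Id_comp:
  assumes "\<theta> \<in> Hom Weil A B"
  shows "\<theta> \<cdot>\<^bsub>Weil\<^esub> Id Weil A = \<theta>" "Id Weil B \<cdot>\<^bsub>Weil\<^esub> \<theta> = \<theta>"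
proof -
  obtain h where h: "\<theta> = (A, B, h)" "h \<in> weil_hom A B" using assms by (auto simp: Hom_Weil)
  have hc: "h \<in> carrier (weil_alg A) \<rightarrow> carrier (weil_alg B)" "h \<in> extensional (carrier (weil_alg A))"
    using h by (auto simp: weil_hom_def ring_hom_def)
  show "\<theta> \<cdot>\<^bsub>Weil\<^esub> Id Weil A = \<theta>" "Id Weil B \<cdot>\<^bsub>Weil\<^esub> \<theta> = \<theta>"
    using compose_Id[OF hc] Id_compose[OF hc] by (simp_all add: h Weil_comp Weil_Id id_def)
qed

lemma fst_weil [simp]: "fst (weil_Wn n) = n" "fst weil_N = 0" "fst (A \<otimes>w B) = fst A + fst B"
  by (simp_all add: weil_Wn_def weil_N_def weil_tensor_def)

lemma weil_N_ob [simp]: "weil_N \<in> Ob Weil"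
  by (simp add: weil_N_def Weil_def equiv_def refl_on_def sym_def trans_def)

lemma weil_Wn_ob [simp]: "weil_Wn n \<in> Ob Weil"
  by (auto simp: weil_Wn_def Weil_def equiv_def refl_on_def sym_def trans_def)

lemma weil_tensor_ob [simp]:
  assumes "A \<in> Ob Weil" "B \<in> Ob Weil"
  shows "A \<otimes>w B \<in> Ob Weil"
proof -
  obtain n R m S where AB: "A = (n, R)" "B = (m, S)" by fastforce
  have R: "equiv {..<n} R" and S: "equiv {..<m} S" using assms by (auto simp: AB Weil_def)
  let ?Q = "R \<union> (\<lambda>(i, j). (n + i, n + j)) ` S"
  have sub: "R \<subseteq> {..<n} \<times> {..<n}" "S \<subseteq> {..<m} \<times> {..<m}"
    using R S by (auto simp: equiv_def)
  have "equiv {..<n + m} ?Q"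
  proof (rule equivI)
    show "?Q \<subseteq> {..<n + m} \<times> {..<n + m}" using sub by auto
    show "refl_on {..<n + m} ?Q"
    proof (rule refl_onI)
      fix i assume i: "i \<in> {..<n + m}"
      show "(i, i) \<in> ?Q"
      proof (cases "i < n")
        case True
        then show ?thesis using R by (auto simp: equiv_def refl_on_def)
      next
        case False
        then have "(i - n, i - n) \<in> S" using S i by (auto simp: equiv_def refl_on_def)
        then show ?thesis using False by (force simp: image_iff)
      qed
    qed
    have "sym R" "sym S" using R S by (auto simp: equiv_def)
    then show "sym ?Q" by (auto simp: sym_def)
    show "trans ?Q"
    proof (rule transI)
      fix x y z assume xyz: "(x, y) \<in> ?Q" "(y, z) \<in> ?Q"
      show "(x, z) \<in> ?Q"
      proof (cases "y < n")
        case True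
        then have "(x, y) \<in> R" "(y, z) \<in> R" using xyz by auto
        then show ?thesis using R by (auto simp: equiv_def dest: transD)
      next
        case False
        then obtain i j k l where "(i, j) \<in> S" "(k, l) \<in> S" "x = n + i" "y = n + j" "y = n + k" "z = n + l"
          using xyz sub by auto
        then have "(i, l) \<in> S" "x = n + i" "z = n + l"
          using S by (auto simp: equiv_def dest: transD)
        then show ?thesis by force
      qed
    qed
  qed
  then show ?thesis by (simp add: AB weil_tensor_def Weil_def)
qed

lemma weil_W_tensor_ob [simp]: "weil_W_tensor n \<in> Ob Weil"
  by (induction n) auto

lemma weil_aug_hom: "A \<in> Ob Weil \<Longrightarrow> weil_aug A \<in> Hom Weil A weil_N"
  unfolding weil_aug_def
  by (rule weil_map_hom) (simp_all add: weil_assignment_def weil_cong.refl)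

lemma weil_p_eq_aug: "weil_p = weil_aug weil_W"
  by (simp add: weil_p_def weil_aug_def)

lemma weil_p_hom: "weil_p \<in> Hom Weil weil_W weil_N"
  unfolding weil_p_eq_aug by (rule weil_aug_hom) (rule weil_Wn_ob)

lemma weil_zero_hom: "weil_zero \<in> Hom Weil weil_N weil_W"
  unfolding weil_zero_def by (rule weil_map_hom) (simp_all add: weil_assignment_def)

lemma weil_Wn_gen: "i < n \<Longrightarrow> j < n \<Longrightarrow> (var i * var j, 0) \<in> weil_cong (weil_Wn n)"
  by (rule weil_cong.gen) (auto simp: weil_Wn_def)

lemma weil_plus_hom: "weil_plus \<in> Hom Weil (weil_Wn 2) weil_W"
  unfolding weil_plus_def using weil_Wn_gen[of 0 1 0]
  by (intro weil_map_hom) (simp_all add: weil_assignment_def)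

lemma weil_pr_assignment:
  "weil_assignment (weil_Wn 2) weil_W (\<lambda>i. if i = k then var 0 else 0)"
  using weil_Wn_gen[of 0 1 0] by (simp add: weil_assignment_def weil_cong.refl)

lemma weil_pr_hom: "weil_pr k \<in> Hom Weil (weil_Wn 2) weil_W"
  unfolding weil_pr_def by (rule weil_map_hom[OF weil_pr_assignment]) simp_all

lemma weil_ell_hom: "weil_ell \<in> Hom Weil weil_W (weil_W \<otimes>w weil_W)"
proof -
  let ?B = "weil_W \<otimes>w weil_W"
  have "(var 0 * var 0, 0) \<in> weil_cong ?B"
    by (rule weil_cong.gen) (auto simp: weil_tensor_def weil_Wn_def)
  moreover have "(var 1 * var 1, var 1 * var 1) \<in> weil_cong ?B"
    by (rule weil_cong.refl) (auto simp: weil_tensor_def weil_Wn_def)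
  ultimately have "(var 0 * var 0 * (var 1 * var 1), 0 * (var 1 * var 1)) \<in> weil_cong ?B"
    by (rule weil_cong.mult)
  \<comment> \<open>the square of \<open>x\<^sub>0 x\<^sub>1\<close> contains the vanishing factor \<open>x\<^sub>0 x\<^sub>0\<close>\<close>
  then have "((var 0 * var 1) * (var 0 * var 1), 0) \<in> weil_cong ?B"
    by (simp add: ac_simps)
  then show ?thesis unfolding weil_ell_def
    by (intro weil_map_hom) (auto simp: weil_assignment_def)
qed

lemma weil_in0_assignment: "weil_assignment A (A \<otimes>w B) var"
  by (auto simp: weil_assignment_def weil_tensor_def intro!: weil_cong.gen)

lemma weil_in1_assignment: "weil_assignment B (A \<otimes>w B) (\<lambda>j. var (fst A + j))"
  by (auto simp: weil_assignment_def weil_tensor_def intro!: weil_cong.gen)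

lemma weil_in_hom:
  assumes "A \<in> Ob Weil" "B \<in> Ob Weil"
  shows "weil_in0 A B \<in> Hom Weil A (A \<otimes>w B)" "weil_in1 A B \<in> Hom Weil B (A \<otimes>w B)"
  unfolding weil_in0_def weil_in1_def using assms
  by (auto intro!: weil_map_hom[OF weil_in0_assignment] weil_map_hom[OF weil_in1_assignment])

text \<open>
The variables of \<open>A \<otimes> B\<close> are those of \<open>A\<close> followed by those of \<open>B\<close>, so an endomorphism that is compatible
with both coprojections fixes every variable.
\<close>

lemma weil_tensor_ar_Id:
  assumes A: "A \<in> Ob Weil" and B: "B \<in> Ob Weil"
  shows "Id Weil A \<otimes>a Id Weil B = Id Weil (A \<otimes>w B)"
proof -
  note i0 = weil_in_hom(1)[OF A B] and i1 = weil_in_hom(2)[OF A B]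
  have AB: "A \<otimes>w B \<in> Ob Weil" using A B by simp
  have d: "Dom Weil (Id Weil D) = D" "Cod Weil (Id Weil D) = D" for D by (simp_all add: Weil_def)
  have uniq: "h = Id Weil (A \<otimes>w B)"
    if h: "h \<in> Hom Weil (A \<otimes>w B) (A \<otimes>w B)" and
      e: "h \<cdot>\<^bsub>Weil\<^esub> weil_in0 A B = weil_in0 A B" "h \<cdot>\<^bsub>Weil\<^esub> weil_in1 A B = weil_in1 A B" for h
  proof -
    obtain H where H: "h = (A \<otimes>w B, A \<otimes>w B, H)" "H \<in> weil_hom (A \<otimes>w B) (A \<otimes>w B)"
      using h by (auto simp: Hom_Weil)
    obtain K where K: "Id Weil (A \<otimes>w B) = (A \<otimes>w B, A \<otimes>w B, K)" "K \<in> weil_hom (A \<otimes>w B) (A \<otimes>w B)"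
      using Weil_Id_hom[OF AB] by (auto simp: Hom_Weil)
    obtain I where I: "weil_in0 A B = (A, A \<otimes>w B, I)" using i0 by (auto simp: Hom_Weil)
    obtain J where J: "weil_in1 A B = (B, A \<otimes>w B, J)" using i1 by (auto simp: Hom_Weil)
    have I': "I (weil_class A (var i)) = weil_class (A \<otimes>w B) (var i)" if "i < fst A" for i
      using weil_map_class[OF weil_in0_assignment, of "var i" A B] that I by (simp add: weil_in0_def)
    have J': "J (weil_class B (var i)) = weil_class (A \<otimes>w B) (var (fst A + i))" if "i < fst B" for i
      using weil_map_class[OF weil_in1_assignment, of "var i" B A] that J by (simp add: weil_in1_def)
    have eI: "compose (carrier (weil_alg A)) H I = I" and eJ: "compose (carrier (weil_alg B)) H J = J"
      using e by (simp_all add: H I J Weil_comp)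
    have "H = K"
    proof (rule weil_hom_determined[OF H(2) K(2)])
      fix i assume i: "i < fst (A \<otimes>w B)"
      have "H (weil_class (A \<otimes>w B) (var i)) = weil_class (A \<otimes>w B) (var i)"
      proof (cases "i < fst A")
        case True
        then show ?thesis using fun_cong[OF eI, of "weil_class A (var i)"] I' by (simp add: compose_eq)
      next
        case False
        then show ?thesis using fun_cong[OF eJ, of "weil_class B (var (i - fst A))"] J'[of "i - fst A"] i
          by (simp add: compose_eq)
      qed
      then show "H (weil_class (A \<otimes>w B) (var i)) = K (weil_class (A \<otimes>w B) (var i))"
        using K(1)[symmetric] i by (simp add: Weil_Id)
    qed
    then show ?thesis by (simp add: H K)
  qed
  show ?thesis unfolding weil_tensor_ar_def Let_def d
  proof (rule the_equality)
    show "Id Weil (A \<otimes>w B) \<in> Hom Weil (A \<otimes>w B) (A \<otimes>w B) \<and>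
        Id Weil (A \<otimes>w B) \<cdot>\<^bsub>Weil\<^esub> weil_in0 A B = weil_in0 A B \<cdot>\<^bsub>Weil\<^esub> Id Weil A \<and>
        Id Weil (A \<otimes>w B) \<cdot>\<^bsub>Weil\<^esub> weil_in1 A B = weil_in1 A B \<cdot>\<^bsub>Weil\<^esub> Id Weil B"
      by (simp only: Weil_Id_comp[OF i0] Weil_Id_comp[OF i1] Weil_Id_hom[OF AB] simp_thms)
  next
    fix h assume "h \<in> Hom Weil (A \<otimes>w B) (A \<otimes>w B) \<and>
        h \<cdot>\<^bsub>Weil\<^esub> weil_in0 A B = weil_in0 A B \<cdot>\<^bsub>Weil\<^esub> Id Weil A \<and>
        h \<cdot>\<^bsub>Weil\<^esub> weil_in1 A B = weil_in1 A B \<cdot>\<^bsub>Weil\<^esub> Id Weil B"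
    then show "h = Id Weil (A \<otimes>w B)"
      unfolding Weil_Id_comp[OF i0] Weil_Id_comp[OF i1] using uniq by blast
  qed
qed

text \<open>
Tensoring with the unit turns the pullback axiom for \<open>A \<otimes> (B \<times> C)\<close>, at \<open>A = \<nat>\<close>, into one about \<open>B \<times> C\<close> itself.
\<close>

lemma weil_tensor_ar_unit:
  assumes th: "\<theta> \<in> Hom Weil B B'"
  shows "Id Weil weil_N \<otimes>a \<theta> = \<theta>"
proof -
  have ob: "B \<in> Ob Weil" "B' \<in> Ob Weil" using th by (auto simp: Hom_Weil)
  obtain h where h: "\<theta> = (B, B', h)" "h \<in> weil_hom B B'" using th by (auto simp: Hom_Weil)
  have in1: "weil_in1 weil_N X = Id Weil X" if "X \<in> Ob Weil" for X
    using weil_map_var[OF that] by (simp add: weil_in1_def weil_tensor_unit)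
  have in0: "weil_in0 weil_N X \<in> Hom Weil weil_N X" if "X \<in> Ob Weil" for X
    using weil_in_hom(1)[OF weil_N_ob that] by (simp add: weil_tensor_unit)
  obtain i where i: "weil_in0 weil_N B = (weil_N, B, i)" "i \<in> weil_hom weil_N B"
    using in0[OF ob(1)] by (auto simp: Hom_Weil)
  obtain i' where i': "weil_in0 weil_N B' = (weil_N, B', i')" "i' \<in> weil_hom weil_N B'"
    using in0[OF ob(2)] by (auto simp: Hom_Weil)
  note comp = weil_hom_compose[OF i(2) h(2)]
  have "compose (carrier (weil_alg weil_N)) h i = i'"
    by (rule weil_hom_determined[OF comp i'(2)]) (simp add: weil_N_def)
  then have e0: "\<theta> \<cdot>\<^bsub>Weil\<^esub> weil_in0 weil_N B = weil_in0 weil_N B' \<cdot>\<^bsub>Weil\<^esub> Id Weil weil_N"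
    using Weil_Id_comp(1)[OF in0[OF ob(2)]] by (simp add: h i i' Weil_comp)
  have d: "Dom Weil (Id Weil weil_N) = weil_N" "Cod Weil (Id Weil weil_N) = weil_N"
      "Dom Weil \<theta> = B" "Cod Weil \<theta> = B'"
    by (auto simp: Weil_def h)
  show ?thesis unfolding weil_tensor_ar_def Let_def d weil_tensor_unit in1[OF ob(1)] in1[OF ob(2)]
    using th e0 Weil_Id_comp(2)[OF th] by (intro the_equality) (auto dest: Weil_Id_comp(1))
qed

section \<open>The product of two copies of W\<close>

text \<open>
The coefficients of degree zero and one are invariant under the congruence of every Weil algebra, as the
relations are in degree two; in \<open>W\<^sub>n\<close>, where all products of variables vanish, they determine an
element. This gives the concrete description of \<open>W\<^sub>2\<close> from which the universal property of a product is read off.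
\<close>

definition const_coeff :: "npoly \<Rightarrow> nat" where "const_coeff P = Poly_Mapping.lookup P 0"

definition lin_coeff :: "nat \<Rightarrow> npoly \<Rightarrow> nat" where
  "lin_coeff i P = Poly_Mapping.lookup P (Poly_Mapping.single i 1)"

lemma monom_simps:
  "Poly_Mapping.single i (Suc 0) \<noteq> (0 :: nat \<Rightarrow>\<^sub>0 nat)"
  "Poly_Mapping.single i (Suc 0) = (Poly_Mapping.single j (Suc 0) :: nat \<Rightarrow>\<^sub>0 nat) \<longleftrightarrow> i = j"
  by (auto simp: lookup_single when_def split: if_splits
      dest!: arg_cong[where f = "\<lambda>m. Poly_Mapping.lookup m i"])

lemma const_coeff_simps [simp]: "const_coeff 0 = 0" "const_coeff 1 = 1" "const_coeff (var i) = 0" "const_coeff (P + Q) = const_coeff P + const_coeff Q"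
  by (simp_all add: const_coeff_def var_def lookup_add lookup_single lookup_one monom_simps)

lemma lin_coeff_simps [simp]: "lin_coeff i 0 = 0" "lin_coeff i 1 = 0" "lin_coeff i (var j) = (if i = j then 1 else 0)"
  "lin_coeff i (P + Q) = lin_coeff i P + lin_coeff i Q"
  by (simp_all add: lin_coeff_def var_def lookup_add lookup_single lookup_one when_def monom_simps eq_commute[of 0])

lemma const_coeff_mult [simp]: "const_coeff (P * Q) = const_coeff P * const_coeff Q"
proof (induction P rule: npoly_induct)
  case (single m c)
  show ?case
  proof (induction Q rule: npoly_induct)
    case (single m' c')
    have "m + m' = 0 \<longleftrightarrow> m = 0 \<and> m' = 0"
      by (auto simp: poly_mapping_eq_iff lookup_add fun_eq_iff)
    then show ?case by (simp add: const_coeff_def mult_single lookup_single when_def)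
  qed (simp add: distrib_left)
qed (simp add: distrib_right)

lemma single_eq_add_iff:
  fixes m m' :: "nat \<Rightarrow>\<^sub>0 nat"
  shows "m + m' = Poly_Mapping.single i 1 \<longleftrightarrow>
    (m = 0 \<and> m' = Poly_Mapping.single i 1) \<or> (m = Poly_Mapping.single i 1 \<and> m' = 0)"
proof
  assume *: "m + m' = Poly_Mapping.single i 1"
  have l: "Poly_Mapping.lookup m j + Poly_Mapping.lookup m' j = (if i = j then 1 else 0)" for j
    using arg_cong[OF *, of "\<lambda>p. Poly_Mapping.lookup p j"] by (simp add: lookup_add lookup_single when_def)
  have z: "Poly_Mapping.lookup m j = 0 \<and> Poly_Mapping.lookup m' j = 0" if "j \<noteq> i" for j
    using l[of j] that by simp
  have "(Poly_Mapping.lookup m i = 0 \<and> Poly_Mapping.lookup m' i = 1) \<or>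
      (Poly_Mapping.lookup m i = 1 \<and> Poly_Mapping.lookup m' i = 0)"
    using l[of i] by auto
  then show "(m = 0 \<and> m' = Poly_Mapping.single i 1) \<or> (m = Poly_Mapping.single i 1 \<and> m' = 0)"
  proof (elim disjE)
    assume "Poly_Mapping.lookup m i = 0 \<and> Poly_Mapping.lookup m' i = 1"
    then have "m = 0" "m' = Poly_Mapping.single i 1"
      using z by (auto intro!: poly_mapping_eqI simp: lookup_single when_def) metis
    then show ?thesis by blast
  next
    assume "Poly_Mapping.lookup m i = 1 \<and> Poly_Mapping.lookup m' i = 0"
    then have "m = Poly_Mapping.single i 1" "m' = 0"
      using z by (auto intro!: poly_mapping_eqI simp: lookup_single when_def) metis
    then show ?thesis by blast
  qed
qed auto

lemma lin_coeff_mult [simp]: "lin_coeff i (P * Q) = const_coeff P * lin_coeff i Q + lin_coeff i P * const_coeff Q"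
proof (induction P rule: npoly_induct)
  case (single m c)
  show ?case
  proof (induction Q rule: npoly_induct)
    case (single m' c')
    have "Poly_Mapping.single i 1 \<noteq> (0 :: nat \<Rightarrow>\<^sub>0 nat)"
      by (metis lookup_single_eq lookup_zero one_neq_zero)
    then show ?case using single_eq_add_iff[of m m' i]
      by (auto simp: const_coeff_def lin_coeff_def mult_single lookup_single when_def)
  qed (simp add: algebra_simps)
qed (simp add: algebra_simps)

lemma const_coeff_of_nat [simp]: "const_coeff (of_nat k) = k" and lin_coeff_of_nat [simp]: "lin_coeff i (of_nat k) = 0"
  by (induction k) simp_all

lemma weil_cong_coeffs: "(P, Q) \<in> weil_cong A \<Longrightarrow> const_coeff P = const_coeff Q \<and> (\<forall>i. lin_coeff i P = lin_coeff i Q)"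
  by (induction rule: weil_cong.induct) simp_all

text \<open>
The part of degree at most one, which is a normal form modulo the relations of \<open>W\<^sub>n\<close>.
\<close>

definition affine :: "nat \<Rightarrow> npoly \<Rightarrow> npoly" where
  "affine n P = of_nat (const_coeff P) + (\<Sum>i<n. of_nat (lin_coeff i P) * var i)"

lemma npolys_sum: "(\<And>i. i \<in> S \<Longrightarrow> f i \<in> npolys n) \<Longrightarrow> sum f S \<in> npolys n"
  by (induction S rule: infinite_finite_induct) auto

lemma affine_npolys: "affine n P \<in> npolys n"
  unfolding affine_def by (intro npolys_add npolys_of_nat npolys_sum npolys_mult npolys_var) auto

lemma weil_cong_sum_zero:
  "(\<And>i. i \<in> S \<Longrightarrow> (f i, 0) \<in> weil_cong A) \<Longrightarrow> (sum f S, 0) \<in> weil_cong A"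
proof (induction S rule: infinite_finite_induct)
  case (insert x F)
  then show ?case using weil_cong.add[of "f x" 0 A "sum f F" 0] by simp
qed (simp_all add: weil_cong.refl)

lemma weil_cong_affine: "P \<in> npolys n \<Longrightarrow> (P, affine n P) \<in> weil_cong (weil_Wn n)"
proof (induction P rule: npolys_induct)
  case zero
  show ?case by (simp add: affine_def weil_cong.refl)
next
  case one
  show ?case by (simp add: affine_def weil_cong.refl)
next
  case (var i)
  have "(\<Sum>j<n. of_nat (lin_coeff j (var i)) * var j) = (\<Sum>j<n. if j = i then var i else 0)"
    by (intro sum.cong) auto
  also have "\<dots> = var i" using var by simp
  finally show ?case using var by (simp add: affine_def weil_cong.refl)
next
  case (add P Q)
  then show ?case using weil_cong.add[OF add(3,4)]
    by (simp add: affine_def sum.distrib algebra_simps)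
next
  case (mult P Q)
  let ?L = "\<lambda>P. \<Sum>i<n. of_nat (lin_coeff i P) * var i" and ?W = "weil_Wn n"
  have L: "?L R \<in> npolys n" for R
    by (intro npolys_sum npolys_mult npolys_of_nat npolys_var) simp
  have "(of_nat (lin_coeff i P) * of_nat (lin_coeff j Q) * (var i * var j), of_nat (lin_coeff i P) * of_nat (lin_coeff j Q) * 0) \<in> weil_cong ?W"
    if "i < n" "j < n" for i j
    using that by (intro weil_cong.mult weil_cong.refl weil_Wn_gen) simp_all
  then have "(\<Sum>i<n. \<Sum>j<n. of_nat (lin_coeff i P) * of_nat (lin_coeff j Q) * (var i * var j), 0) \<in> weil_cong ?W"
    by (intro weil_cong_sum_zero) simp
  moreover have "?L P * ?L Q = (\<Sum>i<n. \<Sum>j<n. of_nat (lin_coeff i P) * of_nat (lin_coeff j Q) * (var i * var j))"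
    unfolding sum_product by (intro sum.cong) (simp_all add: ac_simps)
  ultimately have LL: "(?L P * ?L Q, 0) \<in> weil_cong ?W" by simp
  have "affine n P * affine n Q = affine n (P * Q) + ?L P * ?L Q"
    by (simp add: affine_def algebra_simps sum.distrib sum_distrib_left)
  moreover have "(affine n (P * Q) + ?L P * ?L Q, affine n (P * Q) + 0) \<in> weil_cong ?W"
    by (rule weil_cong.add[OF weil_cong.refl LL]) (simp add: affine_npolys)
  ultimately have "(affine n P * affine n Q, affine n (P * Q)) \<in> weil_cong ?W" by simp
  then show ?case by (rule weil_cong.trans[OF weil_cong.mult[OF mult(3,4)]])
qed

lemma weil_cong_Wn_iff:
  assumes "P \<in> npolys n" "Q \<in> npolys n"
  shows "(P, Q) \<in> weil_cong (weil_Wn n) \<longleftrightarrow> const_coeff P = const_coeff Q \<and> (\<forall>i<n. lin_coeff i P = lin_coeff i Q)"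
proof
  assume "const_coeff P = const_coeff Q \<and> (\<forall>i<n. lin_coeff i P = lin_coeff i Q)"
  then have "affine n P = affine n Q" by (simp add: affine_def)
  then show "(P, Q) \<in> weil_cong (weil_Wn n)"
    using weil_cong_affine[OF assms(1)] weil_cong_affine[OF assms(2)]
    by (metis weil_cong.sym weil_cong.trans)
qed (use weil_cong_coeffs in blast)

definition class_const :: "npoly set \<Rightarrow> nat" where "class_const S = const_coeff (SOME P. P \<in> S)"

definition class_lin :: "nat \<Rightarrow> npoly set \<Rightarrow> nat" where "class_lin i S = lin_coeff i (SOME P. P \<in> S)"

lemma class_coeffs [simp]:
  assumes "P \<in> npolys (fst A)"
  shows "class_const (weil_class A P) = const_coeff P" "class_lin i (weil_class A P) = lin_coeff i P"
proof -
  have "(SOME Q. Q \<in> weil_class A P) \<in> weil_class A P"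
    using weil_class_self[OF assms] by (rule someI)
  then have "(P, SOME Q. Q \<in> weil_class A P) \<in> weil_cong A" by (simp add: weil_class_def)
  from weil_cong_coeffs[OF this]
  show "class_const (weil_class A P) = const_coeff P" "class_lin i (weil_class A P) = lin_coeff i P"
    by (simp_all add: class_const_def class_lin_def)
qed

lemma weil_Wn_eqI:
  assumes "S \<in> carrier (weil_alg (weil_Wn n))" "T \<in> carrier (weil_alg (weil_Wn n))"
    and "class_const S = class_const T" "\<And>i. i < n \<Longrightarrow> class_lin i S = class_lin i T"
  shows "S = T"
proof -
  obtain P Q where "P \<in> npolys n" "Q \<in> npolys n" "S = weil_class (weil_Wn n) P" "T = weil_class (weil_Wn n) Q"
    using assms(1,2) by (auto elim!: weil_carrierE)
  then show ?thesis using assms(3,4) by (simp add: weil_class_eq_iff weil_cong_Wn_iff)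
qed

lemma class_coeffs_add [simp]:
  assumes "S \<in> carrier (weil_alg A)" "T \<in> carrier (weil_alg A)"
  shows "class_const (add (weil_alg A) S T) = class_const S + class_const T"
    "class_lin i (add (weil_alg A) S T) = class_lin i S + class_lin i T"
    "add (weil_alg A) S T \<in> carrier (weil_alg A)"
  using assms by (auto elim!: weil_carrierE)

lemma class_coeffs_mult [simp]:
  assumes "S \<in> carrier (weil_alg A)" "T \<in> carrier (weil_alg A)"
  shows "class_const (mult (weil_alg A) S T) = class_const S * class_const T"
    "class_lin i (mult (weil_alg A) S T) = class_const S * class_lin i T + class_lin i S * class_const T"
    "mult (weil_alg A) S T \<in> carrier (weil_alg A)"
  using assms by (auto elim!: weil_carrierE)

text \<open>
All variables of a Weil algebra are nilpotent, and the constant coefficients are natural numbers; so a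
morphism can only send variables to elements with zero constant coefficient. In other words, \<open>\<nat>\<close> is terminal. Two morphisms
from the same object into \<open>W\<close> therefore agree in their constant coefficients, which is why they can be combined to one into \<open>W\<^sub>2\<close>.
\<close>

lemma weil_hom_class_const:
  assumes h: "h \<in> weil_hom A B" and A: "A \<in> Ob Weil" and P: "P \<in> npolys (fst A)"
  shows "class_const (h (weil_class A P)) = const_coeff P"
  using P
proof (induction P rule: npolys_induct)
  case (var i)
  have "(i, i) \<in> snd A" using A var by (auto simp: Weil_def equiv_def refl_on_def)
  then have "(var i * var i, 0) \<in> weil_cong A" using var by (intro weil_cong.gen) auto
  then have "weil_class A (var i * var i) = weil_class A 0"
    using var by (subst weil_class_eq_iff) auto
  moreover have "h (weil_class A (var i * var i)) = mult (weil_alg B) (h (weil_class A (var i))) (h (weil_class A (var i)))"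
    "h (weil_class A (var i)) \<in> carrier (weil_alg B)" "h (weil_class A 0) = weil_class B 0"
    using h var by (simp_all add: weil_hom_iff)
  ultimately have "class_const (h (weil_class A (var i))) * class_const (h (weil_class A (var i))) = class_const (weil_class B 0)"
    by (metis class_coeffs_mult(1))
  then show ?case by simp
qed (use h in \<open>auto simp: weil_hom_iff\<close>)

lemma weil_pr_coeffs:
  assumes "P \<in> npolys 2" "k < 2"
  shows "const_coeff (npoly_subst (\<lambda>i. if i = k then var 0 else 0) P) = const_coeff P \<and>
    lin_coeff 0 (npoly_subst (\<lambda>i. if i = k then var 0 else 0) P) = lin_coeff k P"
  using assms(1) by (induction P rule: npolys_induct) (auto simp: npoly_subst_add npoly_subst_mult)

lemma weil_pr_class_coeffs:
  assumes "S \<in> carrier (weil_alg (weil_Wn 2))" "k < 2"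
  shows "class_const (snd (snd (weil_pr k)) S) = class_const S"
    "class_lin 0 (snd (snd (weil_pr k)) S) = class_lin k S"
proof -
  obtain P where P: "P \<in> npolys 2" "S = weil_class (weil_Wn 2) P"
    using assms(1) by (auto elim!: weil_carrierE)
  moreover have "npoly_subst (\<lambda>i. if i = k then var 0 else 0) P \<in> npolys 1"
    using P by (intro npoly_subst_npolys) auto
  ultimately show "class_const (snd (snd (weil_pr k)) S) = class_const S"
    "class_lin 0 (snd (snd (weil_pr k)) S) = class_lin k S"
    using weil_pr_coeffs[OF P(1) assms(2)]
    by (simp_all add: weil_pr_def weil_map_class[OF weil_pr_assignment] del: One_nat_def)
qed

text \<open>
An element of \<open>W\<^sub>2\<close> is given by a constant and two linear coefficients. The projections keep the constant and
one of the linear coefficients, so they are jointly injective, and a pair of elements of \<open>W\<close> with the same constant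
coefficient has a common preimage.
\<close>

lemma weil_W2_product: "is_product Weil weil_W weil_W (weil_pr 0) (weil_pr 1)"
proof -
  let ?W2 = "weil_Wn 2" and ?W = "weil_W"
  have pr: "\<exists>q. weil_pr k = (?W2, ?W, q) \<and> q \<in> weil_hom ?W2 ?W" for k
    using weil_pr_hom[of k] by (auto simp: Hom_Weil)
  obtain q0 where q0: "weil_pr 0 = (?W2, ?W, q0)" "q0 \<in> weil_hom ?W2 ?W" using pr by blast
  obtain q1 where q1: "weil_pr 1 = (?W2, ?W, q1)" "q1 \<in> weil_hom ?W2 ?W" using pr by blast
  have q0c: "class_const (q0 S) = class_const S" "class_lin 0 (q0 S) = class_lin 0 S"
    and q1c: "class_const (q1 S) = class_const S" "class_lin 0 (q1 S) = class_lin 1 S"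
    if "S \<in> carrier (weil_alg ?W2)" for S
    using weil_pr_class_coeffs[OF that, of 0] weil_pr_class_coeffs[OF that, of 1] by (simp_all add: q0 q1 del: One_nat_def)
  have closed: "h S \<in> carrier (weil_alg B)" if "h \<in> weil_hom A B" "S \<in> carrier (weil_alg A)" for h A B S
    using that by (auto simp: weil_hom_def intro: ring_hom_closed)
  have ex1: "\<exists>!h. h \<in> Hom Weil C ?W2 \<and> weil_pr 0 \<cdot>\<^bsub>Weil\<^esub> h = f \<and> weil_pr 1 \<cdot>\<^bsub>Weil\<^esub> h = g"
    if C: "C \<in> Ob Weil" and f: "f \<in> Hom Weil C ?W" and g: "g \<in> Hom Weil C ?W" for C f g
  proof -
    obtain F where F: "f = (C, ?W, F)" "F \<in> weil_hom C ?W" using f by (auto simp: Hom_Weil)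
    obtain G where G: "g = (C, ?W, G)" "G \<in> weil_hom C ?W" using g by (auto simp: Hom_Weil)
    let ?c = "carrier (weil_alg C)"
    \<comment> \<open>the only possible value of the induced map, as a polynomial in normal form\<close>
    define rep where "rep S = of_nat (class_const (F S)) + of_nat (class_lin 0 (F S)) * var 0 +
        of_nat (class_lin 0 (G S)) * var 1" for S
    define H where "H = (\<lambda>S\<in>?c. weil_class ?W2 (rep S))"
    have rep: "rep S \<in> npolys 2" for S unfolding rep_def
      by (intro npolys_add npolys_mult npolys_of_nat npolys_var) simp_all
    have Hc: "H S \<in> carrier (weil_alg ?W2)" "class_const (H S) = class_const (F S)"
        "class_lin 0 (H S) = class_lin 0 (F S)" "class_lin 1 (H S) = class_lin 0 (G S)" if "S \<in> ?c" for S
      using that rep[of S] by (simp_all add: H_def) (simp_all add: rep_def)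
    have FG: "class_const (G S) = class_const (F S)" if "S \<in> ?c" for S
      using that by (auto elim!: weil_carrierE simp: weil_hom_class_const[OF F(2) C] weil_hom_class_const[OF G(2) C])
    have FGr: "F \<in> ring_hom (weil_alg C) (weil_alg ?W)" "G \<in> ring_hom (weil_alg C) (weil_alg ?W)"
      "F (weil_class C 0) = weil_class ?W 0" "G (weil_class C 0) = weil_class ?W 0"
      using F(2) G(2) by (auto simp: weil_hom_def weil_class_zero)
    have eqI2: "S = T" if "S \<in> carrier (weil_alg ?W2)" "T \<in> carrier (weil_alg ?W2)"
      "class_const S = class_const T" "class_lin 0 S = class_lin 0 T" "class_lin 1 S = class_lin 1 T" for S T
      by (rule weil_Wn_eqI[OF that(1,2)]) (use that in \<open>auto simp: less_2_cases_iff\<close>)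
    have "H \<in> ring_hom (weil_alg C) (weil_alg ?W2)"
    proof (rule ring_hom_memI)
      fix S T assume ST: "S \<in> ?c" "T \<in> ?c"
      note S = closed[OF F(2) ST(1)] closed[OF G(2) ST(1)] and T = closed[OF F(2) ST(2)] closed[OF G(2) ST(2)]
      show "H (mult (weil_alg C) S T) = mult (weil_alg ?W2) (H S) (H T)"
        using ST S T by (intro eqI2) (simp_all add: Hc FG ring_hom_mult[OF FGr(1) ST] ring_hom_mult[OF FGr(2) ST] del: One_nat_def)
      show "H (add (weil_alg C) S T) = add (weil_alg ?W2) (H S) (H T)"
        using ST S T by (intro eqI2) (simp_all add: Hc FG ring_hom_add[OF FGr(1) ST] ring_hom_add[OF FGr(2) ST] del: One_nat_def)
    next
      have one: "F (weil_class C 1) = weil_class ?W 1" "G (weil_class C 1) = weil_class ?W 1"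
        using ring_hom_one[OF FGr(1)] ring_hom_one[OF FGr(2)] by (simp_all add: weil_class_one)
      show "H (one (weil_alg C)) = one (weil_alg ?W2)"
        unfolding weil_class_one by (intro eqI2) (simp_all add: Hc one del: One_nat_def)
    qed (rule Hc)
    moreover have "H (zero (weil_alg C)) = zero (weil_alg ?W2)"
      unfolding weil_class_zero by (intro eqI2) (simp_all add: Hc FGr del: One_nat_def)
    ultimately have H: "H \<in> weil_hom C ?W2" by (simp add: weil_hom_def H_def)
    show ?thesis
    proof (rule ex1I)
      have "compose ?c q0 H = F"
      proof (rule extensionalityI)
        fix S assume "S \<in> ?c"
        then show "compose ?c q0 H S = F S"
          by (intro weil_Wn_eqI[of _ 1])
            (simp_all add: compose_eq q0c Hc closed[OF F(2)] closed[OF q0(2)] del: One_nat_def)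
      qed (use F in \<open>auto simp: weil_hom_def\<close>)
      moreover have "compose ?c q1 H = G"
      proof (rule extensionalityI)
        fix S assume "S \<in> ?c"
        then show "compose ?c q1 H S = G S"
          by (intro weil_Wn_eqI[of _ 1])
            (simp_all add: compose_eq q1c Hc FG closed[OF G(2)] closed[OF q1(2)] del: One_nat_def)
      qed (use G in \<open>auto simp: weil_hom_def\<close>)
      ultimately show "(C, ?W2, H) \<in> Hom Weil C ?W2 \<and> weil_pr 0 \<cdot>\<^bsub>Weil\<^esub> (C, ?W2, H) = f \<and>
          weil_pr 1 \<cdot>\<^bsub>Weil\<^esub> (C, ?W2, H) = g"
        using C H by (simp add: Hom_Weil q0 q1 F G del: One_nat_def) (simp add: Weil_def)
    next
      fix h assume h: "h \<in> Hom Weil C ?W2 \<and> weil_pr 0 \<cdot>\<^bsub>Weil\<^esub> h = f \<and> weil_pr 1 \<cdot>\<^bsub>Weil\<^esub> h = g"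
      then obtain K where K: "h = (C, ?W2, K)" "K \<in> weil_hom C ?W2" by (auto simp: Hom_Weil)
      have q0K: "compose ?c q0 K = F" and q1K: "compose ?c q1 K = G"
        using h by (auto simp: K q0 q1 F G Weil_def simp del: One_nat_def)
      have "K = H"
      proof (rule extensionalityI)
        fix S assume S: "S \<in> ?c"
        have "q0 (K S) = F S" "q1 (K S) = G S"
          using fun_cong[OF q0K, of S] fun_cong[OF q1K, of S] S by (simp_all add: compose_eq)
        then show "K S = H S"
          using q0c[OF closed[OF K(2) S]] q1c[OF closed[OF K(2) S]]
          by (intro eqI2 closed[OF K(2) S]) (simp_all add: Hc S del: One_nat_def)
      qed (use K H in \<open>auto simp: weil_hom_def\<close>)
      then show "h = (C, ?W2, H)" by (simp add: K)
    qed
  qed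
  have d: "weil_pr 0 \<in> Ar Weil" "weil_pr 1 \<in> Ar Weil" "Dom Weil (weil_pr 0) = ?W2" "Dom Weil (weil_pr 1) = ?W2"
      "Cod Weil (weil_pr 0) = ?W" "Cod Weil (weil_pr 1) = ?W"
    using weil_pr_hom by (auto simp: Hom_def)
  show ?thesis unfolding is_product_def d using ex1 d by blast
qed

section \<open>The tangent functor of an actegory\<close>

text \<open>The index of \<open>W\<^sub>1\<close> is kept as the numeral \<open>1\<close>, so that \<open>weil_W\<close> stays in the form used by the definitions.\<close>

declare One_nat_def [simp del]

lemma prod_cat_simps [simp]:
  "(f, g) \<in> Ar (prod_cat C D) \<longleftrightarrow> f \<in> Ar C \<and> g \<in> Ar D"
  "(x, y) \<in> Ob (prod_cat C D) \<longleftrightarrow> x \<in> Ob C \<and> y \<in> Ob D"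
  "Dom (prod_cat C D) (f, g) = (Dom C f, Dom D g)"
  "Cod (prod_cat C D) (f, g) = (Cod C f, Cod D g)"
  "Id (prod_cat C D) (x, y) = (Id C x, Id D y)"
  "(f', g') \<cdot>\<^bsub>prod_cat C D\<^esub> (f, g) = (f' \<cdot>\<^bsub>C\<^esub> f, g' \<cdot>\<^bsub>D\<^esub> g)"
  by (simp_all add: prod_cat_def)

definition T_fctr :: "('o, 'm) actegory \<Rightarrow> weil_ob \<Rightarrow> ('o, 'm, 'o, 'm) fctr" where
  "T_fctr \<XX> A = \<lparr>obj_map = Tob \<XX> A, arr_map = Tar \<XX> A\<rparr>"

lemma T_fctr_simps [simp]: "obj_map (T_fctr \<XX> A) = Tob \<XX> A" "arr_map (T_fctr \<XX> A) = Tar \<XX> A"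
  by (simp_all add: T_fctr_def)

definition T_power :: "('o, 'm) actegory \<Rightarrow> nat \<Rightarrow> ('o, 'm, 'o, 'm) fctr" where
  "T_power \<XX> k = \<lparr>obj_map = Tob \<XX> weil_W ^^ k, arr_map = Tar \<XX> weil_W ^^ k\<rparr>"

text \<open>
The iterated structure isomorphism from \<open>T\<^sup>k\<close> to \<open>T\<^sub>B\<close> with \<open>B = W\<^bsup>\<otimes>k\<^esup>\<close>. It relates the iterates of \<open>T\<close>, in
terms of which differential bundles are defined, to the functors that lax differential functors speak about.
\<close>

primrec T_power_iso :: "('o, 'm) actegory \<Rightarrow> nat \<Rightarrow> 'o \<Rightarrow> 'm" where
  "T_power_iso \<XX> 0 X = act_unit \<XX> X"
| "T_power_iso \<XX> (Suc k) X =
    act_mult \<XX> weil_W (weil_W_tensor k) X \<cdot>\<^bsub>tcat \<XX>\<^esub> Tar \<XX> weil_W (T_power_iso \<XX> k X)"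

context weil_actegory
begin

lemma act_ar:
  assumes "\<theta> \<in> Hom Weil A B" "f \<in> Ar (tcat \<XX>)"
  shows "arr_map (act \<XX>) (\<theta>, f) \<in> Ar (tcat \<XX>)"
    "Dom (tcat \<XX>) (arr_map (act \<XX>) (\<theta>, f)) = Tob \<XX> A (Dom (tcat \<XX>) f)"
    "Cod (tcat \<XX>) (arr_map (act \<XX>) (\<theta>, f)) = Tob \<XX> B (Cod (tcat \<XX>) f)"
  using assms by (simp_all add: Hom_def Tob_def)

lemma act_comp:
  assumes "\<theta> \<in> Hom Weil A B" "\<phi> \<in> Hom Weil B D" "f \<in> Ar (tcat \<XX>)" "g \<in> Ar (tcat \<XX>)"
    "Cod (tcat \<XX>) f = Dom (tcat \<XX>) g"
  shows "arr_map (act \<XX>) (\<phi>, g) \<cdot>\<^bsub>tcat \<XX>\<^esub> arr_map (act \<XX>) (\<theta>, f) =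
    arr_map (act \<XX>) (\<phi> \<cdot>\<^bsub>Weil\<^esub> \<theta>, g \<cdot>\<^bsub>tcat \<XX>\<^esub> f)"
  using assms act.arr_map_comp_ar[of "(\<theta>, f)" "(\<phi>, g)"] by (simp add: Hom_def)

lemma Tob_ob [simp]: "A \<in> Ob Weil \<Longrightarrow> X \<in> Ob (tcat \<XX>) \<Longrightarrow> Tob \<XX> A X \<in> Ob (tcat \<XX>)"
  using act.obj_map_ob[of "(A, X)"] by (simp add: Tob_def)

lemma Tnat_ar:
  assumes "\<theta> \<in> Hom Weil A B" "X \<in> Ob (tcat \<XX>)"
  shows "Tnat \<XX> \<theta> X \<in> Ar (tcat \<XX>)" "Dom (tcat \<XX>) (Tnat \<XX> \<theta> X) = Tob \<XX> A X"
    "Cod (tcat \<XX>) (Tnat \<XX> \<theta> X) = Tob \<XX> B X"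
  using act_ar[OF assms(1), of "Id (tcat \<XX>) X"] assms(2) by (simp_all add: Tnat_def)

lemma Tar_ar [simp]:
  assumes "A \<in> Ob Weil" "f \<in> Ar (tcat \<XX>)"
  shows "Tar \<XX> A f \<in> Ar (tcat \<XX>)" "Dom (tcat \<XX>) (Tar \<XX> A f) = Tob \<XX> A (Dom (tcat \<XX>) f)"
    "Cod (tcat \<XX>) (Tar \<XX> A f) = Tob \<XX> A (Cod (tcat \<XX>) f)"
  using act_ar[OF Weil_Id_hom[OF assms(1)] assms(2)] by (simp_all add: Tar_def)

lemma Tar_comp [simp]:
  assumes "A \<in> Ob Weil" "f \<in> Ar (tcat \<XX>)" "g \<in> Ar (tcat \<XX>)" "Cod (tcat \<XX>) f = Dom (tcat \<XX>) g"
  shows "Tar \<XX> A (g \<cdot>\<^bsub>tcat \<XX>\<^esub> f) = Tar \<XX> A g \<cdot>\<^bsub>tcat \<XX>\<^esub> Tar \<XX> A f"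
  unfolding Tar_def act_comp[OF Weil_Id_hom[OF assms(1)] Weil_Id_hom[OF assms(1)] assms(2-4)]
    Weil_Id_comp(1)[OF Weil_Id_hom[OF assms(1)]] ..

lemma Tar_Id [simp]:
  assumes "A \<in> Ob Weil" "X \<in> Ob (tcat \<XX>)"
  shows "Tar \<XX> A (Id (tcat \<XX>) X) = Id (tcat \<XX>) (Tob \<XX> A X)"
  using act.arr_map_id[of "(A, X)"] assms by (simp add: Tar_def Tob_def)

lemma T_functor: "A \<in> Ob Weil \<Longrightarrow> is_functor (tcat \<XX>) (tcat \<XX>) (T_fctr \<XX> A)"
  by unfold_locales simp_all

lemma Tnat_natural:
  assumes "\<theta> \<in> Hom Weil A B" "f \<in> Ar (tcat \<XX>)"
  shows "Tnat \<XX> \<theta> (Cod (tcat \<XX>) f) \<cdot>\<^bsub>tcat \<XX>\<^esub> Tar \<XX> A f = arr_map (act \<XX>) (\<theta>, f)"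
    "Tar \<XX> B f \<cdot>\<^bsub>tcat \<XX>\<^esub> Tnat \<XX> \<theta> (Dom (tcat \<XX>) f) = arr_map (act \<XX>) (\<theta>, f)"
proof -
  have AB: "A \<in> Ob Weil" "B \<in> Ob Weil" using assms(1) by (auto simp: Hom_Weil)
  show "Tnat \<XX> \<theta> (Cod (tcat \<XX>) f) \<cdot>\<^bsub>tcat \<XX>\<^esub> Tar \<XX> A f = arr_map (act \<XX>) (\<theta>, f)"
    using assms act_comp[OF Weil_Id_hom[OF AB(1)] assms(1), of f "Id (tcat \<XX>) (Cod (tcat \<XX>) f)"]
    by (simp add: Tnat_def Tar_def Weil_Id_comp(1)[OF assms(1)])
  show "Tar \<XX> B f \<cdot>\<^bsub>tcat \<XX>\<^esub> Tnat \<XX> \<theta> (Dom (tcat \<XX>) f) = arr_map (act \<XX>) (\<theta>, f)"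
    using assms act_comp[OF assms(1) Weil_Id_hom[OF AB(2)], of "Id (tcat \<XX>) (Dom (tcat \<XX>) f)" f]
    by (simp add: Tnat_def Tar_def Weil_Id_comp(2)[OF assms(1)])
qed

lemma unit_ar [simp]:
  assumes "X \<in> Ob (tcat \<XX>)"
  shows "act_unit \<XX> X \<in> Ar (tcat \<XX>)" "Dom (tcat \<XX>) (act_unit \<XX> X) = X"
    "Cod (tcat \<XX>) (act_unit \<XX> X) = Tob \<XX> weil_N X"
  using unit_iso[OF assms] by simp_all

lemma mult_ar [simp]:
  assumes "A \<in> Ob Weil" "B \<in> Ob Weil" "X \<in> Ob (tcat \<XX>)"
  shows "act_mult \<XX> A B X \<in> Ar (tcat \<XX>)" "Dom (tcat \<XX>) (act_mult \<XX> A B X) = Tob \<XX> A (Tob \<XX> B X)"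
    "Cod (tcat \<XX>) (act_mult \<XX> A B X) = Tob \<XX> (A \<otimes>w B) X"
  using mult_iso[OF assms] by simp_all

lemma unit_inverse:
  assumes "X \<in> Ob (tcat \<XX>)"
  shows "is_inverse (tcat \<XX>) (act_unit \<XX> X) (inverse_ar (tcat \<XX>) (act_unit \<XX> X))"
  using unit_iso[OF assms] by (intro act.cod.is_inverse_inverse_ar) blast

lemma mult_inverse:
  assumes "A \<in> Ob Weil" "B \<in> Ob Weil" "X \<in> Ob (tcat \<XX>)"
  shows "is_inverse (tcat \<XX>) (act_mult \<XX> A B X) (inverse_ar (tcat \<XX>) (act_mult \<XX> A B X))"
  using mult_iso[OF assms] by (intro act.cod.is_inverse_inverse_ar) blast

lemma tan_ar [simp]:
  assumes "X \<in> Ob (tcat \<XX>)"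
  shows "tan_p \<XX> X \<in> Ar (tcat \<XX>)" "Dom (tcat \<XX>) (tan_p \<XX> X) = Tob \<XX> weil_W X" "Cod (tcat \<XX>) (tan_p \<XX> X) = X"
    "tan_zero \<XX> X \<in> Ar (tcat \<XX>)" "Dom (tcat \<XX>) (tan_zero \<XX> X) = X" "Cod (tcat \<XX>) (tan_zero \<XX> X) = Tob \<XX> weil_W X"
    "tan_ell \<XX> X \<in> Ar (tcat \<XX>)" "Dom (tcat \<XX>) (tan_ell \<XX> X) = Tob \<XX> weil_W X"
    "Cod (tcat \<XX>) (tan_ell \<XX> X) = Tob \<XX> weil_W (Tob \<XX> weil_W X)"
  using assms act.cod.inverseD(1-4)[OF unit_inverse[OF assms]]
    act.cod.inverseD(1-4)[OF mult_inverse[OF weil_Wn_ob weil_Wn_ob assms, of 1 1]]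
    Tnat_ar[OF weil_p_hom assms] Tnat_ar[OF weil_zero_hom assms] Tnat_ar[OF weil_ell_hom assms]
  by (simp_all add: tan_p_def tan_zero_def tan_ell_def)

lemma tan_zero_natural:
  assumes f: "f \<in> Ar (tcat \<XX>)"
  shows "Tar \<XX> weil_W f \<cdot>\<^bsub>tcat \<XX>\<^esub> tan_zero \<XX> (Dom (tcat \<XX>) f) = tan_zero \<XX> (Cod (tcat \<XX>) f) \<cdot>\<^bsub>tcat \<XX>\<^esub> f"
proof -
  let ?C = "tcat \<XX>" and ?X = "Dom (tcat \<XX>) f" and ?Y = "Cod (tcat \<XX>) f"
  note z = Tnat_ar[OF weil_zero_hom]
  have XY: "?X \<in> Ob ?C" "?Y \<in> Ob ?C" using f by simp_all
  have "Tar \<XX> weil_W f \<cdot>\<^bsub>?C\<^esub> (Tnat \<XX> weil_zero ?X \<cdot>\<^bsub>?C\<^esub> act_unit \<XX> ?X) =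
      Tnat \<XX> weil_zero ?Y \<cdot>\<^bsub>?C\<^esub> (Tar \<XX> weil_N f \<cdot>\<^bsub>?C\<^esub> act_unit \<XX> ?X)"
    by (rule act.cod.whisker) (use Tnat_natural[OF weil_zero_hom f] z f XY in simp_all)
  also have "Tar \<XX> weil_N f \<cdot>\<^bsub>?C\<^esub> act_unit \<XX> ?X = act_unit \<XX> ?Y \<cdot>\<^bsub>?C\<^esub> f"
    using unit_natural[of f ?X ?Y] f by simp
  finally show ?thesis using f XY z by (simp add: tan_zero_def)
qed

lemma T_power_simps [simp]:
  "obj_map (T_power \<XX> k) = Tob \<XX> weil_W ^^ k" "arr_map (T_power \<XX> k) = Tar \<XX> weil_W ^^ k"
  by (simp_all add: T_power_def)

lemma T_power_functor: "is_functor (tcat \<XX>) (tcat \<XX>) (T_power \<XX> k)"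
proof -
  have "(X \<in> Ob (tcat \<XX>) \<longrightarrow> (Tob \<XX> weil_W ^^ k) X \<in> Ob (tcat \<XX>) \<and>
      (Tar \<XX> weil_W ^^ k) (Id (tcat \<XX>) X) = Id (tcat \<XX>) ((Tob \<XX> weil_W ^^ k) X)) \<and>
    (f \<in> Ar (tcat \<XX>) \<longrightarrow> (Tar \<XX> weil_W ^^ k) f \<in> Ar (tcat \<XX>) \<and>
      Dom (tcat \<XX>) ((Tar \<XX> weil_W ^^ k) f) = (Tob \<XX> weil_W ^^ k) (Dom (tcat \<XX>) f) \<and>
      Cod (tcat \<XX>) ((Tar \<XX> weil_W ^^ k) f) = (Tob \<XX> weil_W ^^ k) (Cod (tcat \<XX>) f))" for X f k
    by (induction k) simp_all
  note * = this
  have "f \<in> Ar (tcat \<XX>) \<Longrightarrow> g \<in> Ar (tcat \<XX>) \<Longrightarrow> Cod (tcat \<XX>) f = Dom (tcat \<XX>) g \<Longrightarrow>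
    (Tar \<XX> weil_W ^^ k) (g \<cdot>\<^bsub>tcat \<XX>\<^esub> f) = (Tar \<XX> weil_W ^^ k) g \<cdot>\<^bsub>tcat \<XX>\<^esub> (Tar \<XX> weil_W ^^ k) f" for f g k
    by (induction k) (simp_all add: *)
  with * show ?thesis by unfold_locales simp_all
qed

lemma T_power_iso:
  assumes "X \<in> Ob (tcat \<XX>)"
  shows "is_iso (tcat \<XX>) (T_power_iso \<XX> k X) \<and> T_power_iso \<XX> k X \<in> Ar (tcat \<XX>) \<and>
    Dom (tcat \<XX>) (T_power_iso \<XX> k X) = (Tob \<XX> weil_W ^^ k) X \<and>
    Cod (tcat \<XX>) (T_power_iso \<XX> k X) = Tob \<XX> (weil_W_tensor k) X"
proof (induction k)
  case 0
  then show ?case using unit_iso[OF assms] by simp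
next
  case (Suc k)
  have "is_iso (tcat \<XX>) (Tar \<XX> weil_W (T_power_iso \<XX> k X))"
    using is_functor.arr_map_iso[OF T_functor[OF weil_Wn_ob]] Suc by simp
  then have "is_iso (tcat \<XX>) (T_power_iso \<XX> (Suc k) X)"
    using Suc assms mult_iso[of weil_W "weil_W_tensor k" X] by (auto intro: act.cod.iso_comp)
  then show ?case using Suc assms by simp
qed

lemma T_power_iso_natural:
  assumes f: "f \<in> Ar (tcat \<XX>)"
  shows "T_power_iso \<XX> k (Cod (tcat \<XX>) f) \<cdot>\<^bsub>tcat \<XX>\<^esub> (Tar \<XX> weil_W ^^ k) f =
    Tar \<XX> (weil_W_tensor k) f \<cdot>\<^bsub>tcat \<XX>\<^esub> T_power_iso \<XX> k (Dom (tcat \<XX>) f)"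
proof (induction k)
  case 0
  then show ?case using unit_natural[of f] f by simp
next
  case (Suc k)
  let ?C = "tcat \<XX>" and ?X = "Dom (tcat \<XX>) f" and ?Y = "Cod (tcat \<XX>) f" and ?A = "weil_W_tensor k"
  interpret P: is_functor ?C ?C "T_power \<XX> k" by (rule T_power_functor)
  have XY: "?X \<in> Ob ?C" "?Y \<in> Ob ?C" using f by simp_all
  note i = T_power_iso[OF XY(1), of k] T_power_iso[OF XY(2), of k]
  note Tf = P.arr_map_ar[OF f, simplified]
  have "act_mult \<XX> weil_W ?A ?Y \<cdot>\<^bsub>?C\<^esub> Tar \<XX> weil_W (Tar \<XX> ?A f) =
      Tar \<XX> (weil_W \<otimes>w ?A) f \<cdot>\<^bsub>?C\<^esub> act_mult \<XX> weil_W ?A ?X"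
    using mult_natural[OF Weil_Id_hom[of weil_W] Weil_Id_hom[of ?A], of f ?X ?Y] f
    by (simp add: Tar_def weil_tensor_ar_Id)
  then have "act_mult \<XX> weil_W ?A ?Y \<cdot>\<^bsub>?C\<^esub> (Tar \<XX> weil_W (Tar \<XX> ?A f) \<cdot>\<^bsub>?C\<^esub> Tar \<XX> weil_W (T_power_iso \<XX> k ?X)) =
      Tar \<XX> (weil_W \<otimes>w ?A) f \<cdot>\<^bsub>?C\<^esub> (act_mult \<XX> weil_W ?A ?X \<cdot>\<^bsub>?C\<^esub> Tar \<XX> weil_W (T_power_iso \<XX> k ?X))"
    by (rule act.cod.whisker) (use i f XY in simp_all)
  moreover have "Tar \<XX> weil_W (Tar \<XX> ?A f) \<cdot>\<^bsub>?C\<^esub> Tar \<XX> weil_W (T_power_iso \<XX> k ?X) =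
     Tar \<XX> weil_W (T_power_iso \<XX> k ?Y) \<cdot>\<^bsub>?C\<^esub> Tar \<XX> weil_W ((Tar \<XX> weil_W ^^ k) f)"
    using arg_cong[OF Suc, of "Tar \<XX> weil_W"] i f XY Tf by simp
  ultimately show ?case using i f XY Tf by simp
qed

end

context tangent_actegory
begin

text \<open>
\<open>T\<^sub>2 X\<close> is the fibre product of two copies of \<open>T X\<close>: apply the pullback axiom to the product \<open>W\<^sub>2 = W \<times> W\<close>, and replace
\<open>T\<^sub>\<nat> X\<close> by \<open>X\<close> along the unit isomorphism.
\<close>

lemma tan_p_pullback:
  assumes X: "X \<in> Ob (tcat \<XX>)"
  shows "is_pullback (tcat \<XX>) (Tnat \<XX> (weil_pr 0) X) (Tnat \<XX> (weil_pr 1) X) (tan_p \<XX> X) (tan_p \<XX> X)"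
proof -
  let ?C = "tcat \<XX>" and ?i = "inverse_ar (tcat \<XX>) (act_unit \<XX> X)"
  note i = act.cod.inverseD[OF unit_inverse[OF X]]
  have "is_pullback ?C (Tnat \<XX> (weil_pr 0) X) (Tnat \<XX> (weil_pr 1) X) (Tnat \<XX> weil_p X) (Tnat \<XX> weil_p X)"
    using tangent_product_pullback[OF weil_N_ob weil_Wn_ob weil_Wn_ob weil_W2_product X]
    by (simp only: weil_tensor_ar_unit[OF weil_pr_hom] weil_tensor_ar_unit[OF weil_p_hom] weil_p_eq_aug[symmetric])
  then show ?thesis unfolding tan_p_def
  proof (rule act.cod.pullback_mono_base)
    fix u v assume "u \<in> Ar ?C" "v \<in> Ar ?C" "Cod ?C u = Dom ?C ?i" "Cod ?C v = Dom ?C ?i" "?i \<cdot>\<^bsub>?C\<^esub> u = ?i \<cdot>\<^bsub>?C\<^esub> v"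
    then show "u = v" using act.cod.inverse_cancel(2)[OF unit_inverse[OF X]] i(3) by metis
  qed (use i Tnat_ar[OF weil_p_hom X] X in simp_all)
qed

end

section \<open>Lax differential functors\<close>

text \<open>
The universal square of a differential object lies over \<open>T pt\<close>. It can be treated like a pullback over \<open>pt\<close>
because \<open>T pt\<close> is terminal too. The two composition symbols \<open>\<bullet>\<close> and \<open>\<star>\<close> distinguish the source from the target.
\<close>

locale lax_functor_over_terminal =
  X: tangent_actegory \<XX> + Y: tangent_actegory \<YY>
  for \<XX> :: "('o, 'm) actegory" and \<YY> :: "('p, 'n) actegory" +
  fixes pt :: 'o and \<F> :: "('o, 'm, 'p, 'n) oplax"
  assumes terminal: "is_terminal (tcat \<XX>) pt"
    and T_terminal: "is_terminal (tcat \<XX>) (Tob \<XX> weil_W pt)"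
    and lax: "lax_differential_functor \<XX> pt \<YY> \<F>"
begin

abbreviation "C \<equiv> tcat \<XX>"
abbreviation "D \<equiv> tcat \<YY>"
abbreviation comp_C (infixl \<open>\<bullet>\<close> 70) where "g \<bullet> f \<equiv> g \<cdot>\<^bsub>C\<^esub> f"
abbreviation comp_D (infixl \<open>\<star>\<close> 70) where "g \<star> f \<equiv> g \<cdot>\<^bsub>D\<^esub> f"
abbreviation "Fo \<equiv> obj_map (ofun \<F>)"
abbreviation "Fa \<equiv> arr_map (ofun \<F>)"
abbreviation "\<alpha> A Z \<equiv> ocmp \<F> (A, Z)"

lemma oplax: "oplax_linear_functor \<XX> \<YY> \<F>"
  using lax by (simp add: lax_differential_functor_def Let_def)

sublocale F: is_functor C D "ofun \<F>"
  using oplax by (simp add: oplax_linear_functor_def Let_def)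

lemma cmp_ar [simp]:
  assumes "A \<in> Ob Weil" "Z \<in> Ob C"
  shows "\<alpha> A Z \<in> Ar D" "Dom D (\<alpha> A Z) = Fo (Tob \<XX> A Z)" "Cod D (\<alpha> A Z) = Tob \<YY> A (Fo Z)"
proof -
  have "\<forall>A\<in>Ob Weil. \<forall>Z\<in>Ob C. \<alpha> A Z \<in> Hom D (Fo (Tob \<XX> A Z)) (Tob \<YY> A (Fo Z))"
    using oplax unfolding oplax_linear_functor_def Let_def by (elim conjE)
  then have "\<alpha> A Z \<in> Hom D (Fo (Tob \<XX> A Z)) (Tob \<YY> A (Fo Z))" using assms by blast
  then show "\<alpha> A Z \<in> Ar D" "Dom D (\<alpha> A Z) = Fo (Tob \<XX> A Z)" "Cod D (\<alpha> A Z) = Tob \<YY> A (Fo Z)"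
    by simp_all
qed

lemma cmp_natural:
  assumes "\<theta> \<in> Hom Weil A B" "f \<in> Hom C Z Z'"
  shows "arr_map (act \<YY>) (\<theta>, Fa f) \<star> \<alpha> A Z = \<alpha> B Z' \<star> Fa (arr_map (act \<XX>) (\<theta>, f))"
proof -
  have "\<forall>A B Z Z'. \<forall>\<theta>\<in>Hom Weil A B. \<forall>f\<in>Hom C Z Z'.
    arr_map (act \<YY>) (\<theta>, Fa f) \<star> \<alpha> A Z = \<alpha> B Z' \<star> Fa (arr_map (act \<XX>) (\<theta>, f))"
    using oplax unfolding oplax_linear_functor_def Let_def by (elim conjE)
  then show ?thesis using assms by blast
qed

lemma cmp_Tar:
  assumes "A \<in> Ob Weil" "f \<in> Ar C" "Dom C f = Z" "Cod C f = Z'"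
  shows "Tar \<YY> A (Fa f) \<star> \<alpha> A Z = \<alpha> A Z' \<star> Fa (Tar \<XX> A f)"
  unfolding Tar_def by (rule cmp_natural[OF Weil_Id_hom]) (use assms in simp_all)

lemma cmp_Tnat:
  assumes "\<theta> \<in> Hom Weil A B" "Z \<in> Ob C"
  shows "Tnat \<YY> \<theta> (Fo Z) \<star> \<alpha> A Z = \<alpha> B Z \<star> Fa (Tnat \<XX> \<theta> Z)"
  using cmp_natural[OF assms(1), of "Id C Z" Z Z] assms(2) by (simp add: Tnat_def)

lemma cmp_mult:
  assumes "A \<in> Ob Weil" "B \<in> Ob Weil" "Z \<in> Ob C"
  shows "\<alpha> (A \<otimes>w B) Z \<star> Fa (act_mult \<XX> A B Z) =
    act_mult \<YY> A B (Fo Z) \<star> (Tar \<YY> A (\<alpha> B Z) \<star> \<alpha> A (Tob \<XX> B Z))"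
proof -
  have "\<forall>A\<in>Ob Weil. \<forall>B\<in>Ob Weil. \<forall>Z\<in>Ob C. \<alpha> (A \<otimes>w B) Z \<star> Fa (act_mult \<XX> A B Z) =
    act_mult \<YY> A B (Fo Z) \<star> (Tar \<YY> A (\<alpha> B Z) \<star> \<alpha> A (Tob \<XX> B Z))"
    using oplax unfolding oplax_linear_functor_def Let_def by (elim conjE)
  then show ?thesis using assms by blast
qed

lemma cmp_unit: "Z \<in> Ob C \<Longrightarrow> \<alpha> weil_N Z \<star> Fa (act_unit \<XX> Z) = act_unit \<YY> (Fo Z)"
  using oplax unfolding oplax_linear_functor_def Let_def by blast

text \<open>
A functor sends inverses to inverses; stated with a further factor for use inside right-associated composites.
\<close>

lemma Fa_inverse:
  assumes "is_inverse C f g" "x \<in> Ar D" "Cod D x = Fo (Cod C f)"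
  shows "Fa f \<star> (Fa g \<star> x) = x"
proof -
  note i = X.act.cod.inverseD[OF assms(1)]
  have "Fa f \<star> (Fa g \<star> x) = Fa (f \<bullet> g) \<star> x"
    using i(1-4) assms(2,3) by simp
  also have "\<dots> = x" using i(1,6) assms(2,3) by simp
  finally show ?thesis .
qed

text \<open>
The structure maps of the tangent category are natural transformations \<open>T\<^sub>\<theta>\<close> composed with structure
isomorphisms of the actegory. Naturality in \<open>\<theta>\<close> takes care of the former, the unit and multiplication laws of \<open>\<alpha>\<close> of the
latter.
\<close>

lemma cmp_zero:
  assumes "Z \<in> Ob C"
  shows "\<alpha> weil_W Z \<star> Fa (tan_zero \<XX> Z) = tan_zero \<YY> (Fo Z)"
proof -
  note z = X.Tnat_ar[OF weil_zero_hom assms] and z' = Y.Tnat_ar[OF weil_zero_hom F.obj_map_ob[OF assms]]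
  have "Tnat \<YY> weil_zero (Fo Z) \<star> (\<alpha> weil_N Z \<star> Fa (act_unit \<XX> Z)) =
      \<alpha> weil_W Z \<star> (Fa (Tnat \<XX> weil_zero Z) \<star> Fa (act_unit \<XX> Z))"
    by (rule Y.act.cod.whisker[OF cmp_Tnat[OF weil_zero_hom assms]]) (use z z' assms in simp_all)
  then show ?thesis using z assms by (simp add: tan_zero_def cmp_unit)
qed

lemma cmp_p:
  assumes "Z \<in> Ob C"
  shows "tan_p \<YY> (Fo Z) \<star> \<alpha> weil_W Z = Fa (tan_p \<XX> Z)"
proof -
  let ?i = "inverse_ar C (act_unit \<XX> Z)" and ?i' = "inverse_ar D (act_unit \<YY> (Fo Z))"
  note p = X.Tnat_ar[OF weil_p_hom assms] and p' = Y.Tnat_ar[OF weil_p_hom F.obj_map_ob[OF assms]]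
  have inv: "is_inverse C (act_unit \<XX> Z) ?i" "is_inverse D (act_unit \<YY> (Fo Z)) ?i'"
    using X.unit_inverse Y.unit_inverse assms by simp_all
  note i = X.act.cod.inverseD(2-4)[OF inv(1)] and i' = Y.act.cod.inverseD(2-4)[OF inv(2)]
  have "\<alpha> weil_N Z \<star> Fa (Tnat \<XX> weil_p Z) =
      \<alpha> weil_N Z \<star> (Fa (act_unit \<XX> Z) \<star> (Fa ?i \<star> Fa (Tnat \<XX> weil_p Z)))"
    using Fa_inverse[OF inv(1), of "Fa (Tnat \<XX> weil_p Z)"] p assms by simp
  also have "\<dots> = (\<alpha> weil_N Z \<star> Fa (act_unit \<XX> Z)) \<star> (Fa ?i \<star> Fa (Tnat \<XX> weil_p Z))"
    using i p assms by simp
  also have "\<dots> = act_unit \<YY> (Fo Z) \<star> (Fa ?i \<star> Fa (Tnat \<XX> weil_p Z))"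
    by (simp only: cmp_unit[OF assms])
  finally have *: "\<alpha> weil_N Z \<star> Fa (Tnat \<XX> weil_p Z) =
      act_unit \<YY> (Fo Z) \<star> (Fa ?i \<star> Fa (Tnat \<XX> weil_p Z))" .
  have "tan_p \<YY> (Fo Z) \<star> \<alpha> weil_W Z = ?i' \<star> (Tnat \<YY> weil_p (Fo Z) \<star> \<alpha> weil_W Z)"
    using i' p' assms by (simp add: tan_p_def)
  also have "\<dots> = Fa ?i \<star> Fa (Tnat \<XX> weil_p Z)"
    unfolding cmp_Tnat[OF weil_p_hom assms] *
    by (rule Y.act.cod.inverse_cancel(1)[OF inv(2)]) (use i p assms in simp_all)
  finally show ?thesis using i p assms by (simp add: tan_p_def)
qed

lemma cmp_ell:
  assumes "Z \<in> Ob C"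
  shows "tan_ell \<YY> (Fo Z) \<star> \<alpha> weil_W Z =
    Tar \<YY> weil_W (\<alpha> weil_W Z) \<star> (\<alpha> weil_W (Tob \<XX> weil_W Z) \<star> Fa (tan_ell \<XX> Z))"
proof -
  let ?W = weil_W
  let ?m = "act_mult \<XX> ?W ?W Z" and ?m' = "act_mult \<YY> ?W ?W (Fo Z)" and ?W2 = "?W \<otimes>w ?W"
  let ?i = "inverse_ar C ?m" and ?i' = "inverse_ar D ?m'" and ?e = "Fa (Tnat \<XX> weil_ell Z)"
  let ?k = "Tar \<YY> ?W (\<alpha> ?W Z) \<star> \<alpha> ?W (Tob \<XX> ?W Z)"
  note p = X.Tnat_ar[OF weil_ell_hom assms] and p' = Y.Tnat_ar[OF weil_ell_hom F.obj_map_ob[OF assms]]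
  have inv: "is_inverse C ?m ?i" "is_inverse D ?m' ?i'"
    using X.mult_inverse Y.mult_inverse assms by simp_all
  note i = X.act.cod.inverseD(2-4)[OF inv(1)] and i' = Y.act.cod.inverseD(2-4)[OF inv(2)]
  have "\<alpha> ?W2 Z \<star> ?e = \<alpha> ?W2 Z \<star> (Fa ?m \<star> (Fa ?i \<star> ?e))"
    using Fa_inverse[OF inv(1), of ?e] p assms by simp
  also have "\<dots> = (\<alpha> ?W2 Z \<star> Fa ?m) \<star> (Fa ?i \<star> ?e)"
    using i p assms by simp
  also have "\<dots> = (?m' \<star> ?k) \<star> (Fa ?i \<star> ?e)"
    by (simp only: cmp_mult[OF weil_Wn_ob weil_Wn_ob assms])
  also have "\<dots> = ?m' \<star> (?k \<star> (Fa ?i \<star> ?e))"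
    using i p assms by simp
  finally have *: "\<alpha> ?W2 Z \<star> ?e = ?m' \<star> (?k \<star> (Fa ?i \<star> ?e))" .
  have "tan_ell \<YY> (Fo Z) \<star> \<alpha> ?W Z = ?i' \<star> (Tnat \<YY> weil_ell (Fo Z) \<star> \<alpha> ?W Z)"
    using i' p' assms by (simp add: tan_ell_def)
  also have "\<dots> = ?k \<star> (Fa ?i \<star> ?e)"
    unfolding cmp_Tnat[OF weil_ell_hom assms] *
    by (rule Y.act.cod.inverse_cancel(1)[OF inv(2)]) (use i p assms in simp_all)
  finally show ?thesis using i p assms by (simp add: tan_ell_def)
qed

lemma preserves_Tar:
  assumes "A \<in> Ob Weil" "is_pullback C t l r b" "Cod C r = pt"
  shows "is_pullback D (Tar \<YY> A (Fa t)) (Tar \<YY> A (Fa l)) (Tar \<YY> A (Fa r)) (Tar \<YY> A (Fa b))"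
proof -
  have "\<forall>A \<in> Ob Weil. \<forall>t l r b. is_pullback C t l r b \<and> Cod C r = pt \<longrightarrow>
        is_pullback D (Tar \<YY> A (Fa t)) (Tar \<YY> A (Fa l)) (Tar \<YY> A (Fa r)) (Tar \<YY> A (Fa b))"
    using lax unfolding lax_differential_functor_def Let_def by (elim conjE)
  then show ?thesis using assms by blast
qed

lemma cmp_pullback:
  assumes "A \<in> Ob Weil" "f \<in> Ar C" "Dom C f = Z" "Cod C f = Z'"
  shows "is_pullback D (\<alpha> A Z) (Fa (Tar \<XX> A f)) (Tar \<YY> A (Fa f)) (\<alpha> A Z')"
proof -
  have "\<forall>A \<in> Ob Weil. \<forall>Z Z'. \<forall>f \<in> Hom C Z Z'.
        is_pullback D (\<alpha> A Z) (Fa (Tar \<XX> A f)) (Tar \<YY> A (Fa f)) (\<alpha> A Z')"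
    using lax unfolding lax_differential_functor_def Let_def by (elim conjE)
  moreover have "f \<in> Hom C Z Z'" using assms by simp
  ultimately show ?thesis using assms(1) by blast
qed

text \<open>
The definition of a lax differential functor only speaks about \<open>T'\<^sub>B\<close>; the iterates of \<open>T'\<close> are covered since
\<open>T'\<^sup>k\<close> is naturally isomorphic to \<open>T'\<^sub>B\<close> for \<open>B = W\<^bsup>\<otimes>k\<^esup>\<close>. The case \<open>k = 0\<close> says that \<open>F\<close> itself preserves
pullbacks over the terminal object.
\<close>

lemma preserves_T_power:
  assumes P: "is_pullback C t l r b" and "Cod C r = pt"
  shows "is_pullback D ((Tar \<YY> weil_W ^^ k) (Fa t)) ((Tar \<YY> weil_W ^^ k) (Fa l))
    ((Tar \<YY> weil_W ^^ k) (Fa r)) ((Tar \<YY> weil_W ^^ k) (Fa b))"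
proof -
  interpret T: is_functor D D "T_power \<YY> k" by (rule Y.T_power_functor)
  let ?A = "weil_W_tensor k" and ?T = "Tar \<YY> weil_W ^^ k" and ?k = "\<lambda>Z. T_power_iso \<YY> k (Fo Z)"
  note p = X.act.cod.pullbackD[OF P]
  note T = T.arr_map_ar[simplified]
  have "Fa r \<star> Fa t = Fa b \<star> Fa l"
    using arg_cong[OF p(9), of Fa] p(1-8) by simp
  then have comm: "?T (Fa r) \<star> ?T (Fa t) = ?T (Fa b) \<star> ?T (Fa l)"
    using T.arr_map_comp_ar[of "Fa t" "Fa r"] T.arr_map_comp_ar[of "Fa l" "Fa b"] p(1-8) by simp
  have nat: "?k (Cod C f) \<star> ?T (Fa f) = Tar \<YY> ?A (Fa f) \<star> ?k (Dom C f)" if "f \<in> Ar C" for f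
    using Y.T_power_iso_natural[of "Fa f" k] that by simp
  have k: "is_iso D (?k Z)" "?k Z \<in> Ar D" "Dom D (?k Z) = (Tob \<YY> weil_W ^^ k) (Fo Z)"
    "Cod D (?k Z) = Tob \<YY> ?A (Fo Z)" if "Z \<in> Ob C" for Z
    using Y.T_power_iso[of "Fo Z" k] that by simp_all
  have ob: "Dom C t \<in> Ob C" "Dom C r \<in> Ob C" "Dom C b \<in> Ob C" "Cod C r \<in> Ob C" using p by simp_all
  show ?thesis
  proof (rule Y.act.cod.pullback_iso_square[OF preserves_Tar[OF weil_W_tensor_ob assms]])
    show "is_iso D (?k (Dom C t))" "is_iso D (?k (Dom C r))" "is_iso D (?k (Dom C b))" "is_iso D (?k (Cod C r))"
      using k ob by blast+
    show "?k (Dom C r) \<star> ?T (Fa t) = Tar \<YY> ?A (Fa t) \<star> ?k (Dom C t)"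
      "?k (Dom C b) \<star> ?T (Fa l) = Tar \<YY> ?A (Fa l) \<star> ?k (Dom C t)"
      "?k (Cod C r) \<star> ?T (Fa r) = Tar \<YY> ?A (Fa r) \<star> ?k (Dom C r)"
      "?k (Cod C r) \<star> ?T (Fa b) = Tar \<YY> ?A (Fa b) \<star> ?k (Dom C b)"
      using nat[of t] nat[of l] nat[of r] nat[of b] p(1-8) by simp_all
  qed (use comm T k ob p(1-8) in simp_all)
qed

definition TF :: "nat \<Rightarrow> ('o, 'm, 'p, 'n) fctr" where
  "TF k = \<lparr>obj_map = \<lambda>Z. (Tob \<YY> weil_W ^^ k) (Fo Z), arr_map = \<lambda>f. (Tar \<YY> weil_W ^^ k) (Fa f)\<rparr>"

lemma TF_simps [simp]: "obj_map (TF k) Z = (Tob \<YY> weil_W ^^ k) (Fo Z)"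
  "arr_map (TF k) f = (Tar \<YY> weil_W ^^ k) (Fa f)"
  by (simp_all add: TF_def)

lemma TF_functor: "is_functor C D (TF k)"
proof -
  interpret T: is_functor D D "T_power \<YY> k" by (rule Y.T_power_functor)
  show ?thesis
    by unfold_locales
      (use T.obj_map_ob T.arr_map_ar T.arr_map_id T.arr_map_comp_ar in simp_all)
qed

lemma preserves_powers_T:
  assumes q: "Cod C q = pt" "\<And>n. \<exists>r \<pi>. is_pullback_power C q n r \<pi>"
    and "is_pullback_power C q n r \<pi>"
  shows "is_pullback_power D ((Tar \<YY> weil_W ^^ k) (Fa q)) n ((Tar \<YY> weil_W ^^ k) (Fa r))
    (\<lambda>i. (Tar \<YY> weil_W ^^ k) (Fa (\<pi> i)))"
proof -
  interpret T: is_functor C D "TF k" by (rule TF_functor)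
  have "T.preserves_pullbacks_over (Cod C q)"
    unfolding T.preserves_pullbacks_over_def q(1) using preserves_T_power by simp
  from T.preserves_powers[OF this q(2) assms(3)] show ?thesis by simp
qed

text \<open>
Terminal objects are isomorphic, so a pullback over any of them can be moved over \<open>pt\<close> before applying the
functor, and back afterwards.
\<close>

lemma preserves_over_terminal:
  assumes P: "is_pullback C t l r b" and Z: "is_terminal C (Cod C r)"
  shows "is_pullback D (Fa t) (Fa l) (Fa r) (Fa b)"
proof -
  note p = X.act.cod.pullbackD[OF P]
  have "Cod C r \<in> Ob C" using p by simp
  \<comment> \<open>maps into the terminal object \<open>Cod r\<close> are equal, so \<open>i\<close> is trivially a monomorphism\<close>
  then obtain i where i: "i \<in> Ar C" "Dom C i = Cod C r" "Cod C i = pt"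
    using terminal unfolding is_terminal_def by (auto dest!: bspec)
  have "is_pullback C t l (i \<bullet> r) (i \<bullet> b)"
    by (rule X.act.cod.pullback_mono_base[OF P])
      (use i X.act.cod.terminal_unique[OF Z] in simp_all)
  then have "is_pullback D (Fa t) (Fa l) (Fa (i \<bullet> r)) (Fa (i \<bullet> b))"
    using preserves_T_power[of t l "i \<bullet> r" "i \<bullet> b" 0] i p by simp
  then have *: "is_pullback D (Fa t) (Fa l) (Fa i \<star> Fa r) (Fa i \<star> Fa b)"
    using i p by simp
  have comm: "Fa r \<star> Fa t = Fa b \<star> Fa l"
    using arg_cong[OF p(9), of Fa] p(1-8) by simp
  show ?thesis
    by (rule Y.act.cod.pullback_reduce_base[OF *]) (use i p(1-8) comm in simp_all)
qed

end

section \<open>The image of a differential object\<close>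

context category
begin

lemma additive_bundleD:
  assumes "additive_bundle C B"
  shows "bproj B \<in> Hom C (btot B) (bbase B)" "\<exists>r \<pi>. is_pullback_power C (bproj B) n r \<pi>"
    "is_pullback C (bpi0 B) (bpi1 B) (bproj B) (bproj B)"
    "bplus B \<in> Hom C (Dom C (bpi0 B)) (btot B)" "bzero B \<in> Hom C (bbase B) (btot B)"
    "bproj B \<cdot> bplus B = bproj B \<cdot> bpi0 B" "bproj B \<cdot> bplus B = bproj B \<cdot> bpi1 B"
    "bproj B \<cdot> bzero B = Id C (bbase B)"
    "is_pullback_power C (bproj B) 3 r \<pi> \<Longrightarrow>
      bplus B \<cdot> pairing C (bpi0 B) (bpi1 B)
        (bplus B \<cdot> pairing C (bpi0 B) (bpi1 B) (\<pi> 0) (\<pi> 1)) (\<pi> 2) =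
      bplus B \<cdot> pairing C (bpi0 B) (bpi1 B)
        (\<pi> 0) (bplus B \<cdot> pairing C (bpi0 B) (bpi1 B) (\<pi> 1) (\<pi> 2))"
    "bplus B \<cdot> pairing C (bpi0 B) (bpi1 B) (bpi1 B) (bpi0 B) = bplus B"
    "bplus B \<cdot> pairing C (bpi0 B) (bpi1 B) (Id C (btot B)) (bzero B \<cdot> bproj B) = Id C (btot B)"
  using assms unfolding additive_bundle_def by blast+

end

text \<open>
The abbreviations for the differential object \<open>B\<close> whose image is studied follow the mathematical notation: \<open>E\<close> is the total object, \<open>q\<close>, \<open>z\<close>, \<open>s\<close> and \<open>lift\<close> are the structure maps, and \<open>p0\<close>, \<open>p1\<close> are
the projections of the chosen fibre product.
\<close>

locale evaluated_differential_object = lax_functor_over_terminal +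
  fixes B :: "('a, 'b) dbun"
  assumes dbun: "differential_bundle \<XX> B" and base: "bbase B = pt"
begin

abbreviation "E \<equiv> btot B"
abbreviation "q \<equiv> bproj B"
abbreviation "p0 \<equiv> bpi0 B"
abbreviation "p1 \<equiv> bpi1 B"
abbreviation "z \<equiv> bzero B"
abbreviation "s \<equiv> bplus B"
abbreviation "lift \<equiv> blift B"
abbreviation "T f \<equiv> Tar \<XX> weil_W f"
abbreviation "T' f \<equiv> Tar \<YY> weil_W f"

lemma add_bundle: "additive_bundle C B"
  using dbun by (simp add: differential_bundle_def Let_def)

lemmas ab = X.act.cod.additive_bundleD[OF add_bundle, unfolded base]

lemma bundle_ar [simp]:
  "q \<in> Ar C" "Dom C q = E" "Cod C q = pt" "p0 \<in> Ar C" "p1 \<in> Ar C" "Dom C p1 = Dom C p0"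
  "Cod C p0 = E" "Cod C p1 = E" "z \<in> Ar C" "Dom C z = pt" "Cod C z = E"
  "s \<in> Ar C" "Dom C s = Dom C p0" "Cod C s = E"
  using ab(1,4,5) X.act.cod.pullbackD[OF ab(3)] by simp_all

lemma E_ob [simp]: "E \<in> Ob C" and pt_ob [simp]: "pt \<in> Ob C" and P_ob [simp]: "Dom C p0 \<in> Ob C"
  using X.act.cod.dom_ob[of q] X.act.cod.cod_ob[of q] X.act.cod.dom_ob[of p0] by simp_all

lemma q_sides: "q \<bullet> p1 = q \<bullet> p0" "q \<bullet> s = q \<bullet> p0"
  using ab(6,7) by simp_all

lemma power_T:
  assumes "is_pullback_power C q n r \<pi>"
  shows "is_pullback_power C ((Tar \<XX> weil_W ^^ k) q) n ((Tar \<XX> weil_W ^^ k) r) (\<lambda>i. (Tar \<XX> weil_W ^^ k) (\<pi> i))"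
  using dbun assms unfolding differential_bundle_def Let_def by blast

text \<open>
Preservation of the chosen fibre product by \<open>T\<close> is the case \<open>k = 1\<close>, \<open>n = 2\<close> of the preservation of powers.
\<close>

lemma pullback_T: "is_pullback C (T p0) (T p1) (T q) (T q)"
proof -
  have "is_pullback_power C (T q) 2 (T (q \<bullet> p0)) (\<lambda>i. T (if i = 0 then p0 else p1))"
    using power_T[OF X.act.cod.power_2_of_pullback[OF ab(3)], of 1] by (simp add: One_nat_def)
  from X.act.cod.pullback_of_power_2[OF this] show ?thesis by simp
qed

lemma lift_add:
  "additive_morphism C B (T_bundle \<XX> B) lift (tan_zero \<XX> pt)"
  "additive_morphism C B (tangent_bundle \<XX> E) lift z"
  using dbun unfolding differential_bundle_def Let_def base by blast+

lemma lift_ar [simp]: "lift \<in> Ar C" "Dom C lift = E" "Cod C lift = Tob \<XX> weil_W E"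
  using lift_add(1) by (simp_all add: additive_morphism_def bundle_morphism_def T_bundle_def)

lemma lift_T:
  "T q \<bullet> lift = tan_zero \<XX> pt \<bullet> q"
  "lift \<bullet> s = T s \<bullet> pairing C (T p0) (T p1) (lift \<bullet> p0) (lift \<bullet> p1)"
  "lift \<bullet> z = T z \<bullet> tan_zero \<XX> pt"
  using lift_add(1) by (simp_all add: additive_morphism_def bundle_morphism_def T_bundle_def base)

lemma lift_tangent:
  "tan_p \<XX> E \<bullet> lift = z \<bullet> q"
  "lift \<bullet> s = Tnat \<XX> weil_plus E \<bullet>
    pairing C (Tnat \<XX> (weil_pr 0) E) (Tnat \<XX> (weil_pr 1) E) (lift \<bullet> p0) (lift \<bullet> p1)"
  "lift \<bullet> z = tan_zero \<XX> E \<bullet> z"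
  using lift_add(2) by (simp_all add: additive_morphism_def bundle_morphism_def tangent_bundle_def base)

lemma lift_ell: "tan_ell \<XX> E \<bullet> lift = T lift \<bullet> lift"
  using dbun unfolding differential_bundle_def Let_def by blast

lemma universal:
  "is_pullback C (T s \<bullet> pairing C (T p0) (T p1) (lift \<bullet> p0) (tan_zero \<XX> E \<bullet> p1))
    (q \<bullet> p0) (T q) (tan_zero \<XX> pt)"
  using dbun unfolding differential_bundle_def Let_def base by blast

lemma pullback_F: "is_pullback D (Fa p0) (Fa p1) (Fa q) (Fa q)"
  using preserves_T_power[OF ab(3), of 0] by simp

lemma pullback_TF: "is_pullback D (T' (Fa p0)) (T' (Fa p1)) (T' (Fa q)) (T' (Fa q))"
  by (rule preserves_Tar[OF weil_Wn_ob ab(3)]) simp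

lemma F_pairing:
  assumes "x \<in> Ar C" "y \<in> Ar C" "Dom C x = Dom C y" "Cod C x = E" "Cod C y = E" "q \<bullet> x = q \<bullet> y"
  shows "pairing D (Fa p0) (Fa p1) (Fa x) (Fa y) = Fa (pairing C p0 p1 x y)"
proof -
  note h = X.act.cod.pairing[OF ab(3), of x y, simplified bundle_ar, OF assms]
  show ?thesis
    by (rule Y.act.cod.pairing_eqI[OF pullback_F])
      (use h(1-3) arg_cong[OF h(4), of Fa] arg_cong[OF h(5), of Fa] in simp_all)
qed

text \<open>
Existence of the powers and the pullback square are preserved by the functor. The equations are preserved because
pairings are; associativity, which is required of every third power in the target, holds on the image of a third
power in the source and is then transported along the comparison isomorphism \<open>u\<close>.
\<close>

lemma additive_image: "additive_bundle D (eval_bundle \<YY> B \<F>)"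
proof -
  have pw: "is_pullback_power D (Fa q) n (Fa r) (\<lambda>i. Fa (\<pi> i))" if "is_pullback_power C q n r \<pi>" for n r \<pi>
    using preserves_powers_T[OF bundle_ar(3) ab(2) that, of 0] by simp
  have assoc: "Fa s \<star> pairing D (Fa p0) (Fa p1)
        (Fa s \<star> pairing D (Fa p0) (Fa p1) (\<rho> 0) (\<rho> 1)) (\<rho> 2) =
      Fa s \<star> pairing D (Fa p0) (Fa p1)
        (\<rho> 0) (Fa s \<star> pairing D (Fa p0) (Fa p1) (\<rho> 1) (\<rho> 2))"
    if R: "is_pullback_power D (Fa q) 3 r' \<rho>" for r' \<rho>
  proof -
    obtain r \<pi> where P: "is_pullback_power C q 3 r \<pi>" using ab(2) by blast
    note p = X.act.cod.powerD[OF P]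
    have pi: "\<pi> i \<in> Ar C" "Dom C (\<pi> i) = Dom C r" "Cod C (\<pi> i) = E" "q \<bullet> \<pi> i = r" if "i < 3" for i
      using p(4-7)[OF that] by simp_all
    note pis = pi[of 0, simplified] pi[of 1, simplified] pi[of 2, simplified]
    \<comment> \<open>the comparison of the given power with the image of a power in the source\<close>
    obtain u where u: "u \<in> Ar D" "Dom D u = Dom D r'" "Cod D u = Fo (Dom C r)"
      "\<And>i. i < 3 \<Longrightarrow> Fa (\<pi> i) \<star> u = \<rho> i"
      using Y.act.cod.power_compare[OF R pw[OF P]] p(2) by (metis F.arr_map_ar(2))
    have rho: "\<rho> 0 = Fa (\<pi> 0) \<star> u" "\<rho> 1 = Fa (\<pi> 1) \<star> u" "\<rho> 2 = Fa (\<pi> 2) \<star> u"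
      using u(4) by simp_all
    have pair: "pairing D (Fa p0) (Fa p1) (Fa x \<star> u) (Fa y \<star> u) = Fa (pairing C p0 p1 x y) \<star> u"
      if xy: "x \<in> Ar C" "y \<in> Ar C" "Dom C x = Dom C r" "Dom C y = Dom C r" "Cod C x = E" "Cod C y = E"
        "q \<bullet> x = r" "q \<bullet> y = r" for x y
    proof -
      have "Fa q \<star> Fa x = Fa q \<star> Fa y"
        using F.arr_map_comp_ar[of x q] F.arr_map_comp_ar[of y q] xy by simp
      then have "pairing D (Fa p0) (Fa p1) (Fa x \<star> u) (Fa y \<star> u) = pairing D (Fa p0) (Fa p1) (Fa x) (Fa y) \<star> u"
        using xy(1-6) u(1-3) by (intro Y.act.cod.pairing_comp[OF pullback_F]) simp_all
      then show ?thesis using F_pairing[of x y] xy by simp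
    qed
    have sum: "s \<bullet> pairing C p0 p1 x y \<in> Ar C" "Dom C (s \<bullet> pairing C p0 p1 x y) = Dom C r"
        "Cod C (s \<bullet> pairing C p0 p1 x y) = E" "q \<bullet> (s \<bullet> pairing C p0 p1 x y) = r"
        "pairing C p0 p1 x y \<in> Ar C" "Dom C (pairing C p0 p1 x y) = Dom C r" "Cod C (pairing C p0 p1 x y) = Dom C p0"
      if xy: "x \<in> Ar C" "y \<in> Ar C" "Dom C x = Dom C r" "Dom C y = Dom C r" "Cod C x = E" "Cod C y = E"
        "q \<bullet> x = r" "q \<bullet> y = r" for x y
    proof -
      have h: "pairing C p0 p1 x y \<in> Ar C" "Dom C (pairing C p0 p1 x y) = Dom C r"
        "Cod C (pairing C p0 p1 x y) = Dom C p0" "p0 \<bullet> pairing C p0 p1 x y = x"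
        using X.act.cod.pairing[OF ab(3), of x y] xy by simp_all
      have "q \<bullet> (s \<bullet> pairing C p0 p1 x y) = q \<bullet> (p0 \<bullet> pairing C p0 p1 x y)"
        by (rule X.act.cod.whisker[OF q_sides(2)]) (use h in simp_all)
      then show "q \<bullet> (s \<bullet> pairing C p0 p1 x y) = r" using h(4) xy(7) by simp
    qed (use X.act.cod.pairing[OF ab(3), of x y] xy in simp_all)
    let ?a = "pairing C p0 p1 (\<pi> 0) (\<pi> 1)" and ?b = "pairing C p0 p1 (\<pi> 1) (\<pi> 2)"
    note a = sum[of "\<pi> 0" "\<pi> 1", OF pis(1,5) pis(2,6) pis(3,7) pis(4,8)]
    note b = sum[of "\<pi> 1" "\<pi> 2", OF pis(5,9) pis(6,10) pis(7,11) pis(8,12)]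
    let ?l = "pairing C p0 p1 (s \<bullet> ?a) (\<pi> 2)" and ?r = "pairing C p0 p1 (\<pi> 0) (s \<bullet> ?b)"
    note l = sum(5-7)[of "s \<bullet> ?a" "\<pi> 2", OF a(1) pis(9) a(2) pis(10) a(3) pis(11) a(4) pis(12)]
    note r = sum(5-7)[of "\<pi> 0" "s \<bullet> ?b", OF pis(1) b(1) pis(2) b(2) pis(3) b(3) pis(4) b(4)]
    have ua: "Fa s \<star> (Fa ?a \<star> u) = Fa (s \<bullet> ?a) \<star> u"
      and ub: "Fa s \<star> (Fa ?b \<star> u) = Fa (s \<bullet> ?b) \<star> u"
      and ul: "Fa s \<star> (Fa ?l \<star> u) = Fa (s \<bullet> ?l) \<star> u"
      and ur: "Fa s \<star> (Fa ?r \<star> u) = Fa (s \<bullet> ?r) \<star> u"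
      using a(5-7) b(5-7) l r u(1-3) by simp_all
    have "Fa s \<star> pairing D (Fa p0) (Fa p1)
        (Fa s \<star> pairing D (Fa p0) (Fa p1) (\<rho> 0) (\<rho> 1)) (\<rho> 2) = Fa (s \<bullet> ?l) \<star> u"
      unfolding rho pair[of "\<pi> 0" "\<pi> 1", OF pis(1,5) pis(2,6) pis(3,7) pis(4,8)] ua
        pair[of "s \<bullet> ?a" "\<pi> 2", OF a(1) pis(9) a(2) pis(10) a(3) pis(11) a(4) pis(12)] ul ..
    moreover have "Fa s \<star> pairing D (Fa p0) (Fa p1)
        (\<rho> 0) (Fa s \<star> pairing D (Fa p0) (Fa p1) (\<rho> 1) (\<rho> 2)) = Fa (s \<bullet> ?r) \<star> u"
      unfolding rho pair[of "\<pi> 1" "\<pi> 2", OF pis(5,9) pis(6,10) pis(7,11) pis(8,12)] ub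
        pair[of "\<pi> 0" "s \<bullet> ?b", OF pis(1) b(1) pis(2) b(2) pis(3) b(3) pis(4) b(4)] ur ..
    ultimately show ?thesis using ab(9)[OF P] by simp
  qed
  have comm: "Fa s \<star> pairing D (Fa p0) (Fa p1) (Fa p1) (Fa p0) = Fa s"
  proof -
    have h: "pairing C p0 p1 p1 p0 \<in> Ar C" "Cod C (pairing C p0 p1 p1 p0) = Dom C p0"
      using X.act.cod.pairing[OF ab(3), of p1 p0] q_sides by simp_all
    show ?thesis using F_pairing[of p1 p0] q_sides h arg_cong[OF ab(10), of Fa] by simp
  qed
  have unit: "Fa s \<star> pairing D (Fa p0) (Fa p1) (Id D (Fo E)) (Fa z \<star> Fa q) = Id D (Fo E)"
  proof -
    have e: "q \<bullet> Id C E = q \<bullet> (z \<bullet> q)"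
      using X.act.cod.comp_assoc_ar[of q z q] ab(8) by simp
    have h: "pairing C p0 p1 (Id C E) (z \<bullet> q) \<in> Ar C" "Cod C (pairing C p0 p1 (Id C E) (z \<bullet> q)) = Dom C p0"
      using X.act.cod.pairing[OF ab(3) _ _ _ _ _ e] by simp_all
    show ?thesis using F_pairing[of "Id C E" "z \<bullet> q"] e h arg_cong[OF ab(11), of Fa] by simp
  qed
  have ex: "\<exists>r \<pi>. is_pullback_power D (Fa q) n r \<pi>" for n
    using ab(2)[of n] pw by blast
  have eqs: "Fa q \<star> Fa s = Fa q \<star> Fa p0" "Fa q \<star> Fa s = Fa q \<star> Fa p1" "Fa q \<star> Fa z = Id D (Fo pt)"
    using arg_cong[OF ab(6), of Fa] arg_cong[OF ab(7), of Fa] arg_cong[OF ab(8), of Fa] by simp_all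
  show ?thesis
    unfolding additive_bundle_def
    using ex assoc comm unit eqs pullback_F by (simp add: eval_bundle_def Let_def base)
qed

text \<open>
An arbitrary power of the image of \<open>q\<close> is isomorphic to the image of a power of \<open>q\<close>, and the latter is preserved by the
iterates of the tangent functor.
\<close>

lemma powers_image:
  assumes R: "is_pullback_power D (Fa q) n r' \<rho>"
  shows "is_pullback_power D ((Tar \<YY> weil_W ^^ k) (Fa q)) n ((Tar \<YY> weil_W ^^ k) r') (\<lambda>i. (Tar \<YY> weil_W ^^ k) (\<rho> i))"
proof -
  interpret T: is_functor D D "T_power \<YY> k" by (rule Y.T_power_functor)
  obtain r \<pi> where P: "is_pullback_power C q n r \<pi>" using ab(2) by blast
  note p = X.act.cod.powerD[OF P]
  have P0: "is_pullback_power D (Fa q) n (Fa r) (\<lambda>i. Fa (\<pi> i))"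
    using preserves_powers_T[OF bundle_ar(3) ab(2) P, of 0] by simp
  note p0 = Y.act.cod.powerD[OF P0]
  have Pk: "is_pullback_power D ((Tar \<YY> weil_W ^^ k) (Fa q)) n ((Tar \<YY> weil_W ^^ k) (Fa r)) (\<lambda>i. (Tar \<YY> weil_W ^^ k) (Fa (\<pi> i)))"
    by (rule preserves_powers_T[OF bundle_ar(3) ab(2) P])
  obtain u where u: "is_iso D u" "u \<in> Ar D" "Dom D u = Dom D r'" "Cod D u = Dom D (Fa r)" "Fa r \<star> u = r'"
      "\<And>i. i < n \<Longrightarrow> Fa (\<pi> i) \<star> u = \<rho> i"
    using Y.act.cod.power_compare[OF R P0] by blast
  note Tc = T.arr_map_comp_ar[simplified] and Ta = T.arr_map_ar[simplified]
  have "is_pullback_power D ((Tar \<YY> weil_W ^^ k) (Fa q)) n ((Tar \<YY> weil_W ^^ k) (Fa r) \<star> (Tar \<YY> weil_W ^^ k) u)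
      (\<lambda>i. (Tar \<YY> weil_W ^^ k) (Fa (\<pi> i)) \<star> (Tar \<YY> weil_W ^^ k) u)"
    using T.arr_map_iso[OF u(1)] u(2-4) p0(2) by (intro Y.act.cod.power_precomp_iso[OF Pk]) (simp_all add: Ta)
  then have "is_pullback_power D ((Tar \<YY> weil_W ^^ k) (Fa q)) n ((Tar \<YY> weil_W ^^ k) r')
      (\<lambda>i. (Tar \<YY> weil_W ^^ k) (Fa (\<pi> i)) \<star> (Tar \<YY> weil_W ^^ k) u)"
    using Tc[of u "Fa r"] u(2-5) p0(2) by simp
  then show ?thesis
  proof (rule Y.act.cod.power_cong)
    fix i assume i: "i < n"
    show "(Tar \<YY> weil_W ^^ k) (\<rho> i) = (Tar \<YY> weil_W ^^ k) (Fa (\<pi> i)) \<star> (Tar \<YY> weil_W ^^ k) u"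
      using Tc[of u "Fa (\<pi> i)"] u(2,4) u(6)[OF i] p(4,5)[OF i] p(2) by simp
  qed
qed

abbreviation "lift' \<equiv> \<alpha> weil_W E \<star> Fa lift"

text \<open>
Additions computed in the \<open>T\<close>-image of the bundle are intertwined by \<open>\<alpha>\<close>. This is used for additivity of the new lift as well
as for identifying the top edge of its universal square.
\<close>

lemma cmp_pairing_T:
  assumes xy: "x \<in> Ar C" "y \<in> Ar C" "Dom C x = Dom C y" "Cod C x = Tob \<XX> weil_W E" "Cod C y = Tob \<XX> weil_W E"
    "T q \<bullet> x = T q \<bullet> y"
  shows "T' (Fa s) \<star> pairing D (T' (Fa p0)) (T' (Fa p1)) (\<alpha> weil_W E \<star> Fa x) (\<alpha> weil_W E \<star> Fa y) =
    \<alpha> weil_W E \<star> Fa (T s \<bullet> pairing C (T p0) (T p1) x y)"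
proof -
  let ?h = "pairing C (T p0) (T p1) x y" and ?P = "Dom C p0"
  have h: "?h \<in> Ar C" "Dom C ?h = Dom C x" "Cod C ?h = Tob \<XX> weil_W ?P" "T p0 \<bullet> ?h = x" "T p1 \<bullet> ?h = y"
    using X.act.cod.pairing[OF pullback_T, of x y] xy by simp_all
  have cmp: "T' (Fa f) \<star> (\<alpha> weil_W ?P \<star> Fa ?h) = \<alpha> weil_W E \<star> Fa (T f \<bullet> ?h)"
    if "f \<in> Ar C" "Dom C f = ?P" "Cod C f = E" for f
  proof -
    have "T' (Fa f) \<star> (\<alpha> weil_W ?P \<star> Fa ?h) = \<alpha> weil_W E \<star> (Fa (T f) \<star> Fa ?h)"
      by (rule Y.act.cod.whisker[OF cmp_Tar[OF weil_Wn_ob that]]) (use that h(1-3) in simp_all)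
    then show ?thesis using that h(1-3) by simp
  qed
  have "pairing D (T' (Fa p0)) (T' (Fa p1)) (\<alpha> weil_W E \<star> Fa x) (\<alpha> weil_W E \<star> Fa y) = \<alpha> weil_W ?P \<star> Fa ?h"
    by (rule Y.act.cod.pairing_eqI[OF pullback_TF])
      (use h(1-3) cmp[of p0, unfolded h(4)] cmp[of p1, unfolded h(5)] in simp_all)
  then show ?thesis using cmp[of s] by simp
qed

lemma q_lift:
  assumes "f \<in> Ar C" "Cod C f = E"
  shows "T q \<bullet> (lift \<bullet> f) = tan_zero \<XX> pt \<bullet> (q \<bullet> f)"
  by (rule X.act.cod.whisker[OF lift_T(1)]) (use assms in simp_all)

lemma q_zero:
  assumes "f \<in> Ar C" "Cod C f = E"
  shows "T q \<bullet> (tan_zero \<XX> E \<bullet> f) = tan_zero \<XX> pt \<bullet> (q \<bullet> f)"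
  by (rule X.act.cod.whisker) (use assms X.tan_zero_natural[of q] in simp_all)

lemma additive_T_image:
  "additive_morphism D (eval_bundle \<YY> B \<F>) (T_bundle \<YY> (eval_bundle \<YY> B \<F>)) lift' (tan_zero \<YY> (Fo pt))"
proof -
  have "T' (Fa q) \<star> lift' = \<alpha> weil_W pt \<star> (Fa (T q) \<star> Fa lift)"
    by (rule Y.act.cod.whisker[OF cmp_Tar]) simp_all
  also have "Fa (T q) \<star> Fa lift = Fa (tan_zero \<XX> pt) \<star> Fa q"
    using arg_cong[OF lift_T(1), of Fa] by simp
  also have "\<alpha> weil_W pt \<star> (Fa (tan_zero \<XX> pt) \<star> Fa q) = tan_zero \<YY> (Fo pt) \<star> Fa q"
    unfolding cmp_zero[OF pt_ob, symmetric] by simp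
  finally have proj: "T' (Fa q) \<star> lift' = tan_zero \<YY> (Fo pt) \<star> Fa q" .
  have "lift' \<star> Fa z = \<alpha> weil_W E \<star> (Fa (T z) \<star> Fa (tan_zero \<XX> pt))"
    using arg_cong[OF lift_T(3), of Fa] by simp
  also have "\<dots> = T' (Fa z) \<star> (\<alpha> weil_W pt \<star> Fa (tan_zero \<XX> pt))"
    by (rule Y.act.cod.whisker[OF cmp_Tar[symmetric]]) simp_all
  finally have zero: "lift' \<star> Fa z = T' (Fa z) \<star> tan_zero \<YY> (Fo pt)"
    by (simp only: cmp_zero[OF pt_ob])
  have plus: "lift' \<star> Fa s = T' (Fa s) \<star>
      pairing D (T' (Fa p0)) (T' (Fa p1)) (lift' \<star> Fa p0) (lift' \<star> Fa p1)"
    using cmp_pairing_T[of "lift \<bullet> p0" "lift \<bullet> p1", unfolded lift_T(2)[symmetric]]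
    by (simp add: q_lift q_sides)
  show ?thesis using proj zero plus
    by (simp add: additive_morphism_def bundle_morphism_def T_bundle_def eval_bundle_def Let_def base)
qed

text \<open>
Besides naturality of \<open>\<alpha>\<close>, this rests on the fact that a map into \<open>T\<^sub>2\<close> is determined by its two
components: both sides of the condition on the sum factor through \<open>T\<^sub>2\<close> of the respective total object.
\<close>

lemma additive_tangent_image:
  "additive_morphism D (eval_bundle \<YY> B \<F>) (tangent_bundle \<YY> (Fo E)) lift' (Fa z)"
proof -
  let ?W2 = "weil_Wn 2"
  have "tan_p \<YY> (Fo E) \<star> lift' = (tan_p \<YY> (Fo E) \<star> \<alpha> weil_W E) \<star> Fa lift" by simp
  also have "\<dots> = Fa z \<star> Fa q"
    unfolding cmp_p[OF E_ob] using arg_cong[OF lift_tangent(1), of Fa] by simp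
  finally have proj: "tan_p \<YY> (Fo E) \<star> lift' = Fa z \<star> Fa q" .
  have "lift' \<star> Fa z = (\<alpha> weil_W E \<star> Fa (tan_zero \<XX> E)) \<star> Fa z"
    using arg_cong[OF lift_tangent(3), of Fa] by simp
  then have zero: "lift' \<star> Fa z = tan_zero \<YY> (Fo E) \<star> Fa z"
    unfolding cmp_zero[OF E_ob] .
  let ?x = "lift \<bullet> p0" and ?y = "lift \<bullet> p1"
  let ?h = "pairing C (Tnat \<XX> (weil_pr 0) E) (Tnat \<XX> (weil_pr 1) E) ?x ?y"
  note pr = X.Tnat_ar[OF weil_pr_hom E_ob] and pr' = Y.Tnat_ar[OF weil_pr_hom F.obj_map_ob[OF E_ob]]
    and pl = X.Tnat_ar[OF weil_plus_hom E_ob] and pl' = Y.Tnat_ar[OF weil_plus_hom F.obj_map_ob[OF E_ob]]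
  have "tan_p \<XX> E \<bullet> ?x = z \<bullet> (q \<bullet> p0)" "tan_p \<XX> E \<bullet> ?y = z \<bullet> (q \<bullet> p1)"
    by (rule X.act.cod.whisker[OF lift_tangent(1)]; simp)+
  then have "tan_p \<XX> E \<bullet> ?x = tan_p \<XX> E \<bullet> ?y" by (simp add: q_sides)
  from X.act.cod.pairing[OF X.tan_p_pullback[OF E_ob] _ _ _ _ _ this] pr
  have h: "?h \<in> Ar C" "Dom C ?h = Dom C p0" "Cod C ?h = Tob \<XX> ?W2 E"
    "Tnat \<XX> (weil_pr 0) E \<bullet> ?h = ?x" "Tnat \<XX> (weil_pr 1) E \<bullet> ?h = ?y"
    by simp_all
  have cmp: "Tnat \<YY> \<theta> (Fo E) \<star> (\<alpha> ?W2 E \<star> Fa ?h) = \<alpha> weil_W E \<star> Fa (Tnat \<XX> \<theta> E \<bullet> ?h)"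
    if \<theta>: "\<theta> \<in> Hom Weil ?W2 weil_W" for \<theta>
  proof -
    note t = X.Tnat_ar[OF \<theta> E_ob] Y.Tnat_ar[OF \<theta> F.obj_map_ob[OF E_ob]]
    have "Tnat \<YY> \<theta> (Fo E) \<star> (\<alpha> ?W2 E \<star> Fa ?h) = \<alpha> weil_W E \<star> (Fa (Tnat \<XX> \<theta> E) \<star> Fa ?h)"
      by (rule Y.act.cod.whisker[OF cmp_Tnat[OF \<theta> E_ob]]) (use t h(1-3) in simp_all)
    then show ?thesis using t h(1-3) by simp
  qed
  have "pairing D (Tnat \<YY> (weil_pr 0) (Fo E)) (Tnat \<YY> (weil_pr 1) (Fo E)) (\<alpha> weil_W E \<star> Fa ?x) (\<alpha> weil_W E \<star> Fa ?y) =
      \<alpha> ?W2 E \<star> Fa ?h"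
    by (rule Y.act.cod.pairing_eqI[OF Y.tan_p_pullback[OF F.obj_map_ob[OF E_ob]]])
      (use h(1-3) pr' cmp[OF weil_pr_hom, of 0, unfolded h(4)] cmp[OF weil_pr_hom, of 1, unfolded h(5)] in simp_all)
  then have plus: "lift' \<star> Fa s = Tnat \<YY> weil_plus (Fo E) \<star>
      pairing D (Tnat \<YY> (weil_pr 0) (Fo E)) (Tnat \<YY> (weil_pr 1) (Fo E)) (lift' \<star> Fa p0) (lift' \<star> Fa p1)"
    using cmp[OF weil_plus_hom, folded lift_tangent(2)] by simp
  show ?thesis using proj zero plus
    by (simp add: additive_morphism_def bundle_morphism_def tangent_bundle_def eval_bundle_def Let_def base)
qed

lemma ell_image: "tan_ell \<YY> (Fo E) \<star> lift' = T' lift' \<star> lift'"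
proof -
  let ?a = "\<alpha> weil_W E" and ?aT = "\<alpha> weil_W (Tob \<XX> weil_W E)"
  have "tan_ell \<YY> (Fo E) \<star> lift' = (tan_ell \<YY> (Fo E) \<star> ?a) \<star> Fa lift" by simp
  also have "\<dots> = T' ?a \<star> (?aT \<star> (Fa (tan_ell \<XX> E) \<star> Fa lift))"
    unfolding cmp_ell[OF E_ob] by simp
  also have "Fa (tan_ell \<XX> E) \<star> Fa lift = Fa (T lift) \<star> Fa lift"
    using arg_cong[OF lift_ell, of Fa] by simp
  also have "?aT \<star> (Fa (T lift) \<star> Fa lift) = T' (Fa lift) \<star> (?a \<star> Fa lift)"
    by (rule Y.act.cod.whisker[OF cmp_Tar[symmetric]]) simp_all
  finally show ?thesis by simp
qed

text \<open>
The square of the source lies over \<open>T pt\<close>, which is terminal, so its image is a pullback. Pasting with the naturality square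
of \<open>\<alpha>\<close> at \<open>q\<close> yields the required square up to rewriting its edges.
\<close>

lemma universal_image:
  "is_pullback D (T' (Fa s) \<star> pairing D (T' (Fa p0)) (T' (Fa p1)) (lift' \<star> Fa p0) (tan_zero \<YY> (Fo E) \<star> Fa p1))
    (Fa q \<star> Fa p0) (T' (Fa q)) (tan_zero \<YY> (Fo pt))"
proof -
  let ?t = "T s \<bullet> pairing C (T p0) (T p1) (lift \<bullet> p0) (tan_zero \<XX> E \<bullet> p1)"
  \<comment> \<open>This is where terminality of the tangent object of the base enters.\<close>
  have "is_pullback D (Fa ?t) (Fa (q \<bullet> p0)) (Fa (T q)) (Fa (tan_zero \<XX> pt))"
    by (rule preserves_over_terminal[OF universal]) (simp add: T_terminal)
  from Y.act.cod.pullback_paste[OF this cmp_pullback[OF weil_Wn_ob bundle_ar(1-3)]]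
  have "is_pullback D (\<alpha> weil_W E \<star> Fa ?t) (Fa (q \<bullet> p0)) (T' (Fa q)) (tan_zero \<YY> (Fo pt))"
    by (simp only: cmp_zero[OF pt_ob])
  moreover have "\<alpha> weil_W E \<star> Fa ?t = T' (Fa s) \<star> pairing D (T' (Fa p0)) (T' (Fa p1))
      (\<alpha> weil_W E \<star> Fa (lift \<bullet> p0)) (\<alpha> weil_W E \<star> Fa (tan_zero \<XX> E \<bullet> p1))"
    by (rule cmp_pairing_T[symmetric]) (simp_all add: q_lift q_zero q_sides)
  moreover have "\<alpha> weil_W E \<star> Fa (tan_zero \<XX> E \<bullet> p1) = tan_zero \<YY> (Fo E) \<star> Fa p1"
    unfolding cmp_zero[OF E_ob, symmetric] by simp
  moreover have "\<alpha> weil_W E \<star> Fa (lift \<bullet> p0) = lift' \<star> Fa p0" "Fa (q \<bullet> p0) = Fa q \<star> Fa p0" by simp_all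
  ultimately show ?thesis by simp
qed

lemma differential_image: "differential_bundle \<YY> (eval_bundle \<YY> B \<F>)"
proof -
  have f: "btot (eval_bundle \<YY> B \<F>) = Fo E" "bbase (eval_bundle \<YY> B \<F>) = Fo pt" "bproj (eval_bundle \<YY> B \<F>) = Fa q"
    "bpi0 (eval_bundle \<YY> B \<F>) = Fa p0" "bpi1 (eval_bundle \<YY> B \<F>) = Fa p1" "bzero (eval_bundle \<YY> B \<F>) = Fa z"
    "bplus (eval_bundle \<YY> B \<F>) = Fa s" "blift (eval_bundle \<YY> B \<F>) = lift'"
    by (simp_all add: eval_bundle_def Let_def base)
  show ?thesis unfolding differential_bundle_def Let_def f
    using additive_image powers_image additive_T_image additive_tangent_image ell_image universal_image
    by blast
qed

end

section \<open>The categories of differential bundles and of differential functors\<close>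

lemma category_full_subcat:
  assumes "category C"
  shows "category (full_subcat C S)"
proof -
  interpret category C by fact
  show ?thesis by unfold_locales (auto simp: full_subcat_def Hom_def)
qed

lemma functor_full_subcat:
  assumes F: "is_functor C D F" and S: "\<And>x. x \<in> Ob C \<Longrightarrow> x \<in> S \<Longrightarrow> obj_map F x \<in> S'"
  shows "is_functor (full_subcat C S) (full_subcat D S') F"
proof -
  interpret is_functor C D F by (rule F)
  interpret C': category "full_subcat C S" by (rule category_full_subcat) (rule dom.category_axioms)
  interpret D': category "full_subcat D S'" by (rule category_full_subcat) (rule cod.category_axioms)
  show ?thesis by unfold_locales (auto simp: full_subcat_def Hom_def S)
qed

lemma DBun_of_category:
  assumes C: "category (tcat \<XX>)"
    and bundled: "\<And>B B' f g. mor B B' f g \<Longrightarrow> bundle_morphism (tcat \<XX>) B B' f g"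
    and ident: "\<And>B. differential_bundle \<XX> B \<Longrightarrow> mor B B (Id (tcat \<XX>) (btot B)) (Id (tcat \<XX>) (bbase B))"
    and comp: "\<And>B B' B'' f g f' g'. differential_bundle \<XX> B \<Longrightarrow> differential_bundle \<XX> B' \<Longrightarrow> differential_bundle \<XX> B'' \<Longrightarrow>
      mor B B' f g \<Longrightarrow> mor B' B'' f' g' \<Longrightarrow> mor B B'' (f' \<cdot>\<^bsub>tcat \<XX>\<^esub> f) (g' \<cdot>\<^bsub>tcat \<XX>\<^esub> g)"
  shows "category (DBun_of \<XX> mor)"
proof -
  interpret category "tcat \<XX>" by fact
  have ar: "f \<in> Ar (tcat \<XX>)" "Dom (tcat \<XX>) f = btot B" "Cod (tcat \<XX>) f = btot B'"
    "g \<in> Ar (tcat \<XX>)" "Dom (tcat \<XX>) g = bbase B" "Cod (tcat \<XX>) g = bbase B'" if "mor B B' f g" for B B' f g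
    using bundled[OF that] by (simp_all add: bundle_morphism_def)
  show ?thesis
    by unfold_locales (auto simp: DBun_of_def Hom_def ident comp ar)
qed

lemma additive_morphism_Id:
  assumes C: "category C" and B: "additive_bundle C B"
  shows "additive_morphism C B B (Id C (btot B)) (Id C (bbase B))"
proof -
  interpret category C by fact
  note b = additive_bundleD[OF B] and p = pullbackD[OF additive_bundleD(3)[OF B]]
  have ob: "btot B \<in> Ob C" "bbase B \<in> Ob C" "Dom C (bpi0 B) \<in> Ob C"
    using b(1) dom_ob[of "bproj B"] cod_ob[of "bproj B"] dom_ob[of "bpi0 B"] p by simp_all
  have "pairing C (bpi0 B) (bpi1 B) (bpi0 B) (bpi1 B) = Id C (Dom C (bpi0 B))"
    by (rule pairing_eqI[OF b(3)]) (use b p ob in simp_all)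
  then show ?thesis
    using b(1,4,5) p(1-8) ob by (simp add: additive_morphism_def bundle_morphism_def)
qed

text \<open>
The only point is that the maps induced on the chosen fibre products compose, which follows from
uniqueness of pairings.
\<close>

lemma additive_morphism_comp:
  assumes C: "category C" and B: "additive_bundle C B" "additive_bundle C B'" "additive_bundle C B''"
    and fg: "additive_morphism C B B' f g" and fg': "additive_morphism C B' B'' f' g'"
  shows "additive_morphism C B B'' (f' \<cdot>\<^bsub>C\<^esub> f) (g' \<cdot>\<^bsub>C\<^esub> g)"
proof -
  interpret category C by fact
  note b = additive_bundleD[OF B(1)] additive_bundleD(1,4,5)[OF B(2)] additive_bundleD(1,4,5)[OF B(3)]
  note p = pullbackD[OF additive_bundleD(3)[OF B(1)]] and p' = pullbackD[OF additive_bundleD(3)[OF B(2)]]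
    and p'' = pullbackD[OF additive_bundleD(3)[OF B(3)]]
  have m: "f \<in> Ar C" "Dom C f = btot B" "Cod C f = btot B'" "g \<in> Ar C" "Dom C g = bbase B" "Cod C g = bbase B'"
    "bproj B' \<cdot>\<^bsub>C\<^esub> f = g \<cdot>\<^bsub>C\<^esub> bproj B"
    "f \<cdot>\<^bsub>C\<^esub> bplus B = bplus B' \<cdot>\<^bsub>C\<^esub> pairing C (bpi0 B') (bpi1 B') (f \<cdot>\<^bsub>C\<^esub> bpi0 B) (f \<cdot>\<^bsub>C\<^esub> bpi1 B)"
    "f \<cdot>\<^bsub>C\<^esub> bzero B = bzero B' \<cdot>\<^bsub>C\<^esub> g"
    using fg by (simp_all add: additive_morphism_def bundle_morphism_def)
  have m': "f' \<in> Ar C" "Dom C f' = btot B'" "Cod C f' = btot B''" "g' \<in> Ar C" "Dom C g' = bbase B'" "Cod C g' = bbase B''"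
    "bproj B'' \<cdot>\<^bsub>C\<^esub> f' = g' \<cdot>\<^bsub>C\<^esub> bproj B'"
    "f' \<cdot>\<^bsub>C\<^esub> bplus B' = bplus B'' \<cdot>\<^bsub>C\<^esub> pairing C (bpi0 B'') (bpi1 B'') (f' \<cdot>\<^bsub>C\<^esub> bpi0 B') (f' \<cdot>\<^bsub>C\<^esub> bpi1 B')"
    "f' \<cdot>\<^bsub>C\<^esub> bzero B' = bzero B'' \<cdot>\<^bsub>C\<^esub> g'"
    using fg' by (simp_all add: additive_morphism_def bundle_morphism_def)
  note ty = b(1,4,5) additive_bundleD(1,4,5)[OF B(2)] additive_bundleD(1,4,5)[OF B(3)]
    p(1-8) p'(1-8) p''(1-8) m(1-6) m'(1-6)
  have "bproj B'' \<cdot>\<^bsub>C\<^esub> (f' \<cdot>\<^bsub>C\<^esub> f) = g' \<cdot>\<^bsub>C\<^esub> (bproj B' \<cdot>\<^bsub>C\<^esub> f)"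
    by (rule whisker[OF m'(7)]) (use ty in simp_all)
  then have proj: "bproj B'' \<cdot>\<^bsub>C\<^esub> (f' \<cdot>\<^bsub>C\<^esub> f) = (g' \<cdot>\<^bsub>C\<^esub> g) \<cdot>\<^bsub>C\<^esub> bproj B" using ty m(7) by simp
  have "f' \<cdot>\<^bsub>C\<^esub> (bzero B' \<cdot>\<^bsub>C\<^esub> g) = bzero B'' \<cdot>\<^bsub>C\<^esub> (g' \<cdot>\<^bsub>C\<^esub> g)"
    by (rule whisker[OF m'(9)]) (use ty in simp_all)
  then have zero: "(f' \<cdot>\<^bsub>C\<^esub> f) \<cdot>\<^bsub>C\<^esub> bzero B = bzero B'' \<cdot>\<^bsub>C\<^esub> (g' \<cdot>\<^bsub>C\<^esub> g)" using ty m(9) by simp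
  let ?h = "pairing C (bpi0 B') (bpi1 B') (f \<cdot>\<^bsub>C\<^esub> bpi0 B) (f \<cdot>\<^bsub>C\<^esub> bpi1 B)"
  let ?h' = "pairing C (bpi0 B'') (bpi1 B'') (f' \<cdot>\<^bsub>C\<^esub> bpi0 B') (f' \<cdot>\<^bsub>C\<^esub> bpi1 B')"
  have "bproj B' \<cdot>\<^bsub>C\<^esub> (f \<cdot>\<^bsub>C\<^esub> bpi0 B) = g \<cdot>\<^bsub>C\<^esub> (bproj B \<cdot>\<^bsub>C\<^esub> bpi0 B)"
    "bproj B' \<cdot>\<^bsub>C\<^esub> (f \<cdot>\<^bsub>C\<^esub> bpi1 B) = g \<cdot>\<^bsub>C\<^esub> (bproj B \<cdot>\<^bsub>C\<^esub> bpi1 B)"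
    by (rule whisker[OF m(7)]; use ty in simp)+
  then have e: "bproj B' \<cdot>\<^bsub>C\<^esub> (f \<cdot>\<^bsub>C\<^esub> bpi0 B) = bproj B' \<cdot>\<^bsub>C\<^esub> (f \<cdot>\<^bsub>C\<^esub> bpi1 B)" using p(9) by simp
  have "bproj B'' \<cdot>\<^bsub>C\<^esub> (f' \<cdot>\<^bsub>C\<^esub> bpi0 B') = g' \<cdot>\<^bsub>C\<^esub> (bproj B' \<cdot>\<^bsub>C\<^esub> bpi0 B')"
    "bproj B'' \<cdot>\<^bsub>C\<^esub> (f' \<cdot>\<^bsub>C\<^esub> bpi1 B') = g' \<cdot>\<^bsub>C\<^esub> (bproj B' \<cdot>\<^bsub>C\<^esub> bpi1 B')"
    by (rule whisker[OF m'(7)]; use ty in simp)+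
  then have e': "bproj B'' \<cdot>\<^bsub>C\<^esub> (f' \<cdot>\<^bsub>C\<^esub> bpi0 B') = bproj B'' \<cdot>\<^bsub>C\<^esub> (f' \<cdot>\<^bsub>C\<^esub> bpi1 B')" using p'(9) by simp
  have h: "?h \<in> Ar C" "Dom C ?h = Dom C (bpi0 B)" "Cod C ?h = Dom C (bpi0 B')"
    "bpi0 B' \<cdot>\<^bsub>C\<^esub> ?h = f \<cdot>\<^bsub>C\<^esub> bpi0 B" "bpi1 B' \<cdot>\<^bsub>C\<^esub> ?h = f \<cdot>\<^bsub>C\<^esub> bpi1 B"
    using pairing[OF additive_bundleD(3)[OF B(2)] _ _ _ _ _ e] ty by simp_all
  have h': "?h' \<in> Ar C" "Dom C ?h' = Dom C (bpi0 B')" "Cod C ?h' = Dom C (bpi0 B'')"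
    "bpi0 B'' \<cdot>\<^bsub>C\<^esub> ?h' = f' \<cdot>\<^bsub>C\<^esub> bpi0 B'" "bpi1 B'' \<cdot>\<^bsub>C\<^esub> ?h' = f' \<cdot>\<^bsub>C\<^esub> bpi1 B'"
    using pairing[OF additive_bundleD(3)[OF B(3)] _ _ _ _ _ e'] ty by simp_all
  have "bpi0 B'' \<cdot>\<^bsub>C\<^esub> (?h' \<cdot>\<^bsub>C\<^esub> ?h) = f' \<cdot>\<^bsub>C\<^esub> (bpi0 B' \<cdot>\<^bsub>C\<^esub> ?h)"
    by (rule whisker[OF h'(4)]) (use ty h(1-3) h'(1-3) in simp_all)
  moreover have "bpi1 B'' \<cdot>\<^bsub>C\<^esub> (?h' \<cdot>\<^bsub>C\<^esub> ?h) = f' \<cdot>\<^bsub>C\<^esub> (bpi1 B' \<cdot>\<^bsub>C\<^esub> ?h)"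
    by (rule whisker[OF h'(5)]) (use ty h(1-3) h'(1-3) in simp_all)
  ultimately have pair: "pairing C (bpi0 B'') (bpi1 B'') (f' \<cdot>\<^bsub>C\<^esub> (f \<cdot>\<^bsub>C\<^esub> bpi0 B)) (f' \<cdot>\<^bsub>C\<^esub> (f \<cdot>\<^bsub>C\<^esub> bpi1 B)) = ?h' \<cdot>\<^bsub>C\<^esub> ?h"
    unfolding h(4,5) by (intro pairing_eqI[OF additive_bundleD(3)[OF B(3)]]) (use h(1-3) h'(1-3) in simp_all)
  have "f' \<cdot>\<^bsub>C\<^esub> (bplus B' \<cdot>\<^bsub>C\<^esub> ?h) = bplus B'' \<cdot>\<^bsub>C\<^esub> (?h' \<cdot>\<^bsub>C\<^esub> ?h)"
    by (rule whisker[OF m'(8)]) (use ty h(1-3) h'(1-3) in simp_all)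
  then have plus: "(f' \<cdot>\<^bsub>C\<^esub> f) \<cdot>\<^bsub>C\<^esub> bplus B = bplus B'' \<cdot>\<^bsub>C\<^esub>
      pairing C (bpi0 B'') (bpi1 B'') ((f' \<cdot>\<^bsub>C\<^esub> f) \<cdot>\<^bsub>C\<^esub> bpi0 B) ((f' \<cdot>\<^bsub>C\<^esub> f) \<cdot>\<^bsub>C\<^esub> bpi1 B)"
    using ty pair m(8) by simp
  show ?thesis using proj zero plus ty by (simp add: additive_morphism_def bundle_morphism_def)
qed

lemma differential_bundle_additive: "differential_bundle \<XX> B \<Longrightarrow> additive_bundle (tcat \<XX>) B"
  by (simp add: differential_bundle_def Let_def)

lemma category_DBun_add:
  assumes "category (tcat \<XX>)"
  shows "category (DBun_add \<XX>)"
  unfolding DBun_add_def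
proof (rule DBun_of_category[OF assms])
  show "additive_morphism (tcat \<XX>) B B (Id (tcat \<XX>) (btot B)) (Id (tcat \<XX>) (bbase B))"
    if "differential_bundle \<XX> B" for B
    by (rule additive_morphism_Id[OF assms differential_bundle_additive[OF that]])
  show "additive_morphism (tcat \<XX>) B B'' (f' \<cdot>\<^bsub>tcat \<XX>\<^esub> f) (g' \<cdot>\<^bsub>tcat \<XX>\<^esub> g)"
    if "differential_bundle \<XX> B" "differential_bundle \<XX> B'" "differential_bundle \<XX> B''"
      "additive_morphism (tcat \<XX>) B B' f g" "additive_morphism (tcat \<XX>) B' B'' f' g'" for B B' B'' f g f' g'
    by (rule additive_morphism_comp[OF assms that(1-3)[THEN differential_bundle_additive] that(4,5)])
qed (simp add: additive_morphism_def)

lemma (in weil_actegory) category_DBun_lin: "category (DBun_lin \<XX>)"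
  unfolding DBun_lin_def
proof (rule DBun_of_category[OF base_category])
  have ty: "bproj B \<in> Ar (tcat \<XX>)" "Dom (tcat \<XX>) (bproj B) = btot B" "Cod (tcat \<XX>) (bproj B) = bbase B"
    "btot B \<in> Ob (tcat \<XX>)" "bbase B \<in> Ob (tcat \<XX>)"
    "blift B \<in> Ar (tcat \<XX>)" "Dom (tcat \<XX>) (blift B) = btot B" "Cod (tcat \<XX>) (blift B) = Tob \<XX> weil_W (btot B)"
    if "differential_bundle \<XX> B" for B
  proof -
    show q: "bproj B \<in> Ar (tcat \<XX>)" "Dom (tcat \<XX>) (bproj B) = btot B" "Cod (tcat \<XX>) (bproj B) = bbase B"
      using act.cod.additive_bundleD(1)[OF differential_bundle_additive[OF that]] by simp_all
    show "btot B \<in> Ob (tcat \<XX>)" "bbase B \<in> Ob (tcat \<XX>)"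
      using act.cod.dom_ob[OF q(1)] act.cod.cod_ob[OF q(1)] q by simp_all
    have "blift B \<in> Hom (tcat \<XX>) (btot B) (Tob \<XX> weil_W (btot B))"
      using that by (simp add: differential_bundle_def Let_def additive_morphism_def bundle_morphism_def T_bundle_def)
    then show "blift B \<in> Ar (tcat \<XX>)" "Dom (tcat \<XX>) (blift B) = btot B" "Cod (tcat \<XX>) (blift B) = Tob \<XX> weil_W (btot B)"
      by simp_all
  qed
  show "linear_morphism \<XX> B B (Id (tcat \<XX>) (btot B)) (Id (tcat \<XX>) (bbase B))"
    if "differential_bundle \<XX> B" for B
    using ty[OF that] by (simp add: linear_morphism_def bundle_morphism_def)
  show "linear_morphism \<XX> B B'' (f' \<cdot>\<^bsub>tcat \<XX>\<^esub> f) (g' \<cdot>\<^bsub>tcat \<XX>\<^esub> g)"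
    if B: "differential_bundle \<XX> B" "differential_bundle \<XX> B'" "differential_bundle \<XX> B''"
      and m: "linear_morphism \<XX> B B' f g" and m': "linear_morphism \<XX> B' B'' f' g'" for B B' B'' f g f' g'
  proof -
    let ?C = "tcat \<XX>"
    have f: "f \<in> Ar ?C" "Dom ?C f = btot B" "Cod ?C f = btot B'" "g \<in> Ar ?C" "Dom ?C g = bbase B" "Cod ?C g = bbase B'"
      "bproj B' \<cdot>\<^bsub>?C\<^esub> f = g \<cdot>\<^bsub>?C\<^esub> bproj B" "blift B' \<cdot>\<^bsub>?C\<^esub> f = Tar \<XX> weil_W f \<cdot>\<^bsub>?C\<^esub> blift B"
      using m by (simp_all add: linear_morphism_def bundle_morphism_def)
    have f': "f' \<in> Ar ?C" "Dom ?C f' = btot B'" "Cod ?C f' = btot B''" "g' \<in> Ar ?C" "Dom ?C g' = bbase B'" "Cod ?C g' = bbase B''"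
      "bproj B'' \<cdot>\<^bsub>?C\<^esub> f' = g' \<cdot>\<^bsub>?C\<^esub> bproj B'" "blift B'' \<cdot>\<^bsub>?C\<^esub> f' = Tar \<XX> weil_W f' \<cdot>\<^bsub>?C\<^esub> blift B'"
      using m' by (simp_all add: linear_morphism_def bundle_morphism_def)
    note t = f(1-6) f'(1-6) ty[OF B(1)] ty[OF B(2)] ty[OF B(3)]
    have "bproj B'' \<cdot>\<^bsub>?C\<^esub> (f' \<cdot>\<^bsub>?C\<^esub> f) = g' \<cdot>\<^bsub>?C\<^esub> (bproj B' \<cdot>\<^bsub>?C\<^esub> f)"
      by (rule act.cod.whisker[OF f'(7)]) (use t in simp_all)
    moreover have "blift B'' \<cdot>\<^bsub>?C\<^esub> (f' \<cdot>\<^bsub>?C\<^esub> f) = Tar \<XX> weil_W f' \<cdot>\<^bsub>?C\<^esub> (blift B' \<cdot>\<^bsub>?C\<^esub> f)"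
      by (rule act.cod.whisker[OF f'(8)]) (use t in simp_all)
    ultimately show ?thesis using t by (simp add: linear_morphism_def bundle_morphism_def f(7,8))
  qed
qed (simp add: linear_morphism_def)

lemma DiffFun_of_category:
  fixes \<XX> :: "('o, 'm) actegory" and \<YY> :: "('p, 'n) actegory"
  assumes C: "category (tcat \<XX>)" and D: "category (tcat \<YY>)"
    and nat: "\<And>\<F> \<G> \<phi>. mor \<F> \<G> \<phi> \<Longrightarrow> natural_transformation (tcat \<XX>) (tcat \<YY>) (ofun \<F>) (ofun \<G>) \<phi>"
    and ident: "\<And>\<F>. lax_differential_functor \<XX> pt \<YY> \<F> \<Longrightarrow>
      mor \<F> \<F> (\<lambda>X\<in>Ob (tcat \<XX>). Id (tcat \<YY>) (obj_map (ofun \<F>) X))"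
    and comp: "\<And>\<F> \<G> \<H> \<phi> \<psi>. lax_differential_functor \<XX> pt \<YY> \<F> \<Longrightarrow> lax_differential_functor \<XX> pt \<YY> \<G> \<Longrightarrow>
      lax_differential_functor \<XX> pt \<YY> \<H> \<Longrightarrow> mor \<F> \<G> \<phi> \<Longrightarrow> mor \<G> \<H> \<psi> \<Longrightarrow>
      mor \<F> \<H> (\<lambda>X\<in>Ob (tcat \<XX>). \<psi> X \<cdot>\<^bsub>tcat \<YY>\<^esub> \<phi> X)"
  shows "category (DiffFun_of \<XX> pt \<YY> mor)"
proof -
  interpret C: category "tcat \<XX>" by fact
  interpret D: category "tcat \<YY>" by fact
  have ar: "\<phi> X \<in> Ar (tcat \<YY>)" "Dom (tcat \<YY>) (\<phi> X) = obj_map (ofun \<F>) X" "Cod (tcat \<YY>) (\<phi> X) = obj_map (ofun \<G>) X"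
    if "mor \<F> \<G> \<phi>" "X \<in> Ob (tcat \<XX>)" for \<F> \<G> \<phi> X
    using nat[OF that(1)] that(2) by (simp_all add: natural_transformation_def)
  have idl: "(\<lambda>X\<in>Ob (tcat \<XX>). (\<lambda>X\<in>Ob (tcat \<XX>). Id (tcat \<YY>) (obj_map (ofun \<G>) X)) X \<cdot>\<^bsub>tcat \<YY>\<^esub> \<phi> X) = \<phi>"
    and idr: "(\<lambda>X\<in>Ob (tcat \<XX>). \<phi> X \<cdot>\<^bsub>tcat \<YY>\<^esub> (\<lambda>X\<in>Ob (tcat \<XX>). Id (tcat \<YY>) (obj_map (ofun \<F>) X)) X) = \<phi>"
    if "mor \<F> \<G> \<phi>" "\<phi> \<in> extensional (Ob (tcat \<XX>))" for \<F> \<G> \<phi>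
    by (rule extensionalityI[OF _ that(2)]; simp add: ar[OF that(1)])+
  have assoc: "(\<lambda>X\<in>Ob (tcat \<XX>). (\<lambda>X\<in>Ob (tcat \<XX>). \<chi> X \<cdot>\<^bsub>tcat \<YY>\<^esub> \<psi> X) X \<cdot>\<^bsub>tcat \<YY>\<^esub> \<phi> X) =
      (\<lambda>X\<in>Ob (tcat \<XX>). \<chi> X \<cdot>\<^bsub>tcat \<YY>\<^esub> (\<lambda>X\<in>Ob (tcat \<XX>). \<psi> X \<cdot>\<^bsub>tcat \<YY>\<^esub> \<phi> X) X)"
    if "mor \<F> \<G> \<phi>" "mor \<G> \<H> \<psi>" "mor \<H> \<K> \<chi>" for \<F> \<G> \<H> \<K> \<phi> \<psi> \<chi>
    by (rule restrict_ext) (simp add: ar[OF that(1)] ar[OF that(2)] ar[OF that(3)])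
  show ?thesis
  proof (unfold_locales, goal_cases)
    case 3
    then show ?case by (simp add: DiffFun_of_def Hom_def Let_def ident)
  next
    case 4
    then show ?case by (auto simp: DiffFun_of_def Hom_def Let_def intro: comp)
  next
    case 5
    then show ?case by (auto simp: DiffFun_of_def Hom_def Let_def intro: idl simp del: restrict_apply)
  next
    case 6
    then show ?case by (auto simp: DiffFun_of_def Hom_def Let_def intro: idr simp del: restrict_apply)
  next
    case 7
    then show ?case by (auto simp: DiffFun_of_def Hom_def Let_def intro: assoc simp del: restrict_apply)
  qed (auto simp: DiffFun_of_def Hom_def Let_def)
qed

lemma lax_differential_functorD:
  assumes "lax_differential_functor \<XX> pt \<YY> \<F>"
  shows "oplax_linear_functor \<XX> \<YY> \<F>" "is_functor (tcat \<XX>) (tcat \<YY>) (ofun \<F>)"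
  using assms by (simp_all add: lax_differential_functor_def oplax_linear_functor_def Let_def)

lemma natural_transformation_Id:
  assumes "is_functor C D F"
  shows "natural_transformation C D F F (\<lambda>X\<in>Ob C. Id D (obj_map F X))"
proof -
  interpret is_functor C D F by fact
  show ?thesis by (auto simp: natural_transformation_def)
qed

lemma natural_transformation_comp:
  assumes "is_functor C D F" "is_functor C D G" "is_functor C D H"
    and \<phi>: "natural_transformation C D F G \<phi>" and \<psi>: "natural_transformation C D G H \<psi>"
  shows "natural_transformation C D F H (\<lambda>X\<in>Ob C. \<psi> X \<cdot>\<^bsub>D\<^esub> \<phi> X)"
proof -
  interpret F: is_functor C D F by fact
  interpret G: is_functor C D G by fact
  interpret H: is_functor C D H by fact
  have a: "\<phi> X \<in> Ar D" "Dom D (\<phi> X) = obj_map F X" "Cod D (\<phi> X) = obj_map G X"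
    "\<psi> X \<in> Ar D" "Dom D (\<psi> X) = obj_map G X" "Cod D (\<psi> X) = obj_map H X" if "X \<in> Ob C" for X
    using \<phi> \<psi> that by (simp_all add: natural_transformation_def)
  have n: "\<phi> (Cod C f) \<cdot>\<^bsub>D\<^esub> arr_map F f = arr_map G f \<cdot>\<^bsub>D\<^esub> \<phi> (Dom C f)"
    "\<psi> (Cod C f) \<cdot>\<^bsub>D\<^esub> arr_map G f = arr_map H f \<cdot>\<^bsub>D\<^esub> \<psi> (Dom C f)" if "f \<in> Ar C" for f
    using \<phi> \<psi> that by (simp_all add: natural_transformation_def)
  have "\<psi> (Cod C f) \<cdot>\<^bsub>D\<^esub> (\<phi> (Cod C f) \<cdot>\<^bsub>D\<^esub> arr_map F f) = arr_map H f \<cdot>\<^bsub>D\<^esub> (\<psi> (Dom C f) \<cdot>\<^bsub>D\<^esub> \<phi> (Dom C f))"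
    if f: "f \<in> Ar C" for f
    unfolding n(1)[OF f] by (rule F.cod.whisker[OF n(2)[OF f]]) (use f a in simp_all)
  then show ?thesis by (auto simp: natural_transformation_def a)
qed

lemma category_DiffFun:
  assumes "category (tcat \<XX>)" "category (tcat \<YY>)"
  shows "category (DiffFun \<XX> pt \<YY>)"
  unfolding DiffFun_def
  by (rule DiffFun_of_category[OF assms])
    (blast intro: natural_transformation_Id natural_transformation_comp lax_differential_functorD)+

lemma category_DiffFun_lin:
  assumes "weil_actegory \<XX>" "weil_actegory \<YY>"
  shows "category (DiffFun_lin \<XX> pt \<YY>)"
  unfolding DiffFun_lin_def
proof (rule DiffFun_of_category)
  interpret X: weil_actegory \<XX> by fact
  interpret Y: weil_actegory \<YY> by fact
  let ?C = "tcat \<XX>" and ?D = "tcat \<YY>"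
  show "category ?C" "category ?D" by (rule X.base_category Y.base_category)+
  have cmp: "ocmp \<F> (A, X) \<in> Hom ?D (obj_map (ofun \<F>) (Tob \<XX> A X)) (Tob \<YY> A (obj_map (ofun \<F>) X))"
    if "lax_differential_functor \<XX> pt \<YY> \<F>" "A \<in> Ob Weil" "X \<in> Ob ?C" for \<F> A X
    using lax_differential_functorD(1)[OF that(1)] that(2,3) unfolding oplax_linear_functor_def Let_def by blast
  show "linear_transformation \<XX> \<YY> \<F> \<F> (\<lambda>X\<in>Ob ?C. Id ?D (obj_map (ofun \<F>) X))"
    if F: "lax_differential_functor \<XX> pt \<YY> \<F>" for \<F>
  proof -
    interpret F: is_functor ?C ?D "ofun \<F>" by (rule lax_differential_functorD(2)[OF F])
    show ?thesis using natural_transformation_Id[OF F.is_functor_axioms] cmp[OF F]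
      by (simp add: linear_transformation_def)
  qed
  show "linear_transformation \<XX> \<YY> \<F> \<H> (\<lambda>X\<in>Ob ?C. \<psi> X \<cdot>\<^bsub>?D\<^esub> \<phi> X)"
    if F: "lax_differential_functor \<XX> pt \<YY> \<F>" and G: "lax_differential_functor \<XX> pt \<YY> \<G>"
      and H: "lax_differential_functor \<XX> pt \<YY> \<H>"
      and \<phi>: "linear_transformation \<XX> \<YY> \<F> \<G> \<phi>" and \<psi>: "linear_transformation \<XX> \<YY> \<G> \<H> \<psi>" for \<F> \<G> \<H> \<phi> \<psi>
  proof -
    have n: "natural_transformation ?C ?D (ofun \<F>) (ofun \<G>) \<phi>" "natural_transformation ?C ?D (ofun \<G>) (ofun \<H>) \<psi>"
      using \<phi> \<psi> by (simp_all add: linear_transformation_def)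
    have a: "\<phi> X \<in> Ar ?D" "Dom ?D (\<phi> X) = obj_map (ofun \<F>) X" "Cod ?D (\<phi> X) = obj_map (ofun \<G>) X"
      "\<psi> X \<in> Ar ?D" "Dom ?D (\<psi> X) = obj_map (ofun \<G>) X" "Cod ?D (\<psi> X) = obj_map (ofun \<H>) X" if "X \<in> Ob ?C" for X
      using n that by (simp_all add: natural_transformation_def)
    have l: "ocmp \<G> (A, X) \<cdot>\<^bsub>?D\<^esub> \<phi> (Tob \<XX> A X) = Tar \<YY> A (\<phi> X) \<cdot>\<^bsub>?D\<^esub> ocmp \<F> (A, X)"
      "ocmp \<H> (A, X) \<cdot>\<^bsub>?D\<^esub> \<psi> (Tob \<XX> A X) = Tar \<YY> A (\<psi> X) \<cdot>\<^bsub>?D\<^esub> ocmp \<G> (A, X)"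
      if "A \<in> Ob Weil" "X \<in> Ob ?C" for A X
      using \<phi> \<psi> that by (simp_all add: linear_transformation_def)
    have "ocmp \<H> (A, X) \<cdot>\<^bsub>?D\<^esub> (\<psi> (Tob \<XX> A X) \<cdot>\<^bsub>?D\<^esub> \<phi> (Tob \<XX> A X)) =
        Tar \<YY> A (\<psi> X \<cdot>\<^bsub>?D\<^esub> \<phi> X) \<cdot>\<^bsub>?D\<^esub> ocmp \<F> (A, X)" if AX: "A \<in> Ob Weil" "X \<in> Ob ?C" for A X
    proof -
      note c = cmp[OF F AX] cmp[OF G AX] cmp[OF H AX]
      have "ocmp \<H> (A, X) \<cdot>\<^bsub>?D\<^esub> (\<psi> (Tob \<XX> A X) \<cdot>\<^bsub>?D\<^esub> \<phi> (Tob \<XX> A X)) =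
          Tar \<YY> A (\<psi> X) \<cdot>\<^bsub>?D\<^esub> (ocmp \<G> (A, X) \<cdot>\<^bsub>?D\<^esub> \<phi> (Tob \<XX> A X))"
        by (rule Y.act.cod.whisker[OF l(2)[OF AX]]) (use AX c a in simp_all)
      then show ?thesis using AX c a by (simp add: l(1))
    qed
    then show ?thesis
      using natural_transformation_comp[OF lax_differential_functorD(2)[OF F] lax_differential_functorD(2)[OF G]
          lax_differential_functorD(2)[OF H] n]
      by (simp add: linear_transformation_def)
  qed
qed (simp add: linear_transformation_def)

section \<open>Evaluation\<close>

context
  fixes \<XX> :: "('o, 'm) actegory" and \<YY> :: "('p, 'n) actegory" and pt :: 'o and B :: "('o, 'm) dbun"
  assumes X: "tangent_actegory \<XX>" and Y: "tangent_actegory \<YY>" and pt: "is_terminal (tcat \<XX>) pt"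
    and T_pt: "is_terminal (tcat \<XX>) (Tob \<XX> weil_W pt)" and B: "differential_bundle \<XX> B" "bbase B = pt"
begin

lemma eval_locale:
  assumes "lax_differential_functor \<XX> pt \<YY> \<F>"
  shows "evaluated_differential_object \<XX> \<YY> pt \<F> B"
  by (intro evaluated_differential_object.intro lax_functor_over_terminal.intro
      lax_functor_over_terminal_axioms.intro evaluated_differential_object_axioms.intro assms X Y pt T_pt B)

text \<open>
By naturality at the two projections, the map induced on the fibre products is the component of the transformation at the
fibre product; compatibility with the addition is then naturality at \<open>\<sigma>\<close>.
\<close>

lemma eval_additive:
  assumes F: "lax_differential_functor \<XX> pt \<YY> \<F>" and G: "lax_differential_functor \<XX> pt \<YY> \<G>"
    and \<phi>: "natural_transformation (tcat \<XX>) (tcat \<YY>) (ofun \<F>) (ofun \<G>) \<phi>"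
  shows "additive_morphism (tcat \<YY>) (eval_bundle \<YY> B \<F>) (eval_bundle \<YY> B \<G>) (\<phi> (btot B)) (\<phi> pt)"
proof -
  interpret F: evaluated_differential_object \<XX> \<YY> pt \<F> B by (rule eval_locale[OF F])
  interpret G: evaluated_differential_object \<XX> \<YY> pt \<G> B by (rule eval_locale[OF G])
  let ?D = "tcat \<YY>" and ?P = "Dom (tcat \<XX>) (bpi0 B)"
  have a: "\<phi> Z \<in> Ar ?D" "Dom ?D (\<phi> Z) = F.Fo Z" "Cod ?D (\<phi> Z) = G.Fo Z" if "Z \<in> Ob (tcat \<XX>)" for Z
    using \<phi> that by (simp_all add: natural_transformation_def)
  have n: "\<phi> Z' \<cdot>\<^bsub>?D\<^esub> F.Fa f = G.Fa f \<cdot>\<^bsub>?D\<^esub> \<phi> Z" if "f \<in> Ar (tcat \<XX>)" "Dom (tcat \<XX>) f = Z" "Cod (tcat \<XX>) f = Z'" for f Z Z'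
    using \<phi> that by (simp add: natural_transformation_def)
  have "pairing ?D (G.Fa (bpi0 B)) (G.Fa (bpi1 B)) (\<phi> (btot B) \<cdot>\<^bsub>?D\<^esub> F.Fa (bpi0 B)) (\<phi> (btot B) \<cdot>\<^bsub>?D\<^esub> F.Fa (bpi1 B)) = \<phi> ?P"
    by (rule F.Y.act.cod.pairing_eqI[OF G.pullback_F]) (simp_all add: a n[of "bpi0 B" ?P] n[of "bpi1 B" ?P])
  then show ?thesis
    using n[of "bplus B" ?P "btot B"] n[of "bzero B" pt "btot B"] n[of "bproj B" "btot B" pt]
    by (simp add: additive_morphism_def bundle_morphism_def eval_bundle_def Let_def B(2) a)
qed

lemma eval_linear:
  assumes F: "lax_differential_functor \<XX> pt \<YY> \<F>" and G: "lax_differential_functor \<XX> pt \<YY> \<G>"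
    and \<phi>: "linear_transformation \<XX> \<YY> \<F> \<G> \<phi>"
  shows "linear_morphism \<YY> (eval_bundle \<YY> B \<F>) (eval_bundle \<YY> B \<G>) (\<phi> (btot B)) (\<phi> pt)"
proof -
  interpret F: evaluated_differential_object \<XX> \<YY> pt \<F> B by (rule eval_locale[OF F])
  interpret G: evaluated_differential_object \<XX> \<YY> pt \<G> B by (rule eval_locale[OF G])
  let ?D = "tcat \<YY>" and ?E = "btot B" and ?TE = "Tob \<XX> weil_W (btot B)"
  have nat: "natural_transformation (tcat \<XX>) (tcat \<YY>) (ofun \<F>) (ofun \<G>) \<phi>"
    using \<phi> by (simp add: linear_transformation_def)
  have a: "\<phi> Z \<in> Ar ?D" "Dom ?D (\<phi> Z) = F.Fo Z" "Cod ?D (\<phi> Z) = G.Fo Z" if "Z \<in> Ob (tcat \<XX>)" for Z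
    using nat that by (simp_all add: natural_transformation_def)
  have n: "\<phi> ?TE \<cdot>\<^bsub>?D\<^esub> F.Fa (blift B) = G.Fa (blift B) \<cdot>\<^bsub>?D\<^esub> \<phi> ?E"
    using nat by (simp add: natural_transformation_def)
  have l: "G.\<alpha> weil_W ?E \<cdot>\<^bsub>?D\<^esub> \<phi> ?TE = Tar \<YY> weil_W (\<phi> ?E) \<cdot>\<^bsub>?D\<^esub> F.\<alpha> weil_W ?E"
    using \<phi> by (simp add: linear_transformation_def)
  have "G.\<alpha> weil_W ?E \<cdot>\<^bsub>?D\<^esub> (\<phi> ?TE \<cdot>\<^bsub>?D\<^esub> F.Fa (blift B)) = Tar \<YY> weil_W (\<phi> ?E) \<cdot>\<^bsub>?D\<^esub> (F.\<alpha> weil_W ?E \<cdot>\<^bsub>?D\<^esub> F.Fa (blift B))"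
    by (rule F.Y.act.cod.whisker[OF l]) (simp_all add: a)
  then have "(G.\<alpha> weil_W ?E \<cdot>\<^bsub>?D\<^esub> G.Fa (blift B)) \<cdot>\<^bsub>?D\<^esub> \<phi> ?E = Tar \<YY> weil_W (\<phi> ?E) \<cdot>\<^bsub>?D\<^esub> (F.\<alpha> weil_W ?E \<cdot>\<^bsub>?D\<^esub> F.Fa (blift B))"
    unfolding n by (simp add: a)
  moreover have "bundle_morphism ?D (eval_bundle \<YY> B \<F>) (eval_bundle \<YY> B \<G>) (\<phi> ?E) (\<phi> pt)"
    using eval_additive[OF F G nat] by (simp add: additive_morphism_def)
  ultimately show ?thesis by (simp add: linear_morphism_def eval_bundle_def Let_def)
qed

lemma Eval_functor:
  assumes cat: "category (DiffFun_of \<XX> pt \<YY> mor)" "category (DBun_of \<YY> mor')"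
    and mor: "\<And>\<F> \<G> \<phi>. lax_differential_functor \<XX> pt \<YY> \<F> \<Longrightarrow> lax_differential_functor \<XX> pt \<YY> \<G> \<Longrightarrow>
      mor \<F> \<G> \<phi> \<Longrightarrow> mor' (eval_bundle \<YY> B \<F>) (eval_bundle \<YY> B \<G>) (\<phi> (btot B)) (\<phi> pt)"
  shows "is_functor (DiffFun_of \<XX> pt \<YY> mor) (DBun_of \<YY> mor') (Eval \<YY> B)"
proof -
  interpret X: tangent_actegory \<XX> by (rule X)
  interpret dom: category "DiffFun_of \<XX> pt \<YY> mor" by fact
  interpret cod: category "DBun_of \<YY> mor'" by fact
  have ob: "btot B \<in> Ob (tcat \<XX>)" "pt \<in> Ob (tcat \<XX>)"
    using X.act.cod.additive_bundleD(1)[OF differential_bundle_additive[OF B(1)]] pt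
      X.act.cod.dom_ob[of "bproj B"] by (simp_all add: is_terminal_def)
  have bundled: "differential_bundle \<YY> (eval_bundle \<YY> B \<F>)" if "lax_differential_functor \<XX> pt \<YY> \<F>" for \<F>
    using evaluated_differential_object.differential_image[OF eval_locale[OF that]] .
  have total: "btot (eval_bundle \<YY> B \<F>) = obj_map (ofun \<F>) (btot B)" "bbase (eval_bundle \<YY> B \<F>) = obj_map (ofun \<F>) pt" for \<F>
    by (simp_all add: eval_bundle_def Let_def B(2))
  show ?thesis
    by unfold_locales
      (auto simp: DiffFun_of_def DBun_of_def Eval_def Hom_def Let_def bundled mor B(2) ob total)
qed

end

theorem corollary4p11:
  fixes \<XX> :: "('o, 'm) actegory" and \<YY> :: "('p, 'n) actegory"
    and pt :: 'o and A :: "('o, 'm) dbun"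
  assumes "tangent_actegory \<XX>" and "tangent_actegory \<YY>"
    and "is_terminal (tcat \<XX>) pt"
    and T_terminal: "is_terminal (tcat \<XX>) (Tob \<XX> weil_W pt)"
    and "differential_bundle \<XX> A" and "bbase A = pt"
  shows "is_functor (DiffFun \<XX> pt \<YY>) (DBun_add \<YY>) (Eval \<YY> A) \<and>
    is_functor (DiffFun_lin \<XX> pt \<YY>) (DBun_lin \<YY>) (Eval \<YY> A) \<and>
    is_functor (DiffFun_strong \<XX> pt \<YY>) (DObj_add \<YY>) (Eval \<YY> A) \<and>
    is_functor (DiffFun_strong_lin \<XX> pt \<YY>) (DObj_lin \<YY>) (Eval \<YY> A)"
proof -
  interpret X: tangent_actegory \<XX> by fact
  interpret Y: tangent_actegory \<YY> by fact
  have add: "is_functor (DiffFun \<XX> pt \<YY>) (DBun_add \<YY>) (Eval \<YY> A)"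
    using category_DiffFun[OF X.base_category Y.base_category] category_DBun_add[OF Y.base_category]
    unfolding DiffFun_def DBun_add_def
    by (rule Eval_functor[OF assms]) (rule eval_additive[OF assms])
  have lin: "is_functor (DiffFun_lin \<XX> pt \<YY>) (DBun_lin \<YY>) (Eval \<YY> A)"
    using category_DiffFun_lin[OF X.weil_actegory_axioms Y.weil_actegory_axioms] Y.category_DBun_lin
    unfolding DiffFun_lin_def DBun_lin_def
    by (rule Eval_functor[OF assms]) (rule eval_linear[OF assms])
  have strong: "obj_map (Eval \<YY> A) \<F> \<in> {B. is_terminal (tcat \<YY>) (bbase B)}"
    if "\<F> \<in> strong_functors pt \<YY>" for \<F> :: "('o, 'm, 'p, 'n) oplax"
    using that \<open>bbase A = pt\<close> by (simp add: strong_functors_def Eval_def eval_bundle_def Let_def)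
  show ?thesis
    unfolding DiffFun_strong_def DiffFun_strong_lin_def DObj_add_def DObj_lin_def
    using add lin functor_full_subcat[OF add strong] functor_full_subcat[OF lin strong] by blast
qed

end
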